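(* Let $\mathcal{C}$ be a non-zero $A$-coring with ${}_A\mathcal{C}$ locally projective and let $M$ be a non-zero right $\mathcal{C}$-comodule that is self-injective and self-cogenerator, with $\mathrm{End}^{\mathcal{C}}(M)$ commutative. If $M$ is fully coprime, then $M$ is irreducible.
   Context: $R$ is a commutative ring with $1\neq 0$, $A$ is a unital $R$-algebra, $\mathcal{C}$ is an $A$-coring (a coalgebra in the monoidal category of $(A,A)$-bimodules), and comodules are right $\mathcal{C}$-comodules with $\mathcal{C}$-colinear maps. A left $A$-module $W$ is locally projective (in the sense of Zimmermann-Huisgen) if for every finitely generated submodule $F\subseteq W$, every surjective $A$-linear $\pi:L\to N$ and every $A$-linear $g:W\to N$ there is an $A$-linear $g':W\to L$ with $\pi g'|_F=g|_F$. Locally projective modules are flat, so $\mathbb{M}^{\mathcal{C}}$ is a Grothendieck category with kernels formed in right $A$-modules. $M$ is self-injective if for every subcomodule $K\subseteq M$ every colinear map $K\to M$ extends to a colinear endomorphism of $M$; self-cogenerator if for every subcomodule $K\subseteq M$ the intersection of the kernels of all $h\in\mathrm{Hom}^{\mathcal{C}}(M/K,M)$ is $0$ (i.e. $M$ cogenerates all its factor comodules). A subcomodule $X\subseteq M$ is fully invariant if $f(X)\subseteq X$ for all $f\in\mathrm{End}^{\mathcal{C}}(M)$. For subcomodules $X,Y\subseteq M$ let $(X:_M^{\mathcal{C}}Y):=\bigcap\{f^{-1}(Y): f\in \mathrm{End}^{\mathcal{C}}(M),\ f(X)=0\}$. $M\neq 0$ is fully coprime if for any fully invariant subcomodules $X,Y\subseteq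 M$ with $M=(X:_M^{\mathcal{C}}Y)$ one has $X=M$ or $Y=M$. $M$ is irreducible if it has a unique simple $\mathcal{C}$-subcomodule that is contained in every non-zero $\mathcal{C}$-subcomodule of $M$ (equivalently, the intersection of all non-zero $\mathcal{C}$-subcomodules of $M$ is non-zero). *)

theory Defs
  imports "HOL-Algebra.Free_Abelian_Groups" "HOL-Algebra.Module" "HOL-Algebra.AbelCoset" "HOL.Hull"
begin

text \<open>
  Conventions.  Rings and modules are HOL-Algebra records, and maps between them are ordinary
  functions of which only the values on the carrier matter.  The library locale
  \<^locale>\<open>module\<close> requires a commutative base ring, so left and right modules over an arbitrary
  ring are introduced here.
\<close>

section \<open>Algebras and modules\<close>

locale unital_algebra = module R A + ring A for R and A :: "('r, 'a, 'z) module_scheme" (structure) +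
  assumes smult_assoc_left: "\<lbrakk>r \<in> carrier R; a \<in> carrier A; b \<in> carrier A\<rbrakk>
      \<Longrightarrow> (r \<odot> a) \<otimes> b = r \<odot> (a \<otimes> b)"
    and smult_assoc_right: "\<lbrakk>r \<in> carrier R; a \<in> carrier A; b \<in> carrier A\<rbrakk>
      \<Longrightarrow> a \<otimes> (r \<odot> b) = r \<odot> (a \<otimes> b)"

locale left_module = ring A + M: abelian_group M
  for A :: "('a, 'q) ring_scheme" (structure) and M :: "('a, 'b, 'z) module_scheme" +
  assumes lsm_closed: "\<lbrakk>a \<in> carrier A; x \<in> carrier M\<rbrakk> \<Longrightarrow> a \<odot>\<^bsub>M\<^esub> x \<in> carrier M"
    and lsm_l_distr: "\<lbrakk>a \<in> carrier A; b \<in> carrier A; x \<in> carrier M\<rbrakk>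
      \<Longrightarrow> (a \<oplus> b) \<odot>\<^bsub>M\<^esub> x = a \<odot>\<^bsub>M\<^esub> x \<oplus>\<^bsub>M\<^esub> b \<odot>\<^bsub>M\<^esub> x"
    and lsm_r_distr: "\<lbrakk>a \<in> carrier A; x \<in> carrier M; y \<in> carrier M\<rbrakk>
      \<Longrightarrow> a \<odot>\<^bsub>M\<^esub> (x \<oplus>\<^bsub>M\<^esub> y) = a \<odot>\<^bsub>M\<^esub> x \<oplus>\<^bsub>M\<^esub> a \<odot>\<^bsub>M\<^esub> y"
    and lsm_assoc: "\<lbrakk>a \<in> carrier A; b \<in> carrier A; x \<in> carrier M\<rbrakk>
      \<Longrightarrow> (a \<otimes> b) \<odot>\<^bsub>M\<^esub> x = a \<odot>\<^bsub>M\<^esub> (b \<odot>\<^bsub>M\<^esub> x)"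
    and lsm_one: "x \<in> carrier M \<Longrightarrow> \<one> \<odot>\<^bsub>M\<^esub> x = x"

definition left_hom ::
  "('a, 'z) ring_scheme \<Rightarrow> ('a, 'b, 'y) module_scheme \<Rightarrow> ('a, 'd, 'x) module_scheme \<Rightarrow> ('b \<Rightarrow> 'd) set"
  where "left_hom A M N = {f \<in> carrier M \<rightarrow> carrier N.
    (\<forall>x \<in> carrier M. \<forall>y \<in> carrier M. f (x \<oplus>\<^bsub>M\<^esub> y) = f x \<oplus>\<^bsub>N\<^esub> f y) \<and>
    (\<forall>a \<in> carrier A. \<forall>x \<in> carrier M. f (a \<odot>\<^bsub>M\<^esub> x) = a \<odot>\<^bsub>N\<^esub> f x)}"

text \<open>
  As for the library's modules, the multiplicative structure of the underlying ring record
  is junk: a right module only uses \<^const>\<open>carrier\<close>, \<^const>\<open>zero\<close>, \<^const>\<open>add\<close> and the action.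
\<close>

record ('a, 'b) rmodule = "'b ring" +
  ract :: "'b \<Rightarrow> 'a \<Rightarrow> 'b"

record ('a, 'b) bimodule = "('a, 'b) rmodule" +
  lact :: "'a \<Rightarrow> 'b \<Rightarrow> 'b"

locale right_module = ring A + M: abelian_group M
  for A :: "('a, 'q) ring_scheme" (structure) and M :: "('a, 'b, 'z) rmodule_scheme" +
  assumes ract_closed: "\<lbrakk>a \<in> carrier A; x \<in> carrier M\<rbrakk> \<Longrightarrow> ract M x a \<in> carrier M"
    and ract_r_distr: "\<lbrakk>a \<in> carrier A; b \<in> carrier A; x \<in> carrier M\<rbrakk>
      \<Longrightarrow> ract M x (a \<oplus> b) = ract M x a \<oplus>\<^bsub>M\<^esub> ract M x b"
    and ract_l_distr: "\<lbrakk>a \<in> carrier A; x \<in> carrier M; y \<in> carrier M\<rbrakk>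
      \<Longrightarrow> ract M (x \<oplus>\<^bsub>M\<^esub> y) a = ract M x a \<oplus>\<^bsub>M\<^esub> ract M y a"
    and ract_assoc: "\<lbrakk>a \<in> carrier A; b \<in> carrier A; x \<in> carrier M\<rbrakk>
      \<Longrightarrow> ract M x (a \<otimes> b) = ract M (ract M x a) b"
    and ract_one: "x \<in> carrier M \<Longrightarrow> ract M x \<one> = x"

definition right_hom ::
  "('a, 'z) ring_scheme \<Rightarrow> ('a, 'b, 'y) rmodule_scheme \<Rightarrow> ('a, 'd, 'x) rmodule_scheme \<Rightarrow> ('b \<Rightarrow> 'd) set"
  where "right_hom A M N = {f \<in> carrier M \<rightarrow> carrier N.
    (\<forall>x \<in> carrier M. \<forall>y \<in> carrier M. f (x \<oplus>\<^bsub>M\<^esub> y) = f x \<oplus>\<^bsub>N\<^esub> f y) \<and>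
    (\<forall>a \<in> carrier A. \<forall>x \<in> carrier M. f (ract M x a) = ract N (f x) a)}"

definition left_part :: "('a, 'b, 'z) bimodule_scheme \<Rightarrow> ('a, 'b) module"
  where "left_part B = \<lparr>carrier = carrier B, mult = mult B, one = one B,
    zero = zero B, add = add B, smult = lact B\<rparr>"

locale bimodule = right_module A B + left: left_module A "left_part B"
  for A :: "('a, 'q) ring_scheme" (structure) and B :: "('a, 'b, 'z) bimodule_scheme" +
  assumes act_assoc: "\<lbrakk>a \<in> carrier A; b \<in> carrier A; x \<in> carrier B\<rbrakk>
      \<Longrightarrow> ract B (lact B a x) b = lact B a (ract B x b)"


section \<open>Tensor products over a ring\<close>

text \<open>
  The tensor product of a right module \<open>M\<close> and a bimodule \<open>N\<close> over \<open>A\<close> is the free abelian group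
  on \<open>carrier M \<times> carrier N\<close> modulo the usual relations; its elements are cosets.
\<close>

type_synonym ('b, 'd) tens = "('b \<times> 'd \<Rightarrow>\<^sub>0 int) set"

definition tensor_rel ::
  "('a, 'z) ring_scheme \<Rightarrow> ('a, 'b, 'y) rmodule_scheme \<Rightarrow> ('a, 'd, 'x) bimodule_scheme \<Rightarrow> ('b, 'd) tens"
  where "tensor_rel A M N = generate (free_Abelian_group (carrier M \<times> carrier N))
    ({frag_of (x \<oplus>\<^bsub>M\<^esub> x', y) - frag_of (x, y) - frag_of (x', y) | x x' y.
        x \<in> carrier M \<and> x' \<in> carrier M \<and> y \<in> carrier N} \<union>
     {frag_of (x, y \<oplus>\<^bsub>N\<^esub> y') - frag_of (x, y) - frag_of (x, y') | x y y'.
        x \<in> carrier M \<and> y \<in> carrier N \<and> y' \<in> carrier N} \<union>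
     {frag_of (ract M x a, y) - frag_of (x, lact N a y) | x a y.
        x \<in> carrier M \<and> a \<in> carrier A \<and> y \<in> carrier N})"

definition tensor_group ::
  "('a, 'z) ring_scheme \<Rightarrow> ('a, 'b, 'y) rmodule_scheme \<Rightarrow> ('a, 'd, 'x) bimodule_scheme \<Rightarrow> ('b, 'd) tens monoid"
  where "tensor_group A M N = free_Abelian_group (carrier M \<times> carrier N) Mod tensor_rel A M N"

definition pure_tensor ::
  "('a, 'z) ring_scheme \<Rightarrow> ('a, 'b, 'y) rmodule_scheme \<Rightarrow> ('a, 'd, 'x) bimodule_scheme \<Rightarrow> 'b \<Rightarrow> 'd \<Rightarrow> ('b, 'd) tens"
  where "pure_tensor A M N x y =
    tensor_rel A M N #>\<^bsub>free_Abelian_group (carrier M \<times> carrier N)\<^esub> frag_of (x, y)"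

text \<open>
  The additive map out of a tensor product that is induced by a balanced biadditive map \<open>\<beta>\<close>
  with values in \<open>T\<close>; it is independent of the chosen representative of the coset \<open>t\<close>.
\<close>

definition tensor_lift :: "('e, 'z) ring_scheme \<Rightarrow> ('b \<Rightarrow> 'd \<Rightarrow> 'e) \<Rightarrow> ('b, 'd) tens \<Rightarrow> 'e"
  where "tensor_lift T \<beta> t = the_elem
    ((\<lambda>u. finsum T (\<lambda>(x, y). [Poly_Mapping.lookup u (x, y)] \<cdot>\<^bsub>T\<^esub> \<beta> x y) (Poly_Mapping.keys u)) ` t)"

definition tensor_ring ::
  "('a, 'z) ring_scheme \<Rightarrow> ('a, 'b, 'y) rmodule_scheme \<Rightarrow> ('a, 'd, 'x) bimodule_scheme \<Rightarrow> ('b, 'd) tens ring"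
  where "tensor_ring A M N = \<lparr>carrier = carrier (tensor_group A M N), mult = undefined, one = undefined,
    zero = one (tensor_group A M N), add = mult (tensor_group A M N)\<rparr>"

definition tensor ::
  "('a, 'z) ring_scheme \<Rightarrow> ('a, 'b, 'y) rmodule_scheme \<Rightarrow> ('a, 'd, 'x) bimodule_scheme
    \<Rightarrow> ('a, ('b, 'd) tens) rmodule"
  where "tensor A M N = ring.extend (tensor_ring A M N)
    \<lparr>ract = \<lambda>t a. tensor_lift (tensor_ring A M N) (\<lambda>x y. pure_tensor A M N x (ract N y a)) t\<rparr>"

definition bitensor ::
  "('a, 'z) ring_scheme \<Rightarrow> ('a, 'b, 'y) bimodule_scheme \<Rightarrow> ('a, 'd, 'x) bimodule_scheme
    \<Rightarrow> ('a, ('b, 'd) tens) bimodule"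
  where "bitensor A M N = rmodule.extend (tensor A M N)
    \<lparr>lact = \<lambda>a t. tensor_lift (tensor_ring A M N) (\<lambda>x y. pure_tensor A M N (lact M a x) y) t\<rparr>"

text \<open>\<open>tensor_map A M' N' f g\<close> is \<open>f \<otimes> g\<close> with codomain \<open>M' \<otimes> N'\<close>.\<close>

definition tensor_map ::
  "('a, 'z) ring_scheme \<Rightarrow> ('a, 'b, 'y) rmodule_scheme \<Rightarrow> ('a, 'd, 'x) bimodule_scheme
    \<Rightarrow> ('e \<Rightarrow> 'b) \<Rightarrow> ('f \<Rightarrow> 'd) \<Rightarrow> ('e, 'f) tens \<Rightarrow> ('b, 'd) tens"
  where "tensor_map A M' N' f g =
    tensor_lift (tensor A M' N') (\<lambda>x y. pure_tensor A M' N' (f x) (g y))"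

text \<open>The canonical map \<open>(M \<otimes> N) \<otimes> P \<rightarrow> M \<otimes> (N \<otimes> P)\<close>.\<close>

definition tensor_assoc ::
  "('a, 'z) ring_scheme \<Rightarrow> ('a, 'b, 'y) rmodule_scheme \<Rightarrow> ('a, 'd, 'x) bimodule_scheme
    \<Rightarrow> ('a, 'e, 'w) bimodule_scheme \<Rightarrow> (('b, 'd) tens, 'e) tens \<Rightarrow> ('b, ('d, 'e) tens) tens"
  where "tensor_assoc A M N P =
    (let T = tensor A M (bitensor A N P) in
      tensor_lift T (\<lambda>t z.
        tensor_lift T (\<lambda>x y. pure_tensor A M (bitensor A N P) x (pure_tensor A N P y z)) t))"


section \<open>Corings and comodules\<close>

record ('a, 'c) coring = "('a, 'c) bimodule" +
  comult :: "'c \<Rightarrow> ('c, 'c) tens"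
  counit :: "'c \<Rightarrow> 'a"

text \<open>
  The counit laws use the canonical isomorphisms \<open>A \<otimes> C \<cong> C\<close> and \<open>C \<otimes> A \<cong> C\<close>: they say that
  \<open>\<Sum> \<epsilon>(c\<^sub>1) c\<^sub>2 = c = \<Sum> c\<^sub>1 \<epsilon>(c\<^sub>2)\<close>.
\<close>

locale coring = bimodule A C
  for A :: "('a, 'q) ring_scheme" (structure) and C :: "('a, 'c, 'z) coring_scheme" +
  assumes comult_right: "comult C \<in> right_hom A C (bitensor A C C)"
    and comult_left: "comult C \<in> left_hom A (left_part C) (left_part (bitensor A C C))"
    and counit_closed: "counit C \<in> carrier C \<rightarrow> carrier A"
    and counit_add: "\<lbrakk>x \<in> carrier C; y \<in> carrier C\<rbrakk>
      \<Longrightarrow> counit C (x \<oplus>\<^bsub>C\<^esub> y) = counit C x \<oplus> counit C y"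
    and counit_right: "\<lbrakk>a \<in> carrier A; x \<in> carrier C\<rbrakk> \<Longrightarrow> counit C (ract C x a) = counit C x \<otimes> a"
    and counit_left: "\<lbrakk>a \<in> carrier A; x \<in> carrier C\<rbrakk> \<Longrightarrow> counit C (lact C a x) = a \<otimes> counit C x"
    and coassoc: "x \<in> carrier C \<Longrightarrow>
      tensor_assoc A C C C (tensor_map A (bitensor A C C) C (comult C) (\<lambda>y. y) (comult C x)) =
      tensor_map A C (bitensor A C C) (\<lambda>y. y) (comult C) (comult C x)"
    and counit_law_left: "x \<in> carrier C \<Longrightarrow>
      tensor_lift C (\<lambda>y z. lact C (counit C y) z) (comult C x) = x"
    and counit_law_right: "x \<in> carrier C \<Longrightarrow>
      tensor_lift C (\<lambda>y z. ract C y (counit C z)) (comult C x) = x"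

record ('a, 'c, 'm) comodule = "('a, 'm) rmodule" +
  coact :: "'m \<Rightarrow> ('m, 'c) tens"

locale right_comodule = coring A C + M: right_module A M
  for A :: "('a, 'q) ring_scheme" (structure) and C :: "('a, 'c, 'y) coring_scheme" and M :: "('a, 'c, 'm, 'z) comodule_scheme" +
  assumes coact_hom: "coact M \<in> right_hom A M (tensor A M C)"
    and coact_coassoc: "x \<in> carrier M \<Longrightarrow>
      tensor_assoc A M C C (tensor_map A (tensor A M C) C (coact M) (\<lambda>y. y) (coact M x)) =
      tensor_map A M (bitensor A C C) (\<lambda>y. y) (comult C) (coact M x)"
    and coact_counit: "x \<in> carrier M \<Longrightarrow>
      tensor_lift M (\<lambda>y z. ract M y (counit C z)) (coact M x) = x"

definition comod_hom ::
  "('a, 'z) ring_scheme \<Rightarrow> ('a, 'c, 'y) coring_scheme \<Rightarrow> ('a, 'c, 'm, 'x) comodule_scheme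
    \<Rightarrow> ('a, 'c, 'n, 'w) comodule_scheme \<Rightarrow> ('m \<Rightarrow> 'n) set"
  where "comod_hom A C M N = {f \<in> right_hom A M N.
    \<forall>x \<in> carrier M. coact N (f x) = tensor_map A N C f (\<lambda>y. y) (coact M x)}"

definition commutative_comod_end ::
  "('a, 'z) ring_scheme \<Rightarrow> ('a, 'c, 'y) coring_scheme \<Rightarrow> ('a, 'c, 'm, 'x) comodule_scheme \<Rightarrow> bool"
  where "commutative_comod_end A C M \<longleftrightarrow>
    (\<forall>f \<in> comod_hom A C M M. \<forall>g \<in> comod_hom A C M M. \<forall>x \<in> carrier M. f (g x) = g (f x))"


section \<open>Subcomodules and factor comodules\<close>

text \<open>
  A subcomodule is a subset of \<open>M\<close> which is a comodule for the operations of \<open>M\<close> and some coaction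
  \<open>\<rho>\<close> with values in \<open>K \<otimes> C\<close>, such that the inclusion is colinear.  (The coaction is unique if
  \<open>C\<close> is flat as a left \<open>A\<close>-module.)  The elements of \<open>K \<otimes> C\<close> are cosets in a free group on
  \<open>K \<times> C\<close>, so \<open>\<rho>\<close> is not literally a restriction of the coaction of \<open>M\<close>.
\<close>

definition subcomodule_via ::
  "('a, 'z) ring_scheme \<Rightarrow> ('a, 'c, 'y) coring_scheme \<Rightarrow> ('a, 'c, 'm, 'x) comodule_scheme
    \<Rightarrow> 'm set \<Rightarrow> ('m \<Rightarrow> ('m, 'c) tens) \<Rightarrow> bool"
  where "subcomodule_via A C M K \<rho> \<longleftrightarrow>
    right_comodule A C (M\<lparr>carrier := K, coact := \<rho>\<rparr>) \<and>
    (\<lambda>x. x) \<in> comod_hom A C (M\<lparr>carrier := K, coact := \<rho>\<rparr>) M"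

definition subcomodule ::
  "('a, 'z) ring_scheme \<Rightarrow> ('a, 'c, 'y) coring_scheme \<Rightarrow> ('a, 'c, 'm, 'x) comodule_scheme
    \<Rightarrow> 'm set \<Rightarrow> bool"
  where "subcomodule A C M K \<longleftrightarrow> (\<exists>\<rho>. subcomodule_via A C M K \<rho>)"

definition factor_module :: "('a, 'm, 'z) rmodule_scheme \<Rightarrow> 'm set \<Rightarrow> ('a, 'm set) rmodule"
  where "factor_module M K = \<lparr>carrier = a_rcosets\<^bsub>M\<^esub> K, mult = undefined, one = undefined,
    zero = K, add = set_add M,
    ract = \<lambda>X a. the_elem ((\<lambda>x. K +>\<^bsub>M\<^esub> ract M x a) ` X)\<rparr>"

text \<open>The coaction of \<open>M / K\<close> is induced by \<open>(p \<otimes> id) \<circ> \<rho>\<close>, where \<open>p\<close> is the projection.\<close>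

definition factor_comodule ::
  "('a, 'z) ring_scheme \<Rightarrow> ('a, 'c, 'y) coring_scheme \<Rightarrow> ('a, 'c, 'm, 'x) comodule_scheme
    \<Rightarrow> 'm set \<Rightarrow> ('a, 'c, 'm set) comodule"
  where "factor_comodule A C M K = rmodule.extend (factor_module M K)
    \<lparr>coact = \<lambda>X. the_elem
      ((\<lambda>x. tensor_map A (factor_module M K) C (\<lambda>y. K +>\<^bsub>M\<^esub> y) (\<lambda>c. c) (coact M x)) ` X)\<rparr>"

definition self_injective ::
  "('a, 'z) ring_scheme \<Rightarrow> ('a, 'c, 'y) coring_scheme \<Rightarrow> ('a, 'c, 'm, 'x) comodule_scheme \<Rightarrow> bool"
  where "self_injective A C M \<longleftrightarrow>
    (\<forall>K \<rho>. subcomodule_via A C M K \<rho> \<longrightarrow>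
      (\<forall>f \<in> comod_hom A C (M\<lparr>carrier := K, coact := \<rho>\<rparr>) M.
        \<exists>g \<in> comod_hom A C M M. \<forall>x \<in> K. g x = f x))"

definition self_cogenerator ::
  "('a, 'z) ring_scheme \<Rightarrow> ('a, 'c, 'y) coring_scheme \<Rightarrow> ('a, 'c, 'm, 'x) comodule_scheme \<Rightarrow> bool"
  where "self_cogenerator A C M \<longleftrightarrow>
    (\<forall>K. subcomodule A C M K \<longrightarrow>
      (\<Inter>h \<in> comod_hom A C (factor_comodule A C M K) M. a_kernel (factor_comodule A C M K) M h)
        = {\<zero>\<^bsub>factor_comodule A C M K\<^esub>})"


section \<open>Fully coprime and irreducible comodules\<close>

definition fully_invariant ::
  "('a, 'z) ring_scheme \<Rightarrow> ('a, 'c, 'y) coring_scheme \<Rightarrow> ('a, 'c, 'm, 'x) comodule_scheme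
    \<Rightarrow> 'm set \<Rightarrow> bool"
  where "fully_invariant A C M X \<longleftrightarrow>
    subcomodule A C M X \<and> (\<forall>f \<in> comod_hom A C M M. f ` X \<subseteq> X)"

definition internal_coproduct ::
  "('a, 'z) ring_scheme \<Rightarrow> ('a, 'c, 'y) coring_scheme \<Rightarrow> ('a, 'c, 'm, 'x) comodule_scheme
    \<Rightarrow> 'm set \<Rightarrow> 'm set \<Rightarrow> 'm set"
  where "internal_coproduct A C M X Y =
    \<Inter> {f -` Y \<inter> carrier M | f. f \<in> comod_hom A C M M \<and> (\<forall>x \<in> X. f x = \<zero>\<^bsub>M\<^esub>)}"

definition fully_coprime ::
  "('a, 'z) ring_scheme \<Rightarrow> ('a, 'c, 'y) coring_scheme \<Rightarrow> ('a, 'c, 'm, 'x) comodule_scheme \<Rightarrow> bool"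
  where "fully_coprime A C M \<longleftrightarrow> carrier M \<noteq> {\<zero>\<^bsub>M\<^esub>} \<and>
    (\<forall>X Y. fully_invariant A C M X \<and> fully_invariant A C M Y \<and>
      carrier M = internal_coproduct A C M X Y \<longrightarrow> X = carrier M \<or> Y = carrier M)"

definition simple_comodule ::
  "('a, 'z) ring_scheme \<Rightarrow> ('a, 'c, 'y) coring_scheme \<Rightarrow> ('a, 'c, 'm, 'x) comodule_scheme \<Rightarrow> bool"
  where "simple_comodule A C N \<longleftrightarrow> carrier N \<noteq> {\<zero>\<^bsub>N\<^esub>} \<and>
    (\<forall>K. subcomodule A C N K \<longrightarrow> K = {\<zero>\<^bsub>N\<^esub>} \<or> K = carrier N)"

definition simple_subcomodule ::
  "('a, 'z) ring_scheme \<Rightarrow> ('a, 'c, 'y) coring_scheme \<Rightarrow> ('a, 'c, 'm, 'x) comodule_scheme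
    \<Rightarrow> 'm set \<Rightarrow> bool"
  where "simple_subcomodule A C M S \<longleftrightarrow>
    (\<exists>\<rho>. subcomodule_via A C M S \<rho> \<and> simple_comodule A C (M\<lparr>carrier := S, coact := \<rho>\<rparr>))"

definition irreducible_comodule ::
  "('a, 'z) ring_scheme \<Rightarrow> ('a, 'c, 'y) coring_scheme \<Rightarrow> ('a, 'c, 'm, 'x) comodule_scheme \<Rightarrow> bool"
  where "irreducible_comodule A C M \<longleftrightarrow>
    (\<exists>!S. simple_subcomodule A C M S \<and>
      (\<forall>K. subcomodule A C M K \<and> K \<noteq> {\<zero>\<^bsub>M\<^esub>} \<longrightarrow> S \<subseteq> K))"


section \<open>Locally projective modules\<close>

definition finitely_generated_submodule ::
  "('a, 'z) ring_scheme \<Rightarrow> ('a, 'w, 'y) module_scheme \<Rightarrow> 'w set \<Rightarrow> bool"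
  where "finitely_generated_submodule A W F \<longleftrightarrow>
    (\<exists>S. finite S \<and> S \<subseteq> carrier W \<and> F = (\<lambda>H. submodule H A W) hull S)"

definition local_lifting ::
  "('a, 'z) ring_scheme \<Rightarrow> ('a, 'w, 'y) module_scheme \<Rightarrow> ('a, 'l) module \<Rightarrow> ('a, 'n) module \<Rightarrow> bool"
  where "local_lifting A W L N \<longleftrightarrow>
    (\<forall>F \<pi> g. finitely_generated_submodule A W F \<and>
      \<pi> \<in> left_hom A L N \<and> \<pi> ` carrier L = carrier N \<and> g \<in> left_hom A W N \<longrightarrow>
      (\<exists>g' \<in> left_hom A W L. \<forall>x \<in> F. \<pi> (g' x) = g x))"

text \<open>
  HOL cannot quantify over the carrier types of \<open>L\<close> and \<open>N\<close> inside a definition.  The types used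
  here are large enough to contain \<open>N = W\<close> and, as \<open>L\<close>, the free module on \<open>W\<close>; lemma
  \<open>locally_projective_universal\<close> below shows that the lifting property then holds for modules
  \<open>L\<close> and \<open>N\<close> over arbitrary types.
\<close>

definition locally_projective :: "('a, 'z) ring_scheme \<Rightarrow> ('a, 'w, 'y) module_scheme \<Rightarrow> bool"
  where "locally_projective A W \<longleftrightarrow> left_module A W \<and>
    (\<forall>(L :: ('a, 'w \<Rightarrow> 'a) module) (N :: ('a, 'w) module).
      left_module A L \<and> left_module A N \<longrightarrow> local_lifting A W L N)"


definition free_left_module :: "('a, 'z) ring_scheme \<Rightarrow> 'w set \<Rightarrow> ('a, 'w \<Rightarrow> 'a) module"
  where "free_left_module A X = \<lparr>carrier = {\<phi>. (\<forall>w. \<phi> w \<in> carrier A) \<and> {w. \<phi> w \<noteq> \<zero>\<^bsub>A\<^esub>} \<subseteq> X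
      \<and> finite {w. \<phi> w \<noteq> \<zero>\<^bsub>A\<^esub>}},
    mult = undefined, one = undefined, zero = \<lambda>_. \<zero>\<^bsub>A\<^esub>, add = \<lambda>\<phi> \<psi> w. \<phi> w \<oplus>\<^bsub>A\<^esub> \<psi> w,
    smult = \<lambda>a \<phi> w. a \<otimes>\<^bsub>A\<^esub> \<phi> w\<rparr>"

definition free_eval :: "('a, 'z) ring_scheme \<Rightarrow> ('a, 'b, 'y) module_scheme \<Rightarrow> ('w \<Rightarrow> 'b) \<Rightarrow> ('w \<Rightarrow> 'a) \<Rightarrow> 'b"
  where "free_eval A N t \<phi> = finsum N (\<lambda>w. \<phi> w \<odot>\<^bsub>N\<^esub> t w) {w. \<phi> w \<noteq> \<zero>\<^bsub>A\<^esub>}"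

lemma (in left_module) lsm_zero_left:
  assumes "x \<in> carrier M" shows "\<zero> \<odot>\<^bsub>M\<^esub> x = \<zero>\<^bsub>M\<^esub>"
proof -
  have "\<zero> \<odot>\<^bsub>M\<^esub> x \<oplus>\<^bsub>M\<^esub> \<zero> \<odot>\<^bsub>M\<^esub> x = \<zero> \<odot>\<^bsub>M\<^esub> x"
    using lsm_l_distr[of \<zero> \<zero> x] assms by simp
  then show ?thesis
    using assms lsm_closed[of \<zero> x] M.add.l_cancel_one' by (metis zero_closed)
qed

lemma left_hom_zero:
  assumes "left_module A M" "left_module A N" "f \<in> left_hom A M N"
  shows "f \<zero>\<^bsub>M\<^esub> = \<zero>\<^bsub>N\<^esub>"
proof -
  interpret M: left_module A M by fact
  interpret N: left_module A N by fact
  have c: "f \<zero>\<^bsub>M\<^esub> \<in> carrier N" using assms(3) by (auto simp: left_hom_def)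
  have "f (\<zero>\<^bsub>M\<^esub> \<oplus>\<^bsub>M\<^esub> \<zero>\<^bsub>M\<^esub>) = f \<zero>\<^bsub>M\<^esub> \<oplus>\<^bsub>N\<^esub> f \<zero>\<^bsub>M\<^esub>"
    using assms(3) M.M.zero_closed unfolding left_hom_def by blast
  then have "f \<zero>\<^bsub>M\<^esub> \<oplus>\<^bsub>N\<^esub> f \<zero>\<^bsub>M\<^esub> = f \<zero>\<^bsub>M\<^esub>" by simp
  then show ?thesis using c N.M.add.l_cancel_one' by metis
qed

lemma left_hom_finsum:
  assumes "left_module A M" "left_module A N" "f \<in> left_hom A M N" "finite I" "u \<in> I \<rightarrow> carrier M"
  shows "f (finsum M u I) = finsum N (\<lambda>i. f (u i)) I"
proof -
  interpret M: left_module A M by fact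
  interpret N: left_module A N by fact
  have fc: "f x \<in> carrier N" if "x \<in> carrier M" for x using assms(3) that by (auto simp: left_hom_def)
  have fa: "f (x \<oplus>\<^bsub>M\<^esub> y) = f x \<oplus>\<^bsub>N\<^esub> f y" if "x \<in> carrier M" "y \<in> carrier M" for x y
    using assms(3) that by (auto simp: left_hom_def)
  show ?thesis using assms(4,5)
  proof (induction I rule: finite_induct)
    case empty
    then show ?case using left_hom_zero[OF assms(1-3)] by simp
  next
    case (insert i I)
    then have u: "u i \<in> carrier M" "u \<in> I \<rightarrow> carrier M" by auto
    then have fu: "(\<lambda>i. f (u i)) \<in> I \<rightarrow> carrier N" "f (u i) \<in> carrier N" using fc by auto
    show ?case
      using insert u fu by (simp add: M.M.finsum_insert N.M.finsum_insert fa M.M.finsum_closed)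
  qed
qed

lemma (in left_module) free_eval_superset:
  assumes "finite I" "{w. \<phi> w \<noteq> \<zero>} \<subseteq> I" "t \<in> I \<rightarrow> carrier M" "\<phi> \<in> I \<rightarrow> carrier A"
  shows "free_eval A M t \<phi> = finsum M (\<lambda>w. \<phi> w \<odot>\<^bsub>M\<^esub> t w) I"
  unfolding free_eval_def
proof (rule M.add.finprod_mono_neutral_cong_left)
  fix i assume "i \<in> I - {w. \<phi> w \<noteq> \<zero>}"
  then have "\<phi> i = \<zero>" "t i \<in> carrier M" using assms(3) by auto
  then show "\<phi> i \<odot>\<^bsub>M\<^esub> t i = \<zero>\<^bsub>M\<^esub>" using lsm_zero_left by simp
next
  show "(\<lambda>w. \<phi> w \<odot>\<^bsub>M\<^esub> t w) \<in> I \<rightarrow> carrier M" using assms lsm_closed by blast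
qed (use assms in auto)

lemma left_module_free:
  assumes "ring A" shows "left_module A (free_left_module A X)"
proof -
  interpret ring A by fact
  let ?L = "free_left_module A X"
  have fin: "finite {w. \<phi> w \<oplus>\<^bsub>A\<^esub> \<psi> w \<noteq> \<zero>\<^bsub>A\<^esub>} \<and> {w. \<phi> w \<oplus>\<^bsub>A\<^esub> \<psi> w \<noteq> \<zero>\<^bsub>A\<^esub>} \<subseteq> X"
    if "\<phi> \<in> carrier ?L" "\<psi> \<in> carrier ?L" for \<phi> \<psi>
  proof -
    have "{w. \<phi> w \<oplus>\<^bsub>A\<^esub> \<psi> w \<noteq> \<zero>\<^bsub>A\<^esub>} \<subseteq> {w. \<phi> w \<noteq> \<zero>\<^bsub>A\<^esub>} \<union> {w. \<psi> w \<noteq> \<zero>\<^bsub>A\<^esub>}" by auto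
    moreover have "finite \<dots>" "\<dots> \<subseteq> X" using that by (auto simp: free_left_module_def)
    ultimately show ?thesis by (meson finite_subset subset_trans)
  qed
  have fin2: "finite {w. a \<otimes>\<^bsub>A\<^esub> \<phi> w \<noteq> \<zero>\<^bsub>A\<^esub>} \<and> {w. a \<otimes>\<^bsub>A\<^esub> \<phi> w \<noteq> \<zero>\<^bsub>A\<^esub>} \<subseteq> X"
    if "\<phi> \<in> carrier ?L" "a \<in> carrier A" for \<phi> a
  proof -
    have "{w. a \<otimes>\<^bsub>A\<^esub> \<phi> w \<noteq> \<zero>\<^bsub>A\<^esub>} \<subseteq> {w. \<phi> w \<noteq> \<zero>\<^bsub>A\<^esub>}" using that(2) by auto
    moreover have "finite \<dots>" "\<dots> \<subseteq> X" using that by (auto simp: free_left_module_def)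
    ultimately show ?thesis by (meson finite_subset subset_trans)
  qed
  have ag: "abelian_group ?L"
  proof (rule abelian_groupI)
    fix \<phi> \<psi> assume "\<phi> \<in> carrier ?L" "\<psi> \<in> carrier ?L"
    then show "\<phi> \<oplus>\<^bsub>?L\<^esub> \<psi> \<in> carrier ?L" using fin[of \<phi> \<psi>] by (simp add: free_left_module_def)
  next
    fix \<phi> assume p: "\<phi> \<in> carrier ?L"
    have c: "\<phi> w \<in> carrier A" for w using p by (simp add: free_left_module_def)
    have i: "\<ominus>\<^bsub>A\<^esub> \<phi> w = \<zero>\<^bsub>A\<^esub> \<longleftrightarrow> \<phi> w = \<zero>\<^bsub>A\<^esub>" for w
      using c[of w] by (metis a_inv_closed minus_minus minus_zero)
    show "\<exists>\<psi>\<in>carrier ?L. \<psi> \<oplus>\<^bsub>?L\<^esub> \<phi> = \<zero>\<^bsub>?L\<^esub>"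
      using p by (intro bexI[of _ "\<lambda>w. \<ominus>\<^bsub>A\<^esub> \<phi> w"]) (auto simp: free_left_module_def l_neg i)
  qed (auto simp: free_left_module_def a_ac intro!: ext)
  show ?thesis
  proof (intro left_module.intro left_module_axioms.intro assms ag)
    fix a \<phi> assume "a \<in> carrier A" "\<phi> \<in> carrier ?L"
    then show "a \<odot>\<^bsub>?L\<^esub> \<phi> \<in> carrier ?L" using fin2[of \<phi> a] by (simp add: free_left_module_def)
  qed (auto simp: free_left_module_def l_distr r_distr m_assoc)
qed

lemma free_eval_hom:
  assumes "left_module A N" "t \<in> X \<rightarrow> carrier N"
  shows "free_eval A N t \<in> left_hom A (free_left_module A X) N"
proof -
  interpret N: left_module A N by fact
  interpret L: left_module A "free_left_module A X" using left_module_free N.ring_axioms .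
  let ?L = "free_left_module A X"
  have c: "\<phi> w \<in> carrier A" if "\<phi> \<in> carrier ?L" for \<phi> w using that by (simp add: free_left_module_def)
  have s: "finite {w. \<phi> w \<noteq> \<zero>\<^bsub>A\<^esub>}" "{w. \<phi> w \<noteq> \<zero>\<^bsub>A\<^esub>} \<subseteq> X" if "\<phi> \<in> carrier ?L" for \<phi>
    using that by (auto simp: free_left_module_def)
  have tc: "\<phi> w \<odot>\<^bsub>N\<^esub> t w \<in> carrier N" if "\<phi> \<in> carrier ?L" "w \<in> X" for \<phi> w
    using N.lsm_closed c that assms(2) by blast
  show ?thesis unfolding left_hom_def
  proof (intro CollectI conjI ballI funcsetI)
    fix \<phi> assume p: "\<phi> \<in> carrier ?L"
    show "free_eval A N t \<phi> \<in> carrier N"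
      unfolding free_eval_def using tc[OF p] s[OF p] by (intro N.M.finsum_closed) auto
  next
    fix \<phi> \<psi> assume p: "\<phi> \<in> carrier ?L" and q: "\<psi> \<in> carrier ?L"
    let ?I = "{w. \<phi> w \<noteq> \<zero>\<^bsub>A\<^esub>} \<union> {w. \<psi> w \<noteq> \<zero>\<^bsub>A\<^esub>}"
    have I: "finite ?I" "?I \<subseteq> X" using s p q by auto
    have pq: "\<phi> \<oplus>\<^bsub>?L\<^esub> \<psi> = (\<lambda>w. \<phi> w \<oplus>\<^bsub>A\<^esub> \<psi> w)" by (simp add: free_left_module_def)
    have t: "t \<in> ?I \<rightarrow> carrier N" using I assms(2) by blast
    have "free_eval A N t (\<lambda>w. \<phi> w \<oplus>\<^bsub>A\<^esub> \<psi> w) = finsum N (\<lambda>w. (\<phi> w \<oplus>\<^bsub>A\<^esub> \<psi> w) \<odot>\<^bsub>N\<^esub> t w) ?I"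
      using I t c[OF p] c[OF q] by (intro N.free_eval_superset) auto
    also have "\<dots> = finsum N (\<lambda>w. \<phi> w \<odot>\<^bsub>N\<^esub> t w \<oplus>\<^bsub>N\<^esub> \<psi> w \<odot>\<^bsub>N\<^esub> t w) ?I"
      by (rule N.M.finsum_cong')
        (use I t c[OF p] c[OF q] tc[OF p] tc[OF q] in \<open>auto simp: N.lsm_l_distr Pi_iff\<close>)
    also have "\<dots> = finsum N (\<lambda>w. \<phi> w \<odot>\<^bsub>N\<^esub> t w) ?I \<oplus>\<^bsub>N\<^esub> finsum N (\<lambda>w. \<psi> w \<odot>\<^bsub>N\<^esub> t w) ?I"
      by (rule N.M.finsum_addf) (use I tc[OF p] tc[OF q] in blast)+
    also have "\<dots> = free_eval A N t \<phi> \<oplus>\<^bsub>N\<^esub> free_eval A N t \<psi>"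
      using N.free_eval_superset[of ?I \<phi> t] N.free_eval_superset[of ?I \<psi> t] I t c[OF p] c[OF q] by auto
    finally show "free_eval A N t (\<phi> \<oplus>\<^bsub>?L\<^esub> \<psi>) = free_eval A N t \<phi> \<oplus>\<^bsub>N\<^esub> free_eval A N t \<psi>"
      unfolding pq .
  next
    fix a \<phi> assume a: "a \<in> carrier A" and p: "\<phi> \<in> carrier ?L"
    let ?I = "{w. \<phi> w \<noteq> \<zero>\<^bsub>A\<^esub>}"
    have t: "t \<in> ?I \<rightarrow> carrier N" using s[OF p] assms(2) by blast
    have ap: "a \<odot>\<^bsub>?L\<^esub> \<phi> = (\<lambda>w. a \<otimes>\<^bsub>A\<^esub> \<phi> w)" by (simp add: free_left_module_def)
    have h: "(\<lambda>x. a \<odot>\<^bsub>N\<^esub> x) \<in> {f \<in> carrier N \<rightarrow> carrier N.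
        \<forall>x\<in>carrier N. \<forall>y\<in>carrier N. f (x \<oplus>\<^bsub>N\<^esub> y) = f x \<oplus>\<^bsub>N\<^esub> f y}"
      using a N.lsm_closed N.lsm_r_distr by auto
    have az: "a \<odot>\<^bsub>N\<^esub> \<zero>\<^bsub>N\<^esub> = \<zero>\<^bsub>N\<^esub>"
      using N.lsm_r_distr[of a "\<zero>\<^bsub>N\<^esub>" "\<zero>\<^bsub>N\<^esub>"] N.lsm_closed[of a "\<zero>\<^bsub>N\<^esub>"] a
      by (metis N.M.add.l_cancel_one' N.M.l_zero N.M.zero_closed)
    have fs: "a \<odot>\<^bsub>N\<^esub> finsum N u I = finsum N (\<lambda>i. a \<odot>\<^bsub>N\<^esub> u i) I"
      if "finite I" "u \<in> I \<rightarrow> carrier N" for u I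
      using that
    proof (induction I rule: finite_induct)
      case empty then show ?case by (simp add: az)
    next
      case (insert i I)
      then have u: "u i \<in> carrier N" "u \<in> I \<rightarrow> carrier N" by auto
      have au: "(\<lambda>i. a \<odot>\<^bsub>N\<^esub> u i) \<in> I \<rightarrow> carrier N" "a \<odot>\<^bsub>N\<^esub> u i \<in> carrier N"
        using u a N.lsm_closed by auto
      show ?case using insert u a au
        by (simp add: N.M.finsum_insert N.lsm_r_distr N.M.finsum_closed)
    qed
    have "free_eval A N t (\<lambda>w. a \<otimes>\<^bsub>A\<^esub> \<phi> w) = finsum N (\<lambda>w. (a \<otimes>\<^bsub>A\<^esub> \<phi> w) \<odot>\<^bsub>N\<^esub> t w) ?I"
      using s[OF p] t a c[OF p] by (intro N.free_eval_superset) auto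
    also have "\<dots> = finsum N (\<lambda>w. a \<odot>\<^bsub>N\<^esub> (\<phi> w \<odot>\<^bsub>N\<^esub> t w)) ?I"
      by (rule N.M.finsum_cong')
        (use s[OF p] t a c[OF p] tc[OF p] N.lsm_closed in \<open>auto simp: N.lsm_assoc Pi_iff\<close>)
    also have "\<dots> = a \<odot>\<^bsub>N\<^esub> free_eval A N t \<phi>"
      unfolding free_eval_def by (rule fs[symmetric]) (use s[OF p] tc[OF p] in auto)
    finally show "free_eval A N t (a \<odot>\<^bsub>?L\<^esub> \<phi>) = a \<odot>\<^bsub>N\<^esub> free_eval A N t \<phi>" unfolding ap .
  qed
qed

lemma free_eval_comp:
  assumes "left_module A M" "left_module A N" "f \<in> left_hom A M N" "t \<in> X \<rightarrow> carrier M"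
    "\<phi> \<in> carrier (free_left_module A X)" "\<And>w. w \<in> X \<Longrightarrow> f (t w) = t' w"
  shows "f (free_eval A M t \<phi>) = free_eval A N t' \<phi>"
proof -
  interpret M: left_module A M by fact
  interpret N: left_module A N by fact
  let ?I = "{w. \<phi> w \<noteq> \<zero>\<^bsub>A\<^esub>}"
  have s: "finite ?I" "?I \<subseteq> X" and c: "\<And>w. \<phi> w \<in> carrier A"
    using assms(5) by (auto simp: free_left_module_def)
  have t: "t w \<in> carrier M" if "w \<in> ?I" for w using s that assms(4) by blast
  have fl: "f (a \<odot>\<^bsub>M\<^esub> x) = a \<odot>\<^bsub>N\<^esub> f x" "f x \<in> carrier N" if "a \<in> carrier A" "x \<in> carrier M" for a x
    using assms(3) that by (auto simp: left_hom_def)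
  have "f (free_eval A M t \<phi>) = finsum N (\<lambda>w. f (\<phi> w \<odot>\<^bsub>M\<^esub> t w)) ?I"
    unfolding free_eval_def
    by (rule left_hom_finsum[OF assms(1-3) s(1)]) (use t c M.lsm_closed in blast)
  also have "\<dots> = free_eval A N t' \<phi>"
    unfolding free_eval_def
  proof (rule N.M.finsum_cong')
    have *: "f (t w) = t' w" "t' w \<in> carrier N" if "w \<in> ?I" for w
      using that s assms(6) fl(2)[OF c[of w] t[OF that]] by auto
    then show "(\<lambda>w. \<phi> w \<odot>\<^bsub>N\<^esub> t' w) \<in> ?I \<rightarrow> carrier N" using c N.lsm_closed by blast
    fix w assume w: "w \<in> ?I"
    show "f (\<phi> w \<odot>\<^bsub>M\<^esub> t w) = \<phi> w \<odot>\<^bsub>N\<^esub> t' w" using fl(1)[OF c t[OF w]] *(1)[OF w] by simp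
  qed simp
  finally show ?thesis .
qed

theorem locally_projective_universal:
  fixes A :: "('a, 'z) ring_scheme" and W :: "('a, 'w, 'y) module_scheme"
    and L :: "('a, 'l) module" and N :: "('a, 'n) module"
  assumes W: "locally_projective A W" and L: "left_module A L" and N: "left_module A N"
  shows "local_lifting A W L N"
  unfolding local_lifting_def
proof (intro allI impI, elim conjE)
  fix F \<pi> g
  assume F: "finitely_generated_submodule A W F" and \<pi>: "\<pi> \<in> left_hom A L N"
    and surj: "\<pi> ` carrier L = carrier N" and g: "g \<in> left_hom A W N"
  let ?P = "free_left_module A (carrier W)" and ?W = "module.truncate W"
  interpret W: left_module A W using W by (simp add: locally_projective_def)
  have tr: "carrier ?W = carrier W" "add ?W = add W" "zero ?W = zero W" "smult ?W = smult W"
    by (simp_all add: module.truncate_def)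
  have ag: "abelian_group ?W"
    by (rule abelian_groupI)
      (auto simp: tr W.M.a_ac intro: bexI[of _ "\<ominus>\<^bsub>W\<^esub> _"] W.M.l_neg)
  have W': "left_module A ?W"
    by (intro left_module.intro left_module_axioms.intro ag W.ring_axioms)
      (auto simp: tr W.lsm_closed W.lsm_l_distr W.lsm_r_distr W.lsm_assoc W.lsm_one)
  interpret W': left_module A ?W by (rule W')
  have P: "left_module A ?P" by (rule left_module_free) (rule W.ring_axioms)
  let ?\<pi> = "free_eval A ?W (\<lambda>w. w)"
  have \<pi>': "?\<pi> \<in> left_hom A ?P ?W"
    by (rule free_eval_hom[OF W']) (simp add: tr)
  have "w \<in> ?\<pi> ` carrier ?P" if w: "w \<in> carrier W" for w
  proof
    let ?d = "\<lambda>v. if v = w then \<one>\<^bsub>A\<^esub> else \<zero>\<^bsub>A\<^esub>"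
    show "?d \<in> carrier ?P" using w by (auto simp: free_left_module_def)
    have "?\<pi> ?d = finsum ?W (\<lambda>v. ?d v \<odot>\<^bsub>?W\<^esub> v) {w}"
      by (rule W'.free_eval_superset) (use w in \<open>auto simp: tr\<close>)
    also have "\<dots> = w" using w W'.M.finsum_insert[of "{}" w "\<lambda>v. ?d v \<odot>\<^bsub>?W\<^esub> v"]
      by (simp add: tr W.lsm_one Pi_iff W'.M.r_zero[unfolded tr])
    finally show "w = ?\<pi> ?d" by simp
  qed
  moreover have "?\<pi> \<in> carrier ?P \<rightarrow> carrier W" using \<pi>' by (simp add: left_hom_def tr)
  ultimately have surj': "?\<pi> ` carrier ?P = carrier ?W" by (auto simp: tr)
  have id: "(\<lambda>w. w) \<in> left_hom A W ?W" by (auto simp: left_hom_def tr)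
  have "local_lifting A W ?P ?W" using W P W' by (simp add: locally_projective_def)
  then obtain g0 where g0: "g0 \<in> left_hom A W ?P" and lift: "\<And>x. x \<in> F \<Longrightarrow> ?\<pi> (g0 x) = x"
    unfolding local_lifting_def using F \<pi>' surj' id by blast
  have gc: "g w \<in> carrier N" if "w \<in> carrier W" for w using g that by (auto simp: left_hom_def)
  have "\<exists>y. y \<in> carrier L \<and> \<pi> y = g w" if "w \<in> carrier W" for w
    using gc[OF that] surj by (metis imageE)
  then obtain s where s: "\<And>w. w \<in> carrier W \<Longrightarrow> s w \<in> carrier L \<and> \<pi> (s w) = g w" by metis
  then have s': "s \<in> carrier W \<rightarrow> carrier L" by auto
  have h: "free_eval A L s \<in> left_hom A ?P L" using free_eval_hom[OF L s'] .
  have F_sub: "F \<subseteq> carrier W"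
  proof -
    obtain S where S: "S \<subseteq> carrier W" "F = (\<lambda>H. submodule H A W) hull S"
      using F by (auto simp: finitely_generated_submodule_def)
    have "submodule (carrier W) A W"
      by (intro submodule.intro submodule_axioms.intro W.lsm_closed W.M.add.subgroup_self)
    then show ?thesis using S hull_minimal[of S "carrier W" "\<lambda>H. submodule H A W"] by simp
  qed
  have g': "g \<in> left_hom A ?W N" using g by (simp add: left_hom_def tr)
  show "\<exists>g'\<in>left_hom A W L. \<forall>x\<in>F. \<pi> (g' x) = g x"
  proof (intro bexI ballI)
    show "(\<lambda>x. free_eval A L s (g0 x)) \<in> left_hom A W L"
      using g0 h unfolding left_hom_def by (auto simp: Pi_iff)
    fix x assume x: "x \<in> F"
    then have gx: "g0 x \<in> carrier ?P" using F_sub g0 by (auto simp: left_hom_def)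
    have "\<pi> (free_eval A L s (g0 x)) = free_eval A N g (g0 x)"
      by (rule free_eval_comp[OF L N \<pi> s' gx]) (use s in auto)
    also have "\<dots> = g (?\<pi> (g0 x))"
      by (rule free_eval_comp[OF W' N g' _ gx, symmetric]) (auto simp: tr)
    finally show "\<pi> (free_eval A L s (g0 x)) = g x" using lift[OF x] by simp
  qed
qed

end

theory Submission
  imports Defs
begin

text \<open>
  Since \<open>C\<close> is locally projective, a tensor in \<open>N \<otimes> C\<close> is determined by its images
  \<open>\<Sum> n \<phi>(c)\<close> under the left linear functionals \<open>\<phi>\<close> on \<open>C\<close>, and it comes from \<open>K \<otimes> C\<close> as soon as
  all these images lie in \<open>K\<close>; the same holds for \<open>C \<otimes> C\<close> in place of \<open>C\<close>.  Hence subcomodules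
  of \<open>M\<close> are the subgroups stable under the action \<open>\<phi> \<cdot> m = \<Sum> m\<^sub>0 \<phi>(m\<^sub>1)\<close>, colinear maps are the
  additive maps commuting with it, and the theorem becomes one about abelian groups with operators.

  There, full coprimeness applied to kernels, together with self-injectivity, shows that the
  commutative ring of endomorphisms is a domain.  A self-injective object whose endomorphism ring
  has no non-trivial idempotents is uniform.  Finally, the self-cogenerator property makes a
  subgroup that is maximal among those avoiding some \<open>m \<noteq> 0\<close> the kernel of an endomorphism \<open>f\<close>;
  then \<open>f m\<close> lies in every non-zero subgroup of the image of \<open>f\<close> and so, by uniformity, in every
  non-zero subgroup.
\<close>

section \<open>Groups with operators\<close>

text \<open>The obstacle is that \<open>K \<otimes> C\<close> is not a subset of
  \<open>M \<otimes> C\<close>: its elements are cosets of another subgroup in another free group.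
  The coaction of a subcomodule is therefore constructed as a preimage under the map induced by the
  inclusion, and its additivity, linearity and coassociativity are checked after applying injective
  maps into tensor products with \<open>M\<close>. Coassociativity lives in
  \<open>K \<otimes> (C \<otimes> C)\<close>, and this is why separation by functionals has to be
  available for \<open>C \<otimes> C\<close> as well as for \<open>C\<close>.

  The operators are indexed by the left dual of \<open>C\<close> as a bare set: stable subgroups and
  commuting maps do not see its convolution product, so just the additivity of each operator is
  recorded. Right multiplication by \<open>a\<close> is itself an operator, that of the functional
  \<open>\<epsilon>(c) a\<close>, so stability under \<open>A\<close> comes for free. Factor
  comodules enter through composites with the projection from \<open>M\<close>, which are
  endomorphisms of \<open>M\<close>; hence quotients do not appear on the side of the operator
  groups.\<close>

locale operator_group = abelian_group G for G (structure) +
  fixes Ops :: "'i set" and act :: "'i \<Rightarrow> 'a \<Rightarrow> 'a"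
  assumes op_closed: "\<lbrakk>w \<in> Ops; x \<in> carrier G\<rbrakk> \<Longrightarrow> act w x \<in> carrier G"
    and op_add: "\<lbrakk>w \<in> Ops; x \<in> carrier G; y \<in> carrier G\<rbrakk> \<Longrightarrow> act w (x \<oplus> y) = act w x \<oplus> act w y"
begin

definition op_subgroup :: "'a set \<Rightarrow> bool"
  where "op_subgroup K \<longleftrightarrow> K \<subseteq> carrier G \<and> \<zero> \<in> K \<and> (\<forall>x\<in>K. \<forall>y\<in>K. x \<oplus> y \<in> K) \<and>
    (\<forall>x\<in>K. \<ominus> x \<in> K) \<and> (\<forall>w\<in>Ops. \<forall>x\<in>K. act w x \<in> K)"

text \<open>The target is always the whole group: self-injectivity speaks of maps from a subgroup
  \<open>K\<close> into \<open>G\<close>, and endomorphisms are the case where \<open>K\<close> is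
  \<open>carrier G\<close>.\<close>

definition op_hom :: "'a set \<Rightarrow> ('a \<Rightarrow> 'a) set"
  where "op_hom K = {f \<in> K \<rightarrow> carrier G. (\<forall>x\<in>K. \<forall>y\<in>K. f (x \<oplus> y) = f x \<oplus> f y) \<and>
    (\<forall>w\<in>Ops. \<forall>x\<in>K. f (act w x) = act w (f x))}"

section \<open>Closure properties of stable subgroups and their homomorphisms\<close>

lemma op_subgroupI:
  assumes "K \<subseteq> carrier G" "\<zero> \<in> K" "\<And>x y. \<lbrakk>x \<in> K; y \<in> K\<rbrakk> \<Longrightarrow> x \<oplus> y \<in> K"
    "\<And>x. x \<in> K \<Longrightarrow> \<ominus> x \<in> K" "\<And>w x. \<lbrakk>w \<in> Ops; x \<in> K\<rbrakk> \<Longrightarrow> act w x \<in> K"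
  shows "op_subgroup K"
  using assms unfolding op_subgroup_def by blast

lemma op_subgroupD:
  assumes "op_subgroup K"
  shows "K \<subseteq> carrier G" "\<And>x. x \<in> K \<Longrightarrow> x \<in> carrier G" "\<zero> \<in> K"
    "\<And>x y. \<lbrakk>x \<in> K; y \<in> K\<rbrakk> \<Longrightarrow> x \<oplus> y \<in> K" "\<And>x. x \<in> K \<Longrightarrow> \<ominus> x \<in> K"
    "\<And>w x. \<lbrakk>w \<in> Ops; x \<in> K\<rbrakk> \<Longrightarrow> act w x \<in> K"
  using assms unfolding op_subgroup_def by blast+

lemma op_homI:
  assumes "\<And>x. x \<in> K \<Longrightarrow> f x \<in> carrier G"
    "\<And>x y. \<lbrakk>x \<in> K; y \<in> K\<rbrakk> \<Longrightarrow> f (x \<oplus> y) = f x \<oplus> f y"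
    "\<And>w x. \<lbrakk>w \<in> Ops; x \<in> K\<rbrakk> \<Longrightarrow> f (act w x) = act w (f x)"
  shows "f \<in> op_hom K"
  using assms unfolding op_hom_def by blast

lemma op_homD:
  assumes "f \<in> op_hom K"
  shows "\<And>x. x \<in> K \<Longrightarrow> f x \<in> carrier G"
    "\<And>x y. \<lbrakk>x \<in> K; y \<in> K\<rbrakk> \<Longrightarrow> f (x \<oplus> y) = f x \<oplus> f y"
    "\<And>w x. \<lbrakk>w \<in> Ops; x \<in> K\<rbrakk> \<Longrightarrow> f (act w x) = act w (f x)"
  using assms unfolding op_hom_def by auto

lemma op_subgroup_carrier: "op_subgroup (carrier G)"
  by (rule op_subgroupI) (auto simp: op_closed)

lemma op_zero:
  assumes "w \<in> Ops" shows "act w \<zero> = \<zero>"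
  using op_add[OF assms zero_closed zero_closed] op_closed[OF assms zero_closed]
  by (metis add.l_cancel_one' l_zero zero_closed)

lemma op_hom_zero:
  assumes "op_subgroup K" "f \<in> op_hom K" shows "f \<zero> = \<zero>"
  using op_homD(2)[OF assms(2), of \<zero> \<zero>] op_homD(1)[OF assms(2), of \<zero>] op_subgroupD(3)[OF assms(1)]
  by (metis add.l_cancel_one' l_zero zero_closed)

lemma op_hom_minus:
  assumes "op_subgroup K" "f \<in> op_hom K" "x \<in> K" shows "f (\<ominus> x) = \<ominus> f x"
proof -
  note K = op_subgroupD[OF assms(1)] and f = op_homD[OF assms(2)]
  have "f (\<ominus> x) \<oplus> f x = f (\<ominus> x \<oplus> x)" using f(2) K(5) assms(3) by simp
  also have "\<dots> = \<zero>" using op_hom_zero[OF assms(1,2)] K(2) assms(3) by (simp add: l_neg)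
  finally show ?thesis using f(1) K(5) assms(3) by (metis minus_equality)
qed

lemma op_minus:
  assumes "w \<in> Ops" "x \<in> carrier G" shows "act w (\<ominus> x) = \<ominus> act w x"
proof -
  have "act w (\<ominus> x) \<oplus> act w x = act w (\<ominus> x \<oplus> x)" using op_add assms by simp
  also have "\<dots> = \<zero>" using op_zero assms by (simp add: l_neg)
  finally show ?thesis using op_closed assms by (metis minus_equality a_inv_closed)
qed

lemma op_subgroup_zero: "op_subgroup {\<zero>}"
  by (rule op_subgroupI) (auto simp: op_zero)

lemma op_subgroup_Int:
  "\<lbrakk>op_subgroup K; op_subgroup L\<rbrakk> \<Longrightarrow> op_subgroup (K \<inter> L)"
  unfolding op_subgroup_def by blast

lemma op_subgroup_Inter:
  assumes "\<K> \<noteq> {}" "\<And>K. K \<in> \<K> \<Longrightarrow> op_subgroup K"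
  shows "op_subgroup (\<Inter>\<K>)"
  by (rule op_subgroupI) (use assms in \<open>auto dest: op_subgroupD\<close>)

lemma op_subgroup_Union_chain:
  assumes "\<K> \<noteq> {}" "\<And>K. K \<in> \<K> \<Longrightarrow> op_subgroup K"
    "\<And>K L. \<lbrakk>K \<in> \<K>; L \<in> \<K>\<rbrakk> \<Longrightarrow> K \<subseteq> L \<or> L \<subseteq> K"
  shows "op_subgroup (\<Union>\<K>)"
proof (rule op_subgroupI)
  fix x y assume "x \<in> \<Union>\<K>" "y \<in> \<Union>\<K>"
  then obtain K L where "K \<in> \<K>" "L \<in> \<K>" "x \<in> K" "y \<in> L" by auto
  with assms(3) obtain N where "N \<in> \<K>" "x \<in> N" "y \<in> N" by blast
  then show "x \<oplus> y \<in> \<Union>\<K>" using assms(2) op_subgroupD(4) by blast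
next
  show "\<Union>\<K> \<subseteq> carrier G" using op_subgroupD(1)[OF assms(2)] by blast
  show "\<zero> \<in> \<Union>\<K>" using op_subgroupD(3)[OF assms(2)] assms(1) by blast
  show "\<ominus> x \<in> \<Union>\<K>" if "x \<in> \<Union>\<K>" for x
    using that op_subgroupD(5)[OF assms(2)] by blast
  show "act w x \<in> \<Union>\<K>" if "w \<in> Ops" "x \<in> \<Union>\<K>" for w x
    using that op_subgroupD(6)[OF assms(2)] by blast
qed

lemma op_subgroup_image:
  assumes "op_subgroup K" "f \<in> op_hom K" shows "op_subgroup (f ` K)"
proof -
  note K = op_subgroupD[OF assms(1)] and f = op_homD[OF assms(2)]
  show ?thesis
  proof (rule op_subgroupI)
    show "f ` K \<subseteq> carrier G" using f(1) by (rule image_subsetI)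
    show "\<zero> \<in> f ` K" using imageI[OF K(3), of f] op_hom_zero[OF assms] by simp
  next
    fix x y assume "x \<in> f ` K" "y \<in> f ` K"
    then obtain u v where uv: "u \<in> K" "v \<in> K" "x = f u" "y = f v" by (elim imageE)
    show "x \<oplus> y \<in> f ` K" using imageI[OF K(4)[OF uv(1,2)], of f] f(2)[OF uv(1,2)] uv(3,4) by simp
  next
    fix x assume "x \<in> f ` K"
    then obtain u where u: "u \<in> K" "x = f u" by (elim imageE)
    show "\<ominus> x \<in> f ` K" using imageI[OF K(5)[OF u(1)], of f] op_hom_minus[OF assms u(1)] u(2) by simp
  next
    fix w x assume w: "w \<in> Ops" and "x \<in> f ` K"
    then obtain u where u: "u \<in> K" "x = f u" by (elim imageE)
    show "act w x \<in> f ` K" using imageI[OF K(6)[OF w u(1)], of f] f(3)[OF w u(1)] u(2) by simp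
  qed
qed

lemma op_subgroup_vimage:
  assumes "f \<in> op_hom (carrier G)" "op_subgroup L" shows "op_subgroup {x \<in> carrier G. f x \<in> L}"
  using op_subgroupD[OF assms(2)] op_homD[OF assms(1)]
    op_hom_zero[OF op_subgroup_carrier assms(1)] op_hom_minus[OF op_subgroup_carrier assms(1)]
  by (intro op_subgroupI) (auto simp: op_closed)

lemma op_subgroup_kernel:
  assumes "f \<in> op_hom (carrier G)" shows "op_subgroup {x \<in> carrier G. f x = \<zero>}"
  using op_subgroup_vimage[OF assms op_subgroup_zero] by simp

text \<open>This is \<open>1 - f\<close>; with an idempotent \<open>f\<close> it forms a pair of
  endomorphisms whose product is zero.\<close>

lemma op_hom_diff_id:
  assumes "f \<in> op_hom (carrier G)" shows "(\<lambda>x. x \<ominus> f x) \<in> op_hom (carrier G)"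
proof (rule op_homI)
  note f = op_homD[OF assms]
  show "x \<ominus> f x \<in> carrier G" if "x \<in> carrier G" for x using that f by simp
  show "(x \<oplus> y) \<ominus> f (x \<oplus> y) = (x \<ominus> f x) \<oplus> (y \<ominus> f y)" if "x \<in> carrier G" "y \<in> carrier G" for x y
    using that f by (simp add: minus_eq minus_add a_ac)
  show "act w x \<ominus> f (act w x) = act w (x \<ominus> f x)" if "w \<in> Ops" "x \<in> carrier G" for w x
    using that f by (simp add: minus_eq op_add op_minus)
qed

text \<open>Zorn's lemma, since unions of chains still avoid \<open>Z\<close>. With \<open>Z\<close>
  a subgroup without its zero this produces complements; with \<open>Z\<close> a singleton it
  produces a subgroup maximal among those missing one element.\<close>

lemma maximal_disjoint_op_subgroup:
  assumes "op_subgroup L" "L \<inter> Z = {}"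
  obtains L' where "op_subgroup L'" "L \<subseteq> L'" "L' \<inter> Z = {}"
    "\<And>K. \<lbrakk>op_subgroup K; L' \<subseteq> K; K \<inter> Z = {}\<rbrakk> \<Longrightarrow> K = L'"
proof -
  let ?F = "{K. op_subgroup K \<and> L \<subseteq> K \<and> K \<inter> Z = {}}"
  have "\<exists>U\<in>?F. \<forall>X\<in>C. X \<subseteq> U" if "subset.chain ?F C" for C
  proof (cases "C = {}")
    \<comment> \<open>The union of the empty chain is empty, hence no subgroup; here
      \<open>L\<close> is the upper bound.\<close>
    case True then show ?thesis using assms by blast
  next
    case False
    have C: "\<And>K. K \<in> C \<Longrightarrow> K \<in> ?F" "\<And>K N. \<lbrakk>K \<in> C; N \<in> C\<rbrakk> \<Longrightarrow> K \<subseteq> N \<or> N \<subseteq> K"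
      using that by (auto simp: subset_chain_def)
    have "op_subgroup (\<Union>C)" by (rule op_subgroup_Union_chain) (use False C in auto)
    then have "\<Union>C \<in> ?F" using False C(1) by blast
    then show ?thesis by blast
  qed
  from subset_Zorn[OF this] obtain N where "N \<in> ?F" "\<forall>X\<in>?F. N \<subseteq> X \<longrightarrow> X = N" by blast
  then show thesis using that[of N] by blast
qed

end

text \<open>The hypotheses on the comodule, read for operator groups. Maps out of a factor by
  \<open>K\<close> become endomorphisms that vanish on \<open>K\<close>, and the last premise of
  \<open>coprime\<close> says that the internal coproduct of \<open>X\<close> and \<open>Y\<close>
  is everything.\<close>

locale coprime_operator_group = operator_group +
  assumes self_inj: "\<And>K f. \<lbrakk>op_subgroup K; f \<in> op_hom K\<rbrakk> \<Longrightarrow>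
      \<exists>g \<in> op_hom (carrier G). \<forall>x\<in>K. g x = f x"
    and self_cogen: "\<And>K x. \<lbrakk>op_subgroup K; x \<in> carrier G; x \<notin> K\<rbrakk> \<Longrightarrow>
      \<exists>f \<in> op_hom (carrier G). (\<forall>k\<in>K. f k = \<zero>) \<and> f x \<noteq> \<zero>"
    and hom_comm: "\<And>f g x. \<lbrakk>f \<in> op_hom (carrier G); g \<in> op_hom (carrier G); x \<in> carrier G\<rbrakk>
      \<Longrightarrow> f (g x) = g (f x)"
    and coprime: "\<And>X Y. \<lbrakk>op_subgroup X; op_subgroup Y;
      \<And>f. f \<in> op_hom (carrier G) \<Longrightarrow> f ` X \<subseteq> X; \<And>f. f \<in> op_hom (carrier G) \<Longrightarrow> f ` Y \<subseteq> Y;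
      \<And>f x. \<lbrakk>f \<in> op_hom (carrier G); \<forall>x\<in>X. f x = \<zero>; x \<in> carrier G\<rbrakk> \<Longrightarrow> f x \<in> Y\<rbrakk>
      \<Longrightarrow> X = carrier G \<or> Y = carrier G"
begin

text \<open>Commutativity gives \<open>f (h x) = h (f x)\<close>, so kernels qualify as the fully
  invariant subgroups in \<open>coprime\<close>.\<close>

lemma kernel_invariant:
  assumes f: "f \<in> op_hom (carrier G)" and h: "h \<in> op_hom (carrier G)"
  shows "h ` {x \<in> carrier G. f x = \<zero>} \<subseteq> {x \<in> carrier G. f x = \<zero>}"
  using op_homD(1)[OF h] hom_comm[OF f h] op_hom_zero[OF op_subgroup_carrier h] by auto

text \<open>As \<open>ker f\<close> is contained in \<open>ker h\<close>, the map \<open>h\<close>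
  descends to the image of \<open>f\<close>; self-injectivity extends the descended map from this
  image to the whole group.\<close>

lemma hom_factors_through:
  assumes f: "f \<in> op_hom (carrier G)" and h: "h \<in> op_hom (carrier G)"
    and ker: "\<And>x. \<lbrakk>x \<in> carrier G; f x = \<zero>\<rbrakk> \<Longrightarrow> h x = \<zero>"
  obtains k where "k \<in> op_hom (carrier G)" "\<And>x. x \<in> carrier G \<Longrightarrow> h x = k (f x)"
proof -
  note fD = op_homD[OF f] and hD = op_homD[OF h]
  have eq: "h x = h y" if "x \<in> carrier G" "y \<in> carrier G" "f x = f y" for x y
  proof -
    have "f (x \<ominus> y) = \<zero>"
      using that fD op_hom_minus[OF op_subgroup_carrier f] by (simp add: minus_eq r_neg)
    then have "h (x \<ominus> y) = \<zero>" using ker that by simp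
    then have "h x \<ominus> h y = \<zero>"
      using that hD op_hom_minus[OF op_subgroup_carrier h] by (simp add: minus_eq)
    then have "\<ominus> (\<ominus> h y) = h x" using that hD by (intro minus_equality) (simp_all add: minus_eq)
    then show ?thesis using that hD by simp
  qed
  \<comment> \<open>Any set-theoretic section of \<open>f\<close> will do: \<open>h\<close>
    identifies elements with equal image under \<open>f\<close>, so \<open>h (s y)\<close> does not
    depend on the choice and inherits additivity from \<open>h\<close>.\<close>
  define s where "s y = (SOME x. x \<in> carrier G \<and> f x = y)" for y
  have s: "s (f x) \<in> carrier G" "f (s (f x)) = f x" if "x \<in> carrier G" for x
    using someI[of "\<lambda>z. z \<in> carrier G \<and> f z = f x" x] that unfolding s_def by auto
  have hs: "h (s (f x)) = h x" if "x \<in> carrier G" for x using eq s that by blast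
  have im: "op_subgroup (f ` carrier G)" using op_subgroup_image[OF op_subgroup_carrier f] .
  have "(\<lambda>y. h (s y)) \<in> op_hom (f ` carrier G)"
  proof (rule op_homI)
    fix y assume "y \<in> f ` carrier G"
    then show "h (s y) \<in> carrier G" using s hD by auto
  next
    fix y z assume "y \<in> f ` carrier G" "z \<in> f ` carrier G"
    then obtain u v where uv: "u \<in> carrier G" "v \<in> carrier G" "y = f u" "z = f v" by (elim imageE)
    have "y \<oplus> z = f (u \<oplus> v)" using fD(2)[OF uv(1,2)] uv(3,4) by simp
    then show "h (s (y \<oplus> z)) = h (s y) \<oplus> h (s z)"
      using hs[OF a_closed[OF uv(1,2)]] hD(2)[OF uv(1,2)] hs[OF uv(1)] hs[OF uv(2)] uv(3,4) by simp
  next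
    fix w y assume w: "w \<in> Ops" and "y \<in> f ` carrier G"
    then obtain u where u: "u \<in> carrier G" "y = f u" by (elim imageE)
    have "act w y = f (act w u)" using fD(3)[OF w u(1)] u(2) by simp
    then show "h (s (act w y)) = act w (h (s y))"
      using hs[OF op_closed[OF w u(1)]] hD(3)[OF w u(1)] hs[OF u(1)] u(2) by simp
  qed
  from self_inj[OF im this] obtain k where k: "k \<in> op_hom (carrier G)"
    "\<forall>y\<in>f ` carrier G. k y = h (s y)" by blast
  show thesis by (rule that[OF k(1)]) (use k(2) hs in simp)
qed

text \<open>Coprimeness is applied to \<open>ker f\<close> and \<open>ker g\<close>. An endomorphism
  \<open>h\<close> that vanishes on \<open>ker f\<close> factors as \<open>k f\<close>, so
  \<open>g h = k g f = 0\<close> and \<open>h\<close> maps everything into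
  \<open>ker g\<close>.\<close>

lemma hom_domain:
  assumes f: "f \<in> op_hom (carrier G)" and g: "g \<in> op_hom (carrier G)"
    and gf: "\<And>x. x \<in> carrier G \<Longrightarrow> g (f x) = \<zero>"
  shows "(\<forall>x\<in>carrier G. f x = \<zero>) \<or> (\<forall>x\<in>carrier G. g x = \<zero>)"
proof -
  let ?X = "{x \<in> carrier G. f x = \<zero>}" and ?Y = "{x \<in> carrier G. g x = \<zero>}"
  have "?X = carrier G \<or> ?Y = carrier G"
  proof (rule coprime)
    fix h x assume h: "h \<in> op_hom (carrier G)" "\<forall>x\<in>?X. h x = \<zero>" and x: "x \<in> carrier G"
    obtain k where k: "k \<in> op_hom (carrier G)" "\<And>x. x \<in> carrier G \<Longrightarrow> h x = k (f x)"
      using hom_factors_through[OF f h(1)] h(2) by blast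
    have "g (h x) = k (g (f x))" using hom_comm[OF g k(1)] k(2) x op_homD(1)[OF f] by simp
    also have "\<dots> = \<zero>" using gf x op_hom_zero[OF op_subgroup_carrier k(1)] by simp
    finally show "h x \<in> ?Y" using op_homD(1)[OF h(1) x] by simp
  qed (use op_subgroup_kernel kernel_invariant f g in auto)
  then show ?thesis by blast
qed

text \<open>The sum of \<open>S\<close> and \<open>L\<close> is direct, so its projection onto
  \<open>S\<close> along \<open>L\<close> is well defined; self-injectivity extends it to an
  endomorphism.\<close>

lemma projection_extends:
  assumes S: "op_subgroup S" and L: "op_subgroup L" and SL: "S \<inter> L = {\<zero>}"
  obtains f where "f \<in> op_hom (carrier G)" "\<And>x. x \<in> S \<Longrightarrow> f x = x" "\<And>x. x \<in> L \<Longrightarrow> f x = \<zero>"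
proof -
  note SD = op_subgroupD[OF S] and LD = op_subgroupD[OF L]
  let ?T = "{s \<oplus> l | s l. s \<in> S \<and> l \<in> L}"
  define p where "p x = (SOME s. s \<in> S \<and> (\<exists>l\<in>L. x = s \<oplus> l))" for x
  have p: "p (s \<oplus> l) = s" if "s \<in> S" "l \<in> L" for s l
  proof -
    have "\<exists>s'. s' \<in> S \<and> (\<exists>l'\<in>L. s \<oplus> l = s' \<oplus> l')" using that by blast
    from someI_ex[OF this] obtain l' where r: "p (s \<oplus> l) \<in> S" "l' \<in> L" "s \<oplus> l = p (s \<oplus> l) \<oplus> l'"
      unfolding p_def by blast
    let ?s = "p (s \<oplus> l)"
    have c: "s \<in> carrier G" "l \<in> carrier G" "?s \<in> carrier G" "l' \<in> carrier G"
      using that r SD LD by auto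
    \<comment> \<open>Comparing two decompositions of one element produces an element of
      \<open>S \<inter> L\<close>.\<close>
    have "\<ominus> ?s \<oplus> s = l' \<oplus> \<ominus> l"
    proof -
      have "\<ominus> ?s \<oplus> s = \<ominus> ?s \<oplus> (s \<oplus> l) \<oplus> \<ominus> l" using c by (simp add: a_assoc r_neg)
      also have "\<dots> = \<ominus> ?s \<oplus> (?s \<oplus> l') \<oplus> \<ominus> l" using r(3) by simp
      also have "\<dots> = l' \<oplus> \<ominus> l" using c by (simp add: a_assoc[symmetric] l_neg)
      finally show ?thesis .
    qed
    moreover have "\<ominus> ?s \<oplus> s \<in> S" "l' \<oplus> \<ominus> l \<in> L" using that r SD LD by auto
    ultimately have "\<ominus> ?s \<oplus> s = \<zero>" using SL by auto
    then show ?thesis using c by (metis a_inv_closed minus_equality minus_minus)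
  qed
  have T: "op_subgroup ?T"
  proof (rule op_subgroupI)
    show "?T \<subseteq> carrier G" using SD(2) LD(2) by auto
    show "\<zero> \<in> ?T" using SD(3) LD(3) by force
  next
    fix x y assume "x \<in> ?T" "y \<in> ?T"
    then obtain s l s' l' where "s \<in> S" "l \<in> L" "s' \<in> S" "l' \<in> L" "x = s \<oplus> l" "y = s' \<oplus> l'" by blast
    moreover from this have "x \<oplus> y = (s \<oplus> s') \<oplus> (l \<oplus> l')" using SD(2) LD(2) by (simp add: a_ac)
    ultimately show "x \<oplus> y \<in> ?T" using SD(4) LD(4) by blast
  next
    fix x assume "x \<in> ?T"
    then obtain s l where "s \<in> S" "l \<in> L" "x = s \<oplus> l" by blast
    moreover from this have "\<ominus> x = \<ominus> s \<oplus> \<ominus> l" using SD(2) LD(2) by (simp add: minus_add)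
    ultimately show "\<ominus> x \<in> ?T" using SD(5) LD(5) by blast
  next
    fix w x assume w: "w \<in> Ops" and "x \<in> ?T"
    then obtain s l where "s \<in> S" "l \<in> L" "x = s \<oplus> l" by blast
    moreover from this have "act w x = act w s \<oplus> act w l" using op_add w SD(2) LD(2) by simp
    ultimately show "act w x \<in> ?T" using SD(6) LD(6) w by blast
  qed
  have "p \<in> op_hom ?T"
  proof (rule op_homI)
    fix x assume "x \<in> ?T" then show "p x \<in> carrier G" using p SD(2) by auto
  next
    fix x y assume "x \<in> ?T" "y \<in> ?T"
    then obtain s l s' l' where *: "s \<in> S" "l \<in> L" "s' \<in> S" "l' \<in> L" "x = s \<oplus> l" "y = s' \<oplus> l'" by blast
    then have "x \<oplus> y = (s \<oplus> s') \<oplus> (l \<oplus> l')" using SD(2) LD(2) by (simp add: a_ac)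
    then show "p (x \<oplus> y) = p x \<oplus> p y" using * p SD(4) LD(4) by simp
  next
    fix w x assume w: "w \<in> Ops" and "x \<in> ?T"
    then obtain s l where *: "s \<in> S" "l \<in> L" "x = s \<oplus> l" by blast
    then have "act w x = act w s \<oplus> act w l" using op_add w SD(2) LD(2) by simp
    then show "p (act w x) = act w (p x)" using * p SD(6) LD(6) w by simp
  qed
  from self_inj[OF T this] obtain f where f: "f \<in> op_hom (carrier G)" "\<forall>x\<in>?T. f x = p x" by blast
  have "f x = x" if "x \<in> S" for x
  proof -
    have "x \<oplus> \<zero> \<in> ?T" using that LD(3) by blast
    then show ?thesis using f(2) p[OF that LD(3)] SD(2)[OF that] by simp
  qed
  moreover have "f x = \<zero>" if "x \<in> L" for x
  proof -
    have "\<zero> \<oplus> x \<in> ?T" using that SD(3) by blast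
    then show ?thesis using f(2) p[OF SD(3) that] LD(2)[OF that] by simp
  qed
  ultimately show thesis using that f(1) by blast
qed

text \<open>Enlarging \<open>S\<close> and \<open>L\<close> to mutually maximal disjoint subgroups makes the extended projection
  idempotent, which is impossible in a domain.\<close>

lemma uniform:
  assumes S: "op_subgroup S" "S \<noteq> {\<zero>}" and L: "op_subgroup L" "L \<noteq> {\<zero>}"
  shows "S \<inter> L \<noteq> {\<zero>}"
proof
  assume SL: "S \<inter> L = {\<zero>}"
  \<comment> \<open>\<open>L'\<close> is maximal against the given \<open>S\<close>, while
    \<open>S'\<close> is then chosen maximal against the enlarged \<open>L'\<close>.\<close>
  obtain L' where L': "op_subgroup L'" "L \<subseteq> L'" "L' \<inter> (S - {\<zero>}) = {}"
      "\<And>K. \<lbrakk>op_subgroup K; L' \<subseteq> K; K \<inter> (S - {\<zero>}) = {}\<rbrakk> \<Longrightarrow> K = L'"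
    using maximal_disjoint_op_subgroup[OF L(1), of "S - {\<zero>}"] SL by blast
  obtain S' where S': "op_subgroup S'" "S \<subseteq> S'" "S' \<inter> (L' - {\<zero>}) = {}"
      "\<And>K. \<lbrakk>op_subgroup K; S' \<subseteq> K; K \<inter> (L' - {\<zero>}) = {}\<rbrakk> \<Longrightarrow> K = S'"
    using maximal_disjoint_op_subgroup[OF S(1), of "L' - {\<zero>}"] L'(3) by blast
  have "S' \<inter> L' = {\<zero>}" using S'(3) op_subgroupD(3)[OF S'(1)] op_subgroupD(3)[OF L'(1)] by blast
  then obtain f where f: "f \<in> op_hom (carrier G)" "\<And>x. x \<in> S' \<Longrightarrow> f x = x" "\<And>x. x \<in> L' \<Longrightarrow> f x = \<zero>"
    using projection_extends[OF S'(1) L'(1)] by metis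
  let ?T = "{x \<in> carrier G. f x \<in> L'}"
  have "L' \<subseteq> ?T" using f(3) op_subgroupD(2,3)[OF L'(1)] by auto
  moreover have "?T \<inter> (S - {\<zero>}) = {}"
  proof -
    have "x = \<zero>" if "x \<in> S" "f x \<in> L'" for x
    proof -
      have "f x = x" using f(2) S'(2) that(1) by blast
      then show ?thesis using L'(3) that by auto
    qed
    then show ?thesis by blast
  qed
  \<comment> \<open>The preimage of \<open>L'\<close> contains \<open>L'\<close> and meets
    \<open>S\<close> trivially because \<open>f\<close> fixes \<open>S\<close>; maximality of
    \<open>L'\<close> gives equality.\<close>
  ultimately have T: "?T = L'" using L'(4) op_subgroup_vimage[OF f(1) L'(1)] by blast
  \<comment> \<open>If \<open>f x\<close> lies in \<open>L'\<close>, then \<open>x\<close> lies in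
    the preimage of \<open>L'\<close>, which is \<open>L'\<close>, so \<open>f x\<close> is zero.
    Thus the image meets \<open>L'\<close> trivially and equals \<open>S'\<close> by maximality. As
    \<open>f\<close> fixes \<open>S'\<close>, it is idempotent.\<close>
  have "f ` carrier G = S'"
  proof (rule S'(4))
    show "op_subgroup (f ` carrier G)" using op_subgroup_image[OF op_subgroup_carrier f(1)] .
    show "S' \<subseteq> f ` carrier G" using f(2) op_subgroupD(2)[OF S'(1)] by force
    show "f ` carrier G \<inter> (L' - {\<zero>}) = {}" using T f(3) by blast
  qed
  then have idem: "f (f x) = f x" if "x \<in> carrier G" for x using f(2) that by blast
  have "f (x \<ominus> f x) = \<zero>" if "x \<in> carrier G" for x
    using that idem op_homD[OF f(1)] op_hom_minus[OF op_subgroup_carrier f(1)]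
    by (simp add: minus_eq r_neg)
  \<comment> \<open>The product of \<open>1 - f\<close> and \<open>f\<close> is zero, so one of them
    vanishes: \<open>f = 1\<close> contradicts \<open>L\<close>, which \<open>f\<close> kills, and
    \<open>f = 0\<close> contradicts \<open>S\<close>, which \<open>f\<close> fixes.\<close>
  from hom_domain[OF op_hom_diff_id[OF f(1)] f(1) this]
  consider "\<forall>x\<in>carrier G. x \<ominus> f x = \<zero>" | "\<forall>x\<in>carrier G. f x = \<zero>" by blast
  then show False
  proof cases
    case 1
    have "x = \<zero>" if "x \<in> L" for x
    proof -
      have "x \<in> carrier G" "f x = \<zero>" using f(3) that L'(2) op_subgroupD(2)[OF L(1)] by blast+
      then show ?thesis using bspec[OF 1, of x] by (simp add: minus_eq minus_equality[of \<zero> \<zero>])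
    qed
    then show False using L(2) op_subgroupD(3)[OF L(1)] by blast
  next
    case 2
    have "x = \<zero>" if "x \<in> S" for x
    proof -
      have "x \<in> carrier G" "f x = x" using f(2) that S'(2) op_subgroupD(2)[OF S(1)] by blast+
      then show ?thesis using bspec[OF 2, of x] by simp
    qed
    then show False using S(2) op_subgroupD(3)[OF S(1)] by blast
  qed
qed

lemma irreducible:
  assumes "carrier G \<noteq> {\<zero>}"
  obtains S where "op_subgroup S" "S \<noteq> {\<zero>}" "\<And>K. \<lbrakk>op_subgroup K; K \<noteq> {\<zero>}\<rbrakk> \<Longrightarrow> S \<subseteq> K"
proof -
  obtain m where m: "m \<in> carrier G" "m \<noteq> \<zero>" using assms zero_closed by blast
  obtain K where K: "op_subgroup K" "m \<notin> K" "\<And>N. \<lbrakk>op_subgroup N; K \<subseteq> N; m \<notin> N\<rbrakk> \<Longrightarrow> N = K"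
    using maximal_disjoint_op_subgroup[OF op_subgroup_zero, of "{m}"] m(2) by auto
  obtain f where f: "f \<in> op_hom (carrier G)" "\<forall>k\<in>K. f k = \<zero>" "f m \<noteq> \<zero>"
    using self_cogen[OF K(1) m(1) K(2)] by blast
  let ?I = "f ` carrier G"
  have I: "op_subgroup ?I" using op_subgroup_image[OF op_subgroup_carrier f(1)] .
  have in_all: "f m \<in> N" if N: "op_subgroup N" "N \<noteq> {\<zero>}" for N
  proof (rule ccontr)
    assume fm: "f m \<notin> N"
    have "?I \<noteq> {\<zero>}" using f(3) m(1) by blast
    then have "?I \<inter> N \<noteq> {\<zero>}" using uniform[OF I _ N] by blast
    then obtain x where x: "x \<in> carrier G" "f x \<in> N" "f x \<noteq> \<zero>"
      using op_subgroupD(3)[OF op_subgroup_Int[OF I N(1)]] by blast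
    \<comment> \<open>The preimage of \<open>N\<close> contains \<open>K\<close> and misses
      \<open>m\<close>, because \<open>f m\<close> is outside \<open>N\<close>; by maximality it is
      \<open>K\<close>. But \<open>f\<close> kills \<open>K\<close>, whereas the \<open>x\<close>
      supplied by uniformity lies in this preimage with \<open>f x\<close> non-zero.\<close>
    let ?T = "{x \<in> carrier G. f x \<in> N}"
    have "K \<subseteq> ?T" using f(2) op_subgroupD(2)[OF K(1)] op_subgroupD(3)[OF N(1)] by auto
    then have "?T = K" using K(3) op_subgroup_vimage[OF f(1) N(1)] fm by blast
    then show False using x f(2) by blast
  qed
  \<comment> \<open>The witness is the intersection of all non-zero stable subgroups; it is non-zero
    because it contains \<open>f m\<close>.\<close>
  let ?K = "{N. op_subgroup N \<and> N \<noteq> {\<zero>}}"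
  have "op_subgroup (\<Inter>?K)"
    by (rule op_subgroup_Inter) (use assms op_subgroup_carrier in auto)
  moreover have "\<Inter>?K \<noteq> {\<zero>}" using in_all f(3) by blast
  ultimately show thesis using that by blast
qed

end

section \<open>Additive maps and tensor products\<close>

lemma (in abelian_group) add_pow_int:
  assumes "x \<in> carrier G"
  shows "[(k::int)] \<cdot> x \<in> carrier G" "[(0::int)] \<cdot> x = \<zero>" "[(1::int)] \<cdot> x = x"
    "[(k + l)] \<cdot> x = [k] \<cdot> x \<oplus> [(l::int)] \<cdot> x"
  using group.int_pow_closed[OF a_group, of x k] group.int_pow_1[OF a_group, of x]
    group.int_pow_mult[OF a_group, of x k l] assms
  by (simp_all add: add_pow_def int_pow_0[of "add_monoid G"])

text \<open>The group laws of tensor products and factor modules are known for quotient groups in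
  multiplicative notation; this carries them to the additive records.\<close>

lemma abelian_group_if_comm_group:
  assumes "comm_group H" "carrier G = carrier H" "add G = monoid.mult H" "zero G = one H"
  shows "abelian_group G"
proof -
  interpret H: comm_group H by fact
  show ?thesis
    by (rule abelian_groupI) (use assms(2-4) in \<open>auto simp: H.m_ac intro: bexI[of _ "inv\<^bsub>H\<^esub> _"]\<close>)
qed

lemma abelian_group_cong:
  assumes "abelian_group G" "carrier H = carrier G" "add H = add G" "zero H = zero G"
  shows "abelian_group H"
  using abelian_group_if_comm_group[OF abelian_group.a_comm_group[OF assms(1)], of H] assms(2-4) by simp

lemma left_part_simps [simp]:
  "carrier (left_part B) = carrier B" "zero (left_part B) = zero B" "add (left_part B) = add B"
  "smult (left_part B) = lact B"
  by (simp_all add: left_part_def)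

text \<open>The actions are left out, so that one equality principle, \<open>tensor_eqI\<close>,
  serves right linear, left linear and merely additive maps.\<close>

definition additive_map :: "('a, 'x) ring_scheme \<Rightarrow> ('b, 'y) ring_scheme \<Rightarrow> ('a \<Rightarrow> 'b) \<Rightarrow> bool"
  where "additive_map G H f \<longleftrightarrow> (\<forall>x\<in>carrier G. f x \<in> carrier H) \<and>
    (\<forall>x\<in>carrier G. \<forall>y\<in>carrier G. f (x \<oplus>\<^bsub>G\<^esub> y) = f x \<oplus>\<^bsub>H\<^esub> f y)"

lemma additive_mapD:
  assumes "additive_map G H f"
  shows "x \<in> carrier G \<Longrightarrow> f x \<in> carrier H"
    "\<lbrakk>x \<in> carrier G; y \<in> carrier G\<rbrakk> \<Longrightarrow> f (x \<oplus>\<^bsub>G\<^esub> y) = f x \<oplus>\<^bsub>H\<^esub> f y"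
  using assms by (auto simp: additive_map_def)

lemma additive_map_comp:
  "\<lbrakk>additive_map H L g; additive_map G H f\<rbrakk> \<Longrightarrow> additive_map G L (\<lambda>x. g (f x))"
  by (auto simp: additive_map_def)

lemma additive_map_zero:
  assumes "additive_map G H f" "abelian_group G" "abelian_group H"
  shows "f \<zero>\<^bsub>G\<^esub> = \<zero>\<^bsub>H\<^esub>"
proof -
  interpret G: abelian_group G by fact
  interpret H: abelian_group H by fact
  show ?thesis using additive_mapD[OF assms(1)] G.zero_closed G.l_zero H.add.l_cancel_one' by metis
qed

lemma additive_map_minus:
  assumes "additive_map G H f" "abelian_group G" "abelian_group H" "x \<in> carrier G"
  shows "f (\<ominus>\<^bsub>G\<^esub> x) = \<ominus>\<^bsub>H\<^esub> f x"
proof -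
  interpret G: abelian_group G by fact
  interpret H: abelian_group H by fact
  have "f (\<ominus>\<^bsub>G\<^esub> x) \<oplus>\<^bsub>H\<^esub> f x = f (\<ominus>\<^bsub>G\<^esub> x \<oplus>\<^bsub>G\<^esub> x)"
    using additive_mapD(2)[OF assms(1)] assms(4) by simp
  also have "\<dots> = \<zero>\<^bsub>H\<^esub>" using additive_map_zero[OF assms(1-3)] assms(4) by (simp add: G.l_neg)
  finally show ?thesis using additive_mapD(1)[OF assms(1)] assms(4)
    by (intro H.minus_equality[symmetric]) auto
qed

lemma right_hom_iff:
  "f \<in> right_hom A M N \<longleftrightarrow> additive_map M N f \<and>
    (\<forall>a\<in>carrier A. \<forall>x\<in>carrier M. f (ract M x a) = ract N (f x) a)"
  unfolding right_hom_def additive_map_def by auto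

lemma left_hom_iff:
  "f \<in> left_hom A (left_part M) (left_part N) \<longleftrightarrow> additive_map M N f \<and>
    (\<forall>a\<in>carrier A. \<forall>x\<in>carrier M. f (lact M a x) = lact N a (f x))"
  unfolding left_hom_def additive_map_def by auto

text \<open>The linear extension of \<open>\<beta>\<close> to formal sums of pairs. It is the
  function that \<open>tensor_lift\<close> applies to all representatives of a coset.\<close>

definition frag_eval :: "('e, 'z) ring_scheme \<Rightarrow> ('b \<Rightarrow> 'd \<Rightarrow> 'e) \<Rightarrow> ('b \<times> 'd \<Rightarrow>\<^sub>0 int) \<Rightarrow> 'e"
  where "frag_eval T \<beta> u =
    finsum T (\<lambda>(x, y). [Poly_Mapping.lookup u (x, y)] \<cdot>\<^bsub>T\<^esub> \<beta> x y) (Poly_Mapping.keys u)"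

text \<open>A common index set lets formal sums with different supports be added term by
  term.\<close>

lemma (in abelian_group) frag_eval_superset:
  assumes "\<And>x y. (x, y) \<in> S \<Longrightarrow> \<beta> x y \<in> carrier G" "Poly_Mapping.keys u \<subseteq> I" "I \<subseteq> S" "finite I"
  shows "frag_eval G \<beta> u = finsum G (\<lambda>(x, y). [Poly_Mapping.lookup u (x, y)] \<cdot> \<beta> x y) I"
  unfolding frag_eval_def
proof (rule add.finprod_mono_neutral_cong_left)
  fix i assume i: "i \<in> I - Poly_Mapping.keys u"
  obtain x y where xy: "i = (x, y)" by force
  then have "\<beta> x y \<in> carrier G" "Poly_Mapping.lookup u (x, y) = 0"
    using i assms(1,3) by (auto simp: in_keys_iff)
  then show "(\<lambda>(x, y). [Poly_Mapping.lookup u (x, y)] \<cdot> \<beta> x y) i = \<zero>"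
    using xy by (simp add: add_pow_int(2))
next
  show "(\<lambda>(x, y). [Poly_Mapping.lookup u (x, y)] \<cdot> \<beta> x y) \<in> I \<rightarrow> carrier G"
    using assms by (auto intro!: add_pow_int(1))
qed (use assms in auto)

lemma (in abelian_group) frag_eval_closed:
  assumes "\<And>x y. (x, y) \<in> S \<Longrightarrow> \<beta> x y \<in> carrier G" "Poly_Mapping.keys u \<subseteq> S"
  shows "frag_eval G \<beta> u \<in> carrier G"
  unfolding frag_eval_def using assms by (intro finsum_closed) (auto intro!: add_pow_int(1))

lemma (in abelian_group) frag_eval_add:
  assumes \<beta>: "\<And>x y. (x, y) \<in> S \<Longrightarrow> \<beta> x y \<in> carrier G"
    and u: "Poly_Mapping.keys u \<subseteq> S" and v: "Poly_Mapping.keys v \<subseteq> S"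
  shows "frag_eval G \<beta> (u + v) = frag_eval G \<beta> u \<oplus> frag_eval G \<beta> v"
proof -
  let ?I = "Poly_Mapping.keys u \<union> Poly_Mapping.keys v"
  let ?g = "\<lambda>w (x, y). [(Poly_Mapping.lookup w (x, y) :: int)] \<cdot> \<beta> x y"
  have I: "finite ?I" "?I \<subseteq> S" using u v by auto
  have c: "\<beta> x y \<in> carrier G" if "(x, y) \<in> ?I" for x y using \<beta>[of x y] I(2) that by blast
  have g: "?g w \<in> ?I \<rightarrow> carrier G" for w
  proof (rule Pi_I)
    fix i assume "i \<in> ?I"
    then show "?g w i \<in> carrier G" using c by (cases i) (simp add: add_pow_int(1))
  qed
  have "frag_eval G \<beta> (u + v) = finsum G (?g (u + v)) ?I"
    using frag_eval_superset[OF \<beta> _ I(2,1)] keys_add[of u v] by simp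
  also have "\<dots> = finsum G (\<lambda>i. ?g u i \<oplus> ?g v i) ?I"
  proof (rule finsum_cong')
    show "(\<lambda>i. ?g u i \<oplus> ?g v i) \<in> ?I \<rightarrow> carrier G"
      using g[of u] g[of v] by (intro Pi_I a_closed) (rule funcset_mem; assumption)+
    show "?g (u + v) i = ?g u i \<oplus> ?g v i" if "i \<in> ?I" for i
      using that c by (cases i) (simp add: Poly_Mapping.lookup_add add_pow_int(4))
  qed simp
  also have "\<dots> = finsum G (?g u) ?I \<oplus> finsum G (?g v) ?I" by (rule finsum_addf) (rule g)+
  also have "\<dots> = frag_eval G \<beta> u \<oplus> frag_eval G \<beta> v"
    using frag_eval_superset[OF \<beta> _ I(2,1), where u = u] frag_eval_superset[OF \<beta> _ I(2,1), where u = v] by simp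
  finally show ?thesis .
qed

lemma (in abelian_group) frag_eval_frag_of:
  assumes "\<beta> x y \<in> carrier G" shows "frag_eval G \<beta> (frag_of (x, y)) = \<beta> x y"
  using assms finsum_insert[of "{}" "(x, y)"] by (simp add: frag_eval_def Pi_iff add_pow_int)

lemma (in abelian_group) frag_eval_hom:
  assumes "\<And>x y. (x, y) \<in> S \<Longrightarrow> \<beta> x y \<in> carrier G"
  shows "group_hom (free_Abelian_group S) (add_monoid G) (frag_eval G \<beta>)"
  using frag_eval_add[OF assms] frag_eval_closed[OF assms]
  by (intro group_hom.intro group_hom_axioms.intro homI) (auto simp: a_group)

text \<open>The actions are merely required to be closed, so that the locale also covers factors
  such as \<open>tensor A M N\<close>, \<open>bitensor A N P\<close> and
  \<open>factor_module M K\<close>, for which just this much is at hand.\<close>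

locale tensor_factors = M: abelian_group M + N: abelian_group N
  for A :: "('a, 'q) ring_scheme" and M :: "('a, 'b, 'y) rmodule_scheme"
    and N :: "('a, 'd, 'x) bimodule_scheme" +
  assumes ract_M: "\<lbrakk>a \<in> carrier A; x \<in> carrier M\<rbrakk> \<Longrightarrow> ract M x a \<in> carrier M"
    and lact_N: "\<lbrakk>a \<in> carrier A; y \<in> carrier N\<rbrakk> \<Longrightarrow> lact N a y \<in> carrier N"
begin

abbreviation F where "F \<equiv> free_Abelian_group (carrier M \<times> carrier N)"
abbreviation rel where "rel \<equiv> tensor_rel A M N"
abbreviation TT where "TT \<equiv> tensor A M N"
abbreviation pt where "pt \<equiv> pure_tensor A M N"

sublocale F: comm_group F by (rule abelian_free_Abelian_group)

section \<open>The tensor product as an abelian group generated by pure tensors\<close>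

definition relators where "relators =
    {frag_of (x \<oplus>\<^bsub>M\<^esub> x', y) - frag_of (x, y) - frag_of (x', y) | x x' y.
        x \<in> carrier M \<and> x' \<in> carrier M \<and> y \<in> carrier N} \<union>
     {frag_of (x, y \<oplus>\<^bsub>N\<^esub> y') - frag_of (x, y) - frag_of (x, y') | x y y'.
        x \<in> carrier M \<and> y \<in> carrier N \<and> y' \<in> carrier N} \<union>
     {frag_of (ract M x a, y) - frag_of (x, lact N a y) | x a y.
        x \<in> carrier M \<and> a \<in> carrier A \<and> y \<in> carrier N}"

lemma rel_eq: "rel = generate F relators"
  by (simp add: tensor_rel_def relators_def)

lemma keys_diff_subset:
  "\<lbrakk>Poly_Mapping.keys u \<subseteq> S; Poly_Mapping.keys v \<subseteq> S\<rbrakk> \<Longrightarrow> Poly_Mapping.keys (u - v) \<subseteq> S"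
  using keys_diff[of u v] by blast

lemma relators_sub: "relators \<subseteq> carrier F"
  unfolding relators_def
  by (auto simp: keys_frag_of ract_M lact_N dest!: subsetD[OF keys_diff])

lemma rel_subgroup: "subgroup rel F"
  unfolding rel_eq by (rule F.generate_is_subgroup[OF relators_sub])

lemma rel_normal: "rel \<lhd> F"
  using rel_subgroup by (simp add: F.normal_iff_subgroup)

lemma tensor_monoid:
  "carrier TT = carrier (F Mod rel)" "add TT = monoid.mult (F Mod rel)" "zero TT = one (F Mod rel)"
  by (simp_all add: tensor_def tensor_ring_def tensor_group_def ring.defs)

lemma tensor_abelian: "abelian_group TT"
  by (rule abelian_group_if_comm_group[OF F.abelian_FactGroup[OF rel_subgroup] tensor_monoid])

sublocale TT: abelian_group TT by (rule tensor_abelian)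

lemma carrier_tensor: "carrier TT = {rel #>\<^bsub>F\<^esub> u | u. Poly_Mapping.keys u \<subseteq> carrier M \<times> carrier N}"
  by (auto simp: tensor_monoid FactGroup_def RCOSETS_def)

lemma coset_in_tensor:
  "Poly_Mapping.keys u \<subseteq> carrier M \<times> carrier N \<Longrightarrow> rel #>\<^bsub>F\<^esub> u \<in> carrier TT"
  unfolding carrier_tensor by blast

lemma coset_add:
  assumes "Poly_Mapping.keys u \<subseteq> carrier M \<times> carrier N" "Poly_Mapping.keys v \<subseteq> carrier M \<times> carrier N"
  shows "(rel #>\<^bsub>F\<^esub> u) \<oplus>\<^bsub>TT\<^esub> (rel #>\<^bsub>F\<^esub> v) = rel #>\<^bsub>F\<^esub> (u + v)"
  using normal.rcos_sum[OF rel_normal, of u v] assms by (simp add: tensor_monoid FactGroup_def)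

lemma coset_eqI:
  assumes "Poly_Mapping.keys u \<subseteq> carrier M \<times> carrier N" "Poly_Mapping.keys v \<subseteq> carrier M \<times> carrier N"
    "u - v \<in> relators"
  shows "rel #>\<^bsub>F\<^esub> u = rel #>\<^bsub>F\<^esub> v"
proof -
  have "u - v \<in> rel" unfolding rel_eq using assms(3) by (rule generate.incl)
  then have "u \<in> rel #>\<^bsub>F\<^esub> v" by (force simp: r_coset_def)
  then show ?thesis using F.repr_independence[of u rel v] rel_subgroup assms(2) by simp
qed

lemma pure_eq: "pt x y = rel #>\<^bsub>F\<^esub> frag_of (x, y)"
  by (simp add: pure_tensor_def)

lemma pure_closed: "\<lbrakk>x \<in> carrier M; y \<in> carrier N\<rbrakk> \<Longrightarrow> pt x y \<in> carrier TT"
  unfolding pure_eq by (rule coset_in_tensor) (simp add: keys_frag_of)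

lemma keys_frag_add:
  "\<lbrakk>Poly_Mapping.keys u \<subseteq> S; Poly_Mapping.keys v \<subseteq> S\<rbrakk> \<Longrightarrow> Poly_Mapping.keys (u + v) \<subseteq> S"
  using keys_add[of u v] by blast

lemma pure_add_left:
  assumes "x \<in> carrier M" "x' \<in> carrier M" "y \<in> carrier N"
  shows "pt (x \<oplus>\<^bsub>M\<^esub> x') y = pt x y \<oplus>\<^bsub>TT\<^esub> pt x' y"
proof -
  have "frag_of (x \<oplus>\<^bsub>M\<^esub> x', y) - (frag_of (x, y) + frag_of (x', y)) \<in> relators"
    unfolding relators_def diff_diff_eq[symmetric] using assms by blast
  from coset_eqI[OF _ _ this] show ?thesis
    using assms by (simp add: pure_eq coset_add keys_frag_of keys_frag_add)
qed

lemma pure_add_right: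
  assumes "x \<in> carrier M" "y \<in> carrier N" "y' \<in> carrier N"
  shows "pt x (y \<oplus>\<^bsub>N\<^esub> y') = pt x y \<oplus>\<^bsub>TT\<^esub> pt x y'"
proof -
  have "frag_of (x, y \<oplus>\<^bsub>N\<^esub> y') - (frag_of (x, y) + frag_of (x, y')) \<in> relators"
    unfolding relators_def diff_diff_eq[symmetric] using assms by blast
  from coset_eqI[OF _ _ this] show ?thesis
    using assms by (simp add: pure_eq coset_add keys_frag_of keys_frag_add)
qed

lemma pure_balanced:
  assumes "x \<in> carrier M" "a \<in> carrier A" "y \<in> carrier N"
  shows "pt (ract M x a) y = pt x (lact N a y)"
  unfolding pure_eq
proof (rule coset_eqI)
  show "frag_of (ract M x a, y) - frag_of (x, lact N a y) \<in> relators"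
    unfolding relators_def using assms by blast
qed (use assms ract_M lact_N in \<open>auto simp: keys_frag_of\<close>)

lemma pure_additive_left: "y \<in> carrier N \<Longrightarrow> additive_map M TT (\<lambda>x. pt x y)"
  unfolding additive_map_def using pure_closed pure_add_left by blast

lemma pure_additive_right: "x \<in> carrier M \<Longrightarrow> additive_map N TT (pt x)"
  unfolding additive_map_def using pure_closed pure_add_right by blast

text \<open>Negatives and zero are absorbed by the case of pure tensors:
  \<open>- (x \<otimes> y)\<close> is \<open>(- x) \<otimes> y\<close>, and zero is
  \<open>0 \<otimes> 0\<close>.\<close>

lemma tensor_induct [consumes 1, case_names pure add]:
  assumes t: "t \<in> carrier TT"
    and pure: "\<And>x y. \<lbrakk>x \<in> carrier M; y \<in> carrier N\<rbrakk> \<Longrightarrow> P (pt x y)"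
    and add: "\<And>s t. \<lbrakk>s \<in> carrier TT; t \<in> carrier TT; P s; P t\<rbrakk> \<Longrightarrow> P (s \<oplus>\<^bsub>TT\<^esub> t)"
  shows "P t"
proof -
  let ?S = "carrier M \<times> carrier N"
  obtain u where u: "t = rel #>\<^bsub>F\<^esub> u" "Poly_Mapping.keys u \<subseteq> ?S" using t carrier_tensor by auto
  have coset_0: "rel #>\<^bsub>F\<^esub> 0 = pt \<zero>\<^bsub>M\<^esub> \<zero>\<^bsub>N\<^esub>"
  proof -
    have "pt \<zero>\<^bsub>M\<^esub> \<zero>\<^bsub>N\<^esub> = \<zero>\<^bsub>TT\<^esub>"
      using additive_map_zero[OF pure_additive_right[OF M.zero_closed]] tensor_abelian N.abelian_group_axioms
      by blast
    moreover have "rel #>\<^bsub>F\<^esub> 0 = rel" using F.coset_mult_one[of rel] rel_subgroup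
      by (simp add: subgroup.subset)
    moreover have "\<zero>\<^bsub>TT\<^esub> = rel" by (simp add: tensor_monoid FactGroup_def)
    ultimately show ?thesis by simp
  qed
  \<comment> \<open>Induction in the free group builds elements by differences, while
    \<open>P\<close> is known to respect sums; carrying \<open>- u\<close> along turns each
    difference into a sum.\<close>
  have "P (rel #>\<^bsub>F\<^esub> u) \<and> P (rel #>\<^bsub>F\<^esub> (- u))"
    using u(2)
  proof (induction u rule: free_Abelian_group_induct[consumes 1, case_names zero diff of])
    case zero
    show ?case using pure[OF M.zero_closed N.zero_closed] by (simp add: coset_0)
  next
    case (diff u v)
    have "rel #>\<^bsub>F\<^esub> (u - v) = (rel #>\<^bsub>F\<^esub> u) \<oplus>\<^bsub>TT\<^esub> (rel #>\<^bsub>F\<^esub> (- v))"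
      "rel #>\<^bsub>F\<^esub> (- (u - v)) = (rel #>\<^bsub>F\<^esub> v) \<oplus>\<^bsub>TT\<^esub> (rel #>\<^bsub>F\<^esub> (- u))"
      using diff coset_add[of u "- v"] coset_add[of v "- u"] by simp_all
    then show ?case using diff add coset_in_tensor by simp
  next
    case (of a)
    then obtain x y where a: "a = (x, y)" "x \<in> carrier M" "y \<in> carrier N" by auto
    \<comment> \<open>Both \<open>pt (- x) y\<close> and the coset of the negated generator are
      additive inverses of \<open>pt x y\<close>, hence equal.\<close>
    have "pt (\<ominus>\<^bsub>M\<^esub> x) y \<oplus>\<^bsub>TT\<^esub> pt x y = \<zero>\<^bsub>TT\<^esub>"
      using pure_add_left[of "\<ominus>\<^bsub>M\<^esub> x" x y] a additive_map_zero[OF pure_additive_left[OF a(3)]]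
        tensor_abelian M.abelian_group_axioms by (simp add: M.l_neg)
    moreover have "(rel #>\<^bsub>F\<^esub> (- frag_of (x, y))) \<oplus>\<^bsub>TT\<^esub> pt x y = \<zero>\<^bsub>TT\<^esub>"
      using coset_add[of "- frag_of (x, y)" "frag_of (x, y)"] a coset_0
        additive_map_zero[OF pure_additive_right[OF M.zero_closed]] tensor_abelian N.abelian_group_axioms
      by (simp add: keys_frag_of pure_eq)
    ultimately have "rel #>\<^bsub>F\<^esub> (- frag_of (x, y)) = pt (\<ominus>\<^bsub>M\<^esub> x) y"
      using TT.minus_unique[of "pt x y"] TT.minus_equality pure_closed a coset_in_tensor[of "- frag_of (x, y)"]
      by (metis M.a_inv_closed keys_frag_of keys_minus empty_subsetI insert_subset mem_Sigma_iff)
    then show ?case using pure a by (simp add: pure_eq)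
  qed
  then show ?thesis using u by simp
qed

lemma tensor_eqI:
  assumes "t \<in> carrier TT" "additive_map TT H \<phi>" "additive_map TT H \<psi>"
    "\<And>x y. \<lbrakk>x \<in> carrier M; y \<in> carrier N\<rbrakk> \<Longrightarrow> \<phi> (pt x y) = \<psi> (pt x y)"
  shows "\<phi> t = \<psi> t"
  using assms(1)
proof (induction t rule: tensor_induct)
  case (pure x y) then show ?case by (rule assms(4))
next
  case (add s t) then show ?case using additive_mapD(2)[OF assms(2)] additive_mapD(2)[OF assms(3)] by simp
qed

section \<open>Balanced maps and the universal property\<close>

definition balanced :: "('e, 'w) ring_scheme \<Rightarrow> ('b \<Rightarrow> 'd \<Rightarrow> 'e) \<Rightarrow> bool"
  where "balanced T \<beta> \<longleftrightarrow> abelian_group T \<and>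
    (\<forall>y\<in>carrier N. additive_map M T (\<lambda>x. \<beta> x y)) \<and> (\<forall>x\<in>carrier M. additive_map N T (\<beta> x)) \<and>
    (\<forall>x\<in>carrier M. \<forall>a\<in>carrier A. \<forall>y\<in>carrier N. \<beta> (ract M x a) y = \<beta> x (lact N a y))"

lemma balancedI:
  assumes "abelian_group T" "\<And>y. y \<in> carrier N \<Longrightarrow> additive_map M T (\<lambda>x. \<beta> x y)"
    "\<And>x. x \<in> carrier M \<Longrightarrow> additive_map N T (\<beta> x)"
    "\<And>x a y. \<lbrakk>x \<in> carrier M; a \<in> carrier A; y \<in> carrier N\<rbrakk> \<Longrightarrow> \<beta> (ract M x a) y = \<beta> x (lact N a y)"
  shows "balanced T \<beta>"
  using assms by (simp add: balanced_def)

lemma balancedD: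
  assumes "balanced T \<beta>"
  shows "abelian_group T" "\<lbrakk>x \<in> carrier M; y \<in> carrier N\<rbrakk> \<Longrightarrow> \<beta> x y \<in> carrier T"
    "\<lbrakk>x \<in> carrier M; x' \<in> carrier M; y \<in> carrier N\<rbrakk> \<Longrightarrow> \<beta> (x \<oplus>\<^bsub>M\<^esub> x') y = \<beta> x y \<oplus>\<^bsub>T\<^esub> \<beta> x' y"
    "\<lbrakk>x \<in> carrier M; y \<in> carrier N; y' \<in> carrier N\<rbrakk> \<Longrightarrow> \<beta> x (y \<oplus>\<^bsub>N\<^esub> y') = \<beta> x y \<oplus>\<^bsub>T\<^esub> \<beta> x y'"
    "\<lbrakk>x \<in> carrier M; a \<in> carrier A; y \<in> carrier N\<rbrakk> \<Longrightarrow> \<beta> (ract M x a) y = \<beta> x (lact N a y)"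
  using assms by (auto simp: balanced_def additive_map_def)

text \<open>The kernel of the homomorphism \<open>frag_eval T \<beta>\<close> is a subgroup, so it
  suffices to kill the generators. Grouping \<open>a - b - c\<close> as \<open>a - (b + c)\<close>,
  each of them is a difference of two formal sums to which balancedness assigns equal
  values.\<close>

lemma frag_eval_rel:
  assumes b: "balanced T \<beta>" and r: "r \<in> rel"
  shows "frag_eval T \<beta> r = \<zero>\<^bsub>T\<^esub>"
proof -
  note bD = balancedD[OF b]
  interpret T: abelian_group T by (rule bD(1))
  let ?S = "carrier M \<times> carrier N"
  interpret h: group_hom F "add_monoid T" "frag_eval T \<beta>"
    by (rule T.frag_eval_hom) (use bD(2) in auto)
  have ev: "frag_eval T \<beta> (frag_of (x, y)) = \<beta> x y" if "x \<in> carrier M" "y \<in> carrier N" for x y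
    by (rule T.frag_eval_frag_of) (use bD(2) that in auto)
  have vanish: "frag_eval T \<beta> (u - v) = \<zero>\<^bsub>T\<^esub>"
    if "Poly_Mapping.keys u \<subseteq> ?S" "Poly_Mapping.keys v \<subseteq> ?S" "frag_eval T \<beta> u = frag_eval T \<beta> v" for u v
  proof -
    have "Poly_Mapping.keys (u - v) \<subseteq> ?S" using that by (intro keys_diff_subset)
    then have "frag_eval T \<beta> u = frag_eval T \<beta> (u - v) \<oplus>\<^bsub>T\<^esub> frag_eval T \<beta> v"
      "frag_eval T \<beta> (u - v) \<in> carrier T" "frag_eval T \<beta> v \<in> carrier T"
      using h.hom_mult[of "u - v" v] h.hom_closed that by auto
    then show ?thesis using that(3) T.add.r_cancel_one' by metis
  qed
  have ad: "frag_eval T \<beta> (frag_of (x, y) + frag_of (x', y')) = \<beta> x y \<oplus>\<^bsub>T\<^esub> \<beta> x' y'"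
    if "x \<in> carrier M" "y \<in> carrier N" "x' \<in> carrier M" "y' \<in> carrier N" for x y x' y'
    using h.hom_mult[of "frag_of (x, y)" "frag_of (x', y')"] that by (simp add: keys_frag_of ev)
  have "relators \<subseteq> kernel F (add_monoid T) (frag_eval T \<beta>)"
  proof
    fix r assume r: "r \<in> relators"
    then have "frag_eval T \<beta> r = \<zero>\<^bsub>T\<^esub>"
      unfolding relators_def diff_diff_eq
      by (elim UnE CollectE exE conjE, simp_all)
        (rule vanish; auto simp: keys_frag_of ev ad bD ract_M lact_N dest!: subsetD[OF keys_add])+
    then show "r \<in> kernel F (add_monoid T) (frag_eval T \<beta>)"
      using subsetD[OF relators_sub r] by (simp add: kernel_def)
  qed
  then have "rel \<subseteq> kernel F (add_monoid T) (frag_eval T \<beta>)"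
    unfolding rel_eq by (rule F.generate_subgroup_incl) (rule h.subgroup_kernel)
  then show ?thesis using r by (auto simp: kernel_def)
qed

text \<open>The description in \<open>tensor_lift\<close> is well defined: \<open>frag_eval\<close>
  vanishes on \<open>rel\<close>, so it takes a single value on the whole coset.\<close>

lemma lift_coset:
  assumes b: "balanced T \<beta>" and u: "Poly_Mapping.keys u \<subseteq> carrier M \<times> carrier N"
  shows "tensor_lift T \<beta> (rel #>\<^bsub>F\<^esub> u) = frag_eval T \<beta> u"
proof -
  note bD = balancedD[OF b]
  interpret T: abelian_group T by (rule bD(1))
  have c: "frag_eval T \<beta> u \<in> carrier T"
    by (rule T.frag_eval_closed[where S = "carrier M \<times> carrier N"]) (use bD(2) u in auto)
  have "frag_eval T \<beta> (r + u) = frag_eval T \<beta> u" if "r \<in> rel" for r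
  proof -
    have "Poly_Mapping.keys r \<subseteq> carrier M \<times> carrier N"
      using subsetD[OF subgroup.subset[OF rel_subgroup] that] by simp
    then have "frag_eval T \<beta> (r + u) = frag_eval T \<beta> r \<oplus>\<^bsub>T\<^esub> frag_eval T \<beta> u"
      using u by (intro T.frag_eval_add[where S = "carrier M \<times> carrier N"]) (use bD(2) in auto)
    then show ?thesis using frag_eval_rel[OF b that] c by simp
  qed
  moreover have "rel \<noteq> {}" using subgroup.one_closed[OF rel_subgroup] by blast
  ultimately have "frag_eval T \<beta> ` (rel #>\<^bsub>F\<^esub> u) = {frag_eval T \<beta> u}"
    by (auto simp: r_coset_def image_iff)
  then show ?thesis by (simp add: tensor_lift_def frag_eval_def)
qed

lemma lift_pure:
  assumes "balanced T \<beta>" "x \<in> carrier M" "y \<in> carrier N"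
  shows "tensor_lift T \<beta> (pt x y) = \<beta> x y"
proof -
  interpret T: abelian_group T by (rule balancedD(1)[OF assms(1)])
  show ?thesis
    using lift_coset[OF assms(1), of "frag_of (x, y)"] assms(2,3)
      T.frag_eval_frag_of[of \<beta>, OF balancedD(2)[OF assms]]
    by (simp add: pure_eq keys_frag_of)
qed

lemma lift_additive:
  assumes b: "balanced T \<beta>" shows "additive_map TT T (tensor_lift T \<beta>)"
  unfolding additive_map_def
proof (intro conjI ballI)
  note bD = balancedD[OF b]
  interpret T: abelian_group T by (rule bD(1))
  fix s assume "s \<in> carrier TT"
  then obtain u where u: "s = rel #>\<^bsub>F\<^esub> u" "Poly_Mapping.keys u \<subseteq> carrier M \<times> carrier N"
    using carrier_tensor by auto
  then show "tensor_lift T \<beta> s \<in> carrier T"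
    using lift_coset[OF b] T.frag_eval_closed[where S = "carrier M \<times> carrier N" and \<beta> = \<beta> and u = u] bD(2) by auto
  fix t assume "t \<in> carrier TT"
  then obtain v where v: "t = rel #>\<^bsub>F\<^esub> v" "Poly_Mapping.keys v \<subseteq> carrier M \<times> carrier N"
    using carrier_tensor by auto
  show "tensor_lift T \<beta> (s \<oplus>\<^bsub>TT\<^esub> t) = tensor_lift T \<beta> s \<oplus>\<^bsub>T\<^esub> tensor_lift T \<beta> t"
    using u v coset_add lift_coset[OF b] keys_frag_add[OF u(2) v(2)]
      T.frag_eval_add[OF _ u(2) v(2), of \<beta>] bD(2) by auto
qed

text \<open>Pure tensors summing to \<open>t\<close> are recorded through their effect on additive
  maps. A map known to fix finitely many pure tensors, as obtained from a local dual basis, is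
  thereby seen to fix \<open>t\<close>.\<close>

lemma tensor_finite_support:
  assumes "t \<in> carrier TT"
  shows "\<exists>P. finite P \<and> P \<subseteq> carrier M \<times> carrier N \<and>
    (\<forall>\<Phi>. additive_map TT TT \<Phi> \<longrightarrow> (\<forall>x y. (x, y) \<in> P \<longrightarrow> \<Phi> (pt x y) = pt x y) \<longrightarrow> \<Phi> t = t)"
proof -
  define supports where "supports P s \<longleftrightarrow> finite P \<and> P \<subseteq> carrier M \<times> carrier N \<and>
    (\<forall>\<Phi>. additive_map TT TT \<Phi> \<longrightarrow> (\<forall>x y. (x, y) \<in> P \<longrightarrow> \<Phi> (pt x y) = pt x y) \<longrightarrow> \<Phi> s = s)" for P s
  have "\<exists>P. supports P t"
    using assms
  proof (induction t rule: tensor_induct)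
    case (pure x y)
    then have "supports {(x, y)} (pt x y)" by (simp add: supports_def)
    then show ?case ..
  next
    case (add s t)
    then obtain P Q where PQ: "supports P s" "supports Q t" by (elim exE)
    have "supports (P \<union> Q) (s \<oplus>\<^bsub>TT\<^esub> t)"
      unfolding supports_def
    proof (intro conjI allI impI)
      show "finite (P \<union> Q)" "P \<union> Q \<subseteq> carrier M \<times> carrier N" using PQ by (simp_all add: supports_def)
      fix \<Phi> assume \<Phi>: "additive_map TT TT \<Phi>" "\<forall>x y. (x, y) \<in> P \<union> Q \<longrightarrow> \<Phi> (pt x y) = pt x y"
      then have "\<Phi> s = s" "\<Phi> t = t" using PQ by (simp_all add: supports_def)
      then show "\<Phi> (s \<oplus>\<^bsub>TT\<^esub> t) = s \<oplus>\<^bsub>TT\<^esub> t" using additive_mapD(2)[OF \<Phi>(1) add(1,2)] by simp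
    qed
    then show ?case ..
  qed
  then show ?thesis by (simp add: supports_def)
qed

end

section \<open>Actions and induced maps on tensor products\<close>

lemma bitensor_simps [simp]:
  "carrier (bitensor A B N) = carrier (tensor A B N)" "add (bitensor A B N) = add (tensor A B N)"
  "zero (bitensor A B N) = zero (tensor A B N)" "ract (bitensor A B N) = ract (tensor A B N)"
  by (simp_all add: bitensor_def rmodule.defs)

text \<open>The actions are lifted into \<open>tensor_ring\<close>, because \<open>tensor\<close>
  itself is defined through them; both records carry the same additive group.\<close>

lemma tensor_ring_simps:
  "carrier (tensor_ring A M N) = carrier (tensor A M N)" "add (tensor_ring A M N) = add (tensor A M N)"
  "zero (tensor_ring A M N) = zero (tensor A M N)"
  by (simp_all add: tensor_def ring.defs)

lemma additive_map_add:
  assumes "additive_map G H f" "additive_map G H g" "abelian_group H"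
  shows "additive_map G H (\<lambda>x. f x \<oplus>\<^bsub>H\<^esub> g x)"
proof -
  interpret H: abelian_group H by fact
  show ?thesis unfolding additive_map_def
    using additive_mapD[OF assms(1)] additive_mapD[OF assms(2)] by (auto simp: H.a_ac)
qed

lemma additive_map_id: "additive_map G G (\<lambda>x. x)"
  by (simp add: additive_map_def)

lemma additive_map_const_zero: "abelian_group H \<Longrightarrow> additive_map G H (\<lambda>_. \<zero>\<^bsub>H\<^esub>)"
proof -
  assume "abelian_group H"
  then interpret H: abelian_group H .
  show ?thesis by (simp add: additive_map_def)
qed

lemma bimoduleD:
  assumes "bimodule A B"
  shows "abelian_group B" "right_module A B" "left_module A (left_part B)"
    "\<And>a x. \<lbrakk>a \<in> carrier A; x \<in> carrier B\<rbrakk> \<Longrightarrow> lact B a x \<in> carrier B"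
    "\<And>a x. \<lbrakk>a \<in> carrier A; x \<in> carrier B\<rbrakk> \<Longrightarrow> ract B x a \<in> carrier B"
    "\<And>a. a \<in> carrier A \<Longrightarrow> additive_map B B (lact B a)"
    "\<And>a. a \<in> carrier A \<Longrightarrow> additive_map B B (\<lambda>x. ract B x a)"
    "\<And>a b x. \<lbrakk>a \<in> carrier A; b \<in> carrier A; x \<in> carrier B\<rbrakk>
      \<Longrightarrow> ract B (lact B a x) b = lact B a (ract B x b)"
    "\<And>a b x. \<lbrakk>a \<in> carrier A; b \<in> carrier A; x \<in> carrier B\<rbrakk>
      \<Longrightarrow> lact B (a \<oplus>\<^bsub>A\<^esub> b) x = lact B a x \<oplus>\<^bsub>B\<^esub> lact B b x"
proof -
  interpret B: bimodule A B by fact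
  show "abelian_group B" "right_module A B" "left_module A (left_part B)" by unfold_locales
  show "\<And>a x. \<lbrakk>a \<in> carrier A; x \<in> carrier B\<rbrakk> \<Longrightarrow> lact B a x \<in> carrier B"
    using B.left.lsm_closed by simp
  show "\<And>a x. \<lbrakk>a \<in> carrier A; x \<in> carrier B\<rbrakk> \<Longrightarrow> ract B x a \<in> carrier B" by (rule B.ract_closed)
  show "\<And>a. a \<in> carrier A \<Longrightarrow> additive_map B B (lact B a)"
    using B.left.lsm_closed B.left.lsm_r_distr by (simp add: additive_map_def)
  show "\<And>a. a \<in> carrier A \<Longrightarrow> additive_map B B (\<lambda>x. ract B x a)"
    using B.ract_closed B.ract_l_distr by (simp add: additive_map_def)
  show "\<And>a b x. \<lbrakk>a \<in> carrier A; b \<in> carrier A; x \<in> carrier B\<rbrakk>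
      \<Longrightarrow> ract B (lact B a x) b = lact B a (ract B x b)" by (rule B.act_assoc)
  show "\<And>a b x. \<lbrakk>a \<in> carrier A; b \<in> carrier A; x \<in> carrier B\<rbrakk>
      \<Longrightarrow> lact B (a \<oplus>\<^bsub>A\<^esub> b) x = lact B a x \<oplus>\<^bsub>B\<^esub> lact B b x" using B.left.lsm_l_distr by simp
qed

lemma right_moduleD:
  assumes "right_module A M"
  shows "abelian_group M"
    "\<And>a x. \<lbrakk>a \<in> carrier A; x \<in> carrier M\<rbrakk> \<Longrightarrow> ract M x a \<in> carrier M"
    "\<And>a. a \<in> carrier A \<Longrightarrow> additive_map M M (\<lambda>x. ract M x a)"
    "\<And>x. x \<in> carrier M \<Longrightarrow> additive_map A M (ract M x)"
    "\<And>a b x. \<lbrakk>a \<in> carrier A; b \<in> carrier A; x \<in> carrier M\<rbrakk>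
      \<Longrightarrow> ract M x (a \<otimes>\<^bsub>A\<^esub> b) = ract M (ract M x a) b"
proof -
  interpret M: right_module A M by fact
  show "abelian_group M" by unfold_locales
  show "\<And>a x. \<lbrakk>a \<in> carrier A; x \<in> carrier M\<rbrakk> \<Longrightarrow> ract M x a \<in> carrier M" by (rule M.ract_closed)
  show "\<And>a. a \<in> carrier A \<Longrightarrow> additive_map M M (\<lambda>x. ract M x a)"
    using M.ract_closed M.ract_l_distr by (simp add: additive_map_def)
  show "\<And>x. x \<in> carrier M \<Longrightarrow> additive_map A M (ract M x)"
    using M.ract_closed M.ract_r_distr by (simp add: additive_map_def)
  show "\<And>a b x. \<lbrakk>a \<in> carrier A; b \<in> carrier A; x \<in> carrier M\<rbrakk>
      \<Longrightarrow> ract M x (a \<otimes>\<^bsub>A\<^esub> b) = ract M (ract M x a) b" by (rule M.ract_assoc)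
qed

lemma tensor_factorsI:
  assumes "right_module A M" "bimodule A N" shows "tensor_factors A M N"
  using right_moduleD(1,2)[OF assms(1)] bimoduleD(1,4)[OF assms(2)]
  by (simp add: tensor_factors_def tensor_factors_axioms_def)

text \<open>Balancedness rests on the compatibility of the two actions on \<open>N\<close>: \<open>x
  c \<otimes> y a = x \<otimes> c (y a) = x \<otimes> (c y) a\<close>.\<close>

lemma ract_tensor:
  assumes T: "tensor_factors A M N" and N: "bimodule A N" and a: "a \<in> carrier A"
  shows "additive_map (tensor A M N) (tensor A M N) (\<lambda>t. ract (tensor A M N) t a)"
    and "\<lbrakk>x \<in> carrier M; y \<in> carrier N\<rbrakk> \<Longrightarrow>
      ract (tensor A M N) (pure_tensor A M N x y) a = pure_tensor A M N x (ract N y a)"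
proof -
  interpret T: tensor_factors A M N by fact
  note ND = bimoduleD[OF N]
  let ?R = "tensor_ring A M N" and ?b = "\<lambda>x y. pure_tensor A M N x (ract N y a)"
  have eq: "ract (tensor A M N) t a = tensor_lift ?R ?b t" for t
    by (simp add: tensor_def ring.defs)
  have b: "T.balanced ?R ?b"
  proof (rule T.balancedI)
    show "abelian_group ?R" by (rule abelian_group_cong[OF T.tensor_abelian]) (simp_all add: tensor_ring_simps)
    show "additive_map M ?R (\<lambda>x. ?b x y)" if "y \<in> carrier N" for y
      using T.pure_additive_left[of "ract N y a"] ND(5)[OF a that] by (simp add: additive_map_def tensor_ring_simps)
    show "additive_map N ?R (?b x)" if "x \<in> carrier M" for x
      using additive_map_comp[OF T.pure_additive_right[OF that] ND(7)[OF a]] by (simp add: additive_map_def tensor_ring_simps)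
    show "?b (ract M x c) y = ?b x (lact N c y)" if "x \<in> carrier M" "c \<in> carrier A" "y \<in> carrier N" for x c y
      using that a ND(5,8) T.pure_balanced by simp
  qed
  show "additive_map (tensor A M N) (tensor A M N) (\<lambda>t. ract (tensor A M N) t a)"
    unfolding eq using T.lift_additive[OF b] by (simp add: additive_map_def tensor_ring_simps)
  show "\<lbrakk>x \<in> carrier M; y \<in> carrier N\<rbrakk> \<Longrightarrow> ract (tensor A M N) (pure_tensor A M N x y) a = ?b x y"
    unfolding eq by (rule T.lift_pure[OF b])
qed

text \<open>Now the two actions on \<open>B\<close> must be compatible: \<open>a (x c) \<otimes> y =
  (a x) c \<otimes> y = a x \<otimes> c y\<close>.\<close>

lemma lact_bitensor:
  assumes T: "tensor_factors A B N" and B: "bimodule A B" and a: "a \<in> carrier A"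
  shows "additive_map (tensor A B N) (tensor A B N) (lact (bitensor A B N) a)"
    and "\<lbrakk>x \<in> carrier B; y \<in> carrier N\<rbrakk> \<Longrightarrow>
      lact (bitensor A B N) a (pure_tensor A B N x y) = pure_tensor A B N (lact B a x) y"
proof -
  interpret T: tensor_factors A B N by fact
  note BD = bimoduleD[OF B]
  let ?R = "tensor_ring A B N" and ?b = "\<lambda>x y. pure_tensor A B N (lact B a x) y"
  have eq: "lact (bitensor A B N) a = tensor_lift ?R ?b"
    by (simp add: bitensor_def rmodule.defs)
  have b: "T.balanced ?R ?b"
  proof (rule T.balancedI)
    show "abelian_group ?R" by (rule abelian_group_cong[OF T.tensor_abelian]) (simp_all add: tensor_ring_simps)
    show "additive_map B ?R (\<lambda>x. ?b x y)" if "y \<in> carrier N" for y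
      using additive_map_comp[OF T.pure_additive_left[OF that] BD(6)[OF a]] by (simp add: additive_map_def tensor_ring_simps)
    show "additive_map N ?R (?b x)" if "x \<in> carrier B" for x
      using T.pure_additive_right[OF BD(4)[OF a that]] by (simp add: additive_map_def tensor_ring_simps)
    show "?b (ract B x c) y = ?b x (lact N c y)" if "x \<in> carrier B" "c \<in> carrier A" "y \<in> carrier N" for x c y
      using that a BD(4,8) T.pure_balanced by (simp flip: BD(8))
  qed
  show "additive_map (tensor A B N) (tensor A B N) (lact (bitensor A B N) a)"
    unfolding eq using T.lift_additive[OF b] by (simp add: additive_map_def tensor_ring_simps)
  show "\<lbrakk>x \<in> carrier B; y \<in> carrier N\<rbrakk> \<Longrightarrow> lact (bitensor A B N) a (pure_tensor A B N x y) = ?b x y"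
    unfolding eq by (rule T.lift_pure[OF b])
qed

lemma tensor_factors_tensor_left:
  assumes "tensor_factors A M N" "bimodule A N" "bimodule A P"
  shows "tensor_factors A (tensor A M N) P"
  using bimoduleD(1,4)[OF assms(3)] tensor_factors.tensor_abelian[OF assms(1)]
    additive_mapD(1)[OF ract_tensor(1)[OF assms(1,2)]]
  by (simp add: tensor_factors_def tensor_factors_axioms_def)

lemma tensor_factors_bitensor:
  assumes "right_module A M" "bimodule A N" "bimodule A P"
  shows "tensor_factors A M (bitensor A N P)"
proof -
  have T: "tensor_factors A N P" by (rule tensor_factorsI[OF bimoduleD(2)[OF assms(2)] assms(3)])
  have "abelian_group (bitensor A N P)"
    by (rule abelian_group_cong[OF tensor_factors.tensor_abelian[OF T]]) simp_all
  then show ?thesis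
    using right_moduleD(1,2)[OF assms(1)] additive_mapD(1)[OF lact_bitensor(1)[OF T assms(2)]]
    by (simp add: tensor_factors_def tensor_factors_axioms_def)
qed

text \<open>The term \<open>tensor_map A M' N' f g\<close> names its codomain but not its domain
  \<open>M \<otimes> N\<close>. The same term can thus be read on several tensor products, for
  instance with the coaction of \<open>M\<close> restricted to a subcomodule.\<close>

lemma tensor_map:
  assumes T: "tensor_factors A M N" and T': "tensor_factors A M' N'"
    and f: "f \<in> right_hom A M M'" and g: "g \<in> left_hom A (left_part N) (left_part N')"
  shows "additive_map (tensor A M N) (tensor A M' N') (tensor_map A M' N' f g)"
    and "\<lbrakk>x \<in> carrier M; y \<in> carrier N\<rbrakk> \<Longrightarrow>
      tensor_map A M' N' f g (pure_tensor A M N x y) = pure_tensor A M' N' (f x) (g y)"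
proof -
  interpret T: tensor_factors A M N by fact
  interpret T': tensor_factors A M' N' by fact
  have f': "additive_map M M' f" "\<And>a x. \<lbrakk>a \<in> carrier A; x \<in> carrier M\<rbrakk> \<Longrightarrow> f (ract M x a) = ract M' (f x) a"
    using f by (auto simp: right_hom_iff)
  have g': "additive_map N N' g" "\<And>a y. \<lbrakk>a \<in> carrier A; y \<in> carrier N\<rbrakk> \<Longrightarrow> g (lact N a y) = lact N' a (g y)"
    using g by (auto simp: left_hom_iff)
  have b: "T.balanced (tensor A M' N') (\<lambda>x y. pure_tensor A M' N' (f x) (g y))"
  proof (rule T.balancedI)
    show "abelian_group (tensor A M' N')" by (rule T'.tensor_abelian)
    show "additive_map M (tensor A M' N') (\<lambda>x. pure_tensor A M' N' (f x) (g y))" if "y \<in> carrier N" for y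
      using additive_map_comp[OF T'.pure_additive_left f'(1)] additive_mapD(1)[OF g'(1) that] by blast
    show "additive_map N (tensor A M' N') (\<lambda>y. pure_tensor A M' N' (f x) (g y))" if "x \<in> carrier M" for x
      using additive_map_comp[OF T'.pure_additive_right g'(1)] additive_mapD(1)[OF f'(1) that] by blast
    show "pure_tensor A M' N' (f (ract M x a)) (g y) = pure_tensor A M' N' (f x) (g (lact N a y))"
      if "x \<in> carrier M" "a \<in> carrier A" "y \<in> carrier N" for x a y
      using that f' g' T'.pure_balanced additive_mapD(1)[OF f'(1)] additive_mapD(1)[OF g'(1)] by simp
  qed
  show "additive_map (tensor A M N) (tensor A M' N') (tensor_map A M' N' f g)"
    unfolding tensor_map_def by (rule T.lift_additive[OF b])
  show "\<lbrakk>x \<in> carrier M; y \<in> carrier N\<rbrakk> \<Longrightarrow>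
      tensor_map A M' N' f g (pure_tensor A M N x y) = pure_tensor A M' N' (f x) (g y)"
    unfolding tensor_map_def by (rule T.lift_pure[OF b])
qed

lemma left_hom_id: "(\<lambda>y. y) \<in> left_hom A (left_part N) (left_part N)"
  by (simp add: left_hom_iff additive_map_id)

lemma right_hom_id: "(\<lambda>y. y) \<in> right_hom A N N"
  by (simp add: right_hom_iff additive_map_id)

text \<open>The composites enter as \<open>h\<close> and \<open>k\<close>, equal to
  \<open>f' f\<close> and \<open>g' g\<close> on carriers only. This covers the case where a
  composite equals a known map just on a subcomodule.\<close>

lemma tensor_map_comp:
  assumes T: "tensor_factors A M N" and T': "tensor_factors A M' N'" and T'': "tensor_factors A M'' N''"
    and f: "f \<in> right_hom A M M'" and g: "g \<in> left_hom A (left_part N) (left_part N')"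
    and f': "f' \<in> right_hom A M' M''" and g': "g' \<in> left_hom A (left_part N') (left_part N'')"
    and h: "h \<in> right_hom A M M''" and k: "k \<in> left_hom A (left_part N) (left_part N'')"
    and fh: "\<And>x. x \<in> carrier M \<Longrightarrow> f' (f x) = h x" and gk: "\<And>y. y \<in> carrier N \<Longrightarrow> g' (g y) = k y"
    and t: "t \<in> carrier (tensor A M N)"
  shows "tensor_map A M'' N'' f' g' (tensor_map A M' N' f g t) = tensor_map A M'' N'' h k t"
proof (rule tensor_factors.tensor_eqI[OF T t])
  show "additive_map (tensor A M N) (tensor A M'' N'')
      (\<lambda>t. tensor_map A M'' N'' f' g' (tensor_map A M' N' f g t))"
    by (rule additive_map_comp[OF tensor_map(1)[OF T' T'' f' g'] tensor_map(1)[OF T T' f g]])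
  show "additive_map (tensor A M N) (tensor A M'' N'') (tensor_map A M'' N'' h k)"
    by (rule tensor_map(1)[OF T T'' h k])
  fix x y assume xy: "x \<in> carrier M" "y \<in> carrier N"
  have "f x \<in> carrier M'" "g y \<in> carrier N'"
    using f g xy by (auto simp: right_hom_iff left_hom_iff additive_mapD)
  then show "tensor_map A M'' N'' f' g' (tensor_map A M' N' f g (pure_tensor A M N x y)) =
      tensor_map A M'' N'' h k (pure_tensor A M N x y)"
    using tensor_map(2)[OF T T' f g xy] tensor_map(2)[OF T' T'' f' g'] tensor_map(2)[OF T T'' h k xy]
      fh gk xy by simp
qed

text \<open>A lift whose values are given by a lift. For fixed \<open>z\<close> the inner map is
  balanced in \<open>x\<close> and \<open>y\<close>; additivity and balancedness of the outer one in
  \<open>z\<close> are equalities of additive maps on \<open>M \<otimes> N\<close>, checked on pure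
  tensors.\<close>

lemma tensor_assoc:
  fixes P :: "('a, 'e, 'w) bimodule_scheme"
  assumes M: "right_module A M" and N: "bimodule A N" and P: "bimodule A P"
  defines "T \<equiv> tensor A M (bitensor A N P)"
  shows "additive_map (tensor A (tensor A M N) P) T (tensor_assoc A M N P)"
    and "\<lbrakk>x \<in> carrier M; y \<in> carrier N; z \<in> carrier P\<rbrakk> \<Longrightarrow>
      tensor_assoc A M N P (pure_tensor A (tensor A M N) P (pure_tensor A M N x y) z) =
      pure_tensor A M (bitensor A N P) x (pure_tensor A N P y z)"
proof -
  interpret MN: tensor_factors A M N by (rule tensor_factorsI[OF M N])
  interpret NP: tensor_factors A N P by (rule tensor_factorsI[OF bimoduleD(2)[OF N] P])
  interpret L: tensor_factors A "tensor A M N" P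
    by (rule tensor_factors_tensor_left[OF MN.tensor_factors_axioms N P])
  interpret R: tensor_factors A M "bitensor A N P" by (rule tensor_factors_bitensor[OF M N P])
  note ND = bimoduleD[OF N] and PD = bimoduleD[OF P]
  note lact = lact_bitensor[OF NP.tensor_factors_axioms N]
  note ract = ract_tensor[OF MN.tensor_factors_axioms N]
  let ?b = "\<lambda>z x y. pure_tensor A M (bitensor A N P) x (pure_tensor A N P y z)"
  have T: "abelian_group T" unfolding T_def by (rule R.tensor_abelian)
  then interpret T: abelian_group T .
  have add_y: "additive_map N T (?b z x)" if "x \<in> carrier M" "z \<in> carrier P" for x z
    unfolding T_def
    by (rule additive_map_comp[OF _ NP.pure_additive_left[OF that(2)]])
      (use R.pure_additive_right[OF that(1)] in \<open>simp add: additive_map_def\<close>)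
  have add_z: "additive_map P T (\<lambda>z. ?b z x y)" if "x \<in> carrier M" "y \<in> carrier N" for x y
    unfolding T_def
    by (rule additive_map_comp[OF _ NP.pure_additive_right[OF that(2)]])
      (use R.pure_additive_right[OF that(1)] in \<open>simp add: additive_map_def\<close>)
  have inner: "MN.balanced T (?b z)" if z: "z \<in> carrier P" for z
  proof (rule MN.balancedI[OF T])
    show "additive_map M T (\<lambda>x. ?b z x y)" if "y \<in> carrier N" for y
      unfolding T_def by (rule R.pure_additive_left) (simp add: NP.pure_closed that z)
    show "additive_map N T (?b z x)" if "x \<in> carrier M" for x by (rule add_y[OF that z])
    show "?b z (ract M x a) y = ?b z x (lact N a y)"
      if "x \<in> carrier M" "a \<in> carrier A" "y \<in> carrier N" for x a y
      using that z R.pure_balanced[of x a "pure_tensor A N P y z"] NP.pure_closed lact(2) by simp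
  qed
  let ?c = "\<lambda>t z. tensor_lift T (?b z) t"
  have outer: "L.balanced T ?c"
  proof (rule L.balancedI[OF T])
    show "additive_map (tensor A M N) T (\<lambda>t. ?c t z)" if "z \<in> carrier P" for z
      by (rule MN.lift_additive[OF inner[OF that]])
    show "additive_map P T (?c t)" if t: "t \<in> carrier (tensor A M N)" for t
      unfolding additive_map_def
    proof (intro conjI ballI)
      fix z z' assume z: "z \<in> carrier P" "z' \<in> carrier P"
      show "?c t z \<in> carrier T" by (rule additive_mapD(1)[OF MN.lift_additive[OF inner[OF z(1)]] t])
      have zz: "z \<oplus>\<^bsub>P\<^esub> z' \<in> carrier P" using z abelian_group.axioms(1)[OF PD(1)]
        by (simp add: abelian_monoid.a_closed)
      show "?c t (z \<oplus>\<^bsub>P\<^esub> z') = ?c t z \<oplus>\<^bsub>T\<^esub> ?c t z'"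
        by (rule MN.tensor_eqI[OF t MN.lift_additive[OF inner[OF zz]]
            additive_map_add[OF MN.lift_additive[OF inner[OF z(1)]] MN.lift_additive[OF inner[OF z(2)]] T]])
          (use MN.lift_pure[OF inner] z zz additive_mapD(2)[OF add_z] in simp)
    qed
    show "?c (ract (tensor A M N) t a) z = ?c t (lact P a z)"
      if t: "t \<in> carrier (tensor A M N)" and a: "a \<in> carrier A" and z: "z \<in> carrier P" for t a z
    proof -
      have az: "lact P a z \<in> carrier P" using PD(4) a z by blast
      show ?thesis
        by (rule MN.tensor_eqI[OF t additive_map_comp[OF MN.lift_additive[OF inner[OF z]] ract(1)[OF a]]
            MN.lift_additive[OF inner[OF az]]])
          (use MN.lift_pure[OF inner] ract(2)[OF a] z az a ND(5) NP.pure_balanced in simp)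
    qed
  qed
  have eq: "tensor_assoc A M N P = tensor_lift T ?c"
    by (simp add: tensor_assoc_def T_def Let_def)
  show "additive_map (tensor A (tensor A M N) P) T (tensor_assoc A M N P)"
    unfolding eq by (rule L.lift_additive[OF outer])
  show "tensor_assoc A M N P (pure_tensor A (tensor A M N) P (pure_tensor A M N x y) z) = ?b z x y"
    if "x \<in> carrier M" "y \<in> carrier N" "z \<in> carrier P"
    unfolding eq using that L.lift_pure[OF outer, of "pure_tensor A M N x y" z] MN.pure_closed
      MN.lift_pure[OF inner] by simp
qed

section \<open>Finite rank maps and evaluations\<close>

text \<open>Left linear functionals, with \<open>A\<close> acting on itself by multiplication;
  \<open>left_hom\<close> does not apply because \<open>A\<close> is a ring record without a scalar
  action.\<close>

definition left_dual :: "('a, 'q) ring_scheme \<Rightarrow> ('a, 'w, 'z) bimodule_scheme \<Rightarrow> ('w \<Rightarrow> 'a) set"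
  where "left_dual A W = {\<phi>. additive_map W A \<phi> \<and>
    (\<forall>a\<in>carrier A. \<forall>x\<in>carrier W. \<phi> (lact W a x) = a \<otimes>\<^bsub>A\<^esub> \<phi> x)}"

lemma left_dualD:
  assumes "\<phi> \<in> left_dual A W"
  shows "additive_map W A \<phi>" "x \<in> carrier W \<Longrightarrow> \<phi> x \<in> carrier A"
    "\<lbrakk>a \<in> carrier A; x \<in> carrier W\<rbrakk> \<Longrightarrow> \<phi> (lact W a x) = a \<otimes>\<^bsub>A\<^esub> \<phi> x"
  using assms by (auto simp: left_dual_def additive_map_def)

text \<open>This is \<open>id \<otimes> \<phi>\<close> followed by the canonical isomorphism of
  \<open>M \<otimes> A\<close> with \<open>M\<close>, written as a single lift.\<close>

definition tensor_eval :: "('a, 'b, 'y) rmodule_scheme \<Rightarrow> ('w \<Rightarrow> 'a) \<Rightarrow> ('b, 'w) tens \<Rightarrow> 'b"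
  where "tensor_eval M \<phi> = tensor_lift M (\<lambda>x y. ract M x (\<phi> y))"

lemma tensor_eval:
  assumes T: "tensor_factors A M W" and M: "right_module A M" and \<phi>: "\<phi> \<in> left_dual A W"
  shows "additive_map (tensor A M W) M (tensor_eval M \<phi>)"
    and "\<lbrakk>x \<in> carrier M; y \<in> carrier W\<rbrakk> \<Longrightarrow> tensor_eval M \<phi> (pure_tensor A M W x y) = ract M x (\<phi> y)"
proof -
  interpret T: tensor_factors A M W by fact
  note MD = right_moduleD[OF M] and \<phi>D = left_dualD[OF \<phi>]
  have b: "T.balanced M (\<lambda>x y. ract M x (\<phi> y))"
  proof (rule T.balancedI[OF MD(1)])
    show "additive_map M M (\<lambda>x. ract M x (\<phi> y))" if "y \<in> carrier W" for y
      by (rule MD(3)[OF \<phi>D(2)[OF that]])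
    show "additive_map W M (\<lambda>y. ract M x (\<phi> y))" if "x \<in> carrier M" for x
      by (rule additive_map_comp[OF MD(4)[OF that] \<phi>D(1)])
    show "ract M (ract M x a) (\<phi> y) = ract M x (\<phi> (lact W a y))"
      if "x \<in> carrier M" "a \<in> carrier A" "y \<in> carrier W" for x a y
      using that MD(5) \<phi>D by simp
  qed
  show "additive_map (tensor A M W) M (tensor_eval M \<phi>)"
    unfolding tensor_eval_def by (rule T.lift_additive[OF b])
  show "\<lbrakk>x \<in> carrier M; y \<in> carrier W\<rbrakk> \<Longrightarrow> tensor_eval M \<phi> (pure_tensor A M W x y) = ract M x (\<phi> y)"
    unfolding tensor_eval_def by (rule T.lift_pure[OF b])
qed

text \<open>Naturality in the first factor: by right linearity of \<open>f\<close>, both sides send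
  \<open>x \<otimes> y\<close> to \<open>f x \<phi>(y)\<close>.\<close>

lemma tensor_eval_map:
  assumes T: "tensor_factors A K W" and T': "tensor_factors A M W"
    and K: "right_module A K" and M: "right_module A M"
    and f: "f \<in> right_hom A K M" and \<phi>: "\<phi> \<in> left_dual A W" and t: "t \<in> carrier (tensor A K W)"
  shows "tensor_eval M \<phi> (tensor_map A M W f (\<lambda>y. y) t) = f (tensor_eval K \<phi> t)"
proof -
  have f': "additive_map K M f" "\<And>a x. \<lbrakk>a \<in> carrier A; x \<in> carrier K\<rbrakk> \<Longrightarrow> f (ract K x a) = ract M (f x) a"
    using f by (auto simp: right_hom_iff)
  note map = tensor_map[OF T T' f left_hom_id]
  show ?thesis
    by (rule tensor_factors.tensor_eqI[OF T t
        additive_map_comp[OF tensor_eval(1)[OF T' M \<phi>] map(1)]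
        additive_map_comp[OF f'(1) tensor_eval(1)[OF T K \<phi>]]])
      (use map(2) tensor_eval(2)[OF T' M \<phi>] tensor_eval(2)[OF T K \<phi>] f' left_dualD(2)[OF \<phi>]
        in \<open>simp add: additive_mapD\<close>)
qed

text \<open>The maps \<open>\<Sum> \<phi>\<^sub>i(-) v\<^sub>i\<close>, generated one summand at a
  time so that claims about them follow by induction.\<close>

inductive_set finite_rank :: "('a, 'q) ring_scheme \<Rightarrow> ('a, 'w, 'z) bimodule_scheme \<Rightarrow> ('w \<Rightarrow> 'w) set"
  for A W where
  zero: "(\<lambda>_. \<zero>\<^bsub>W\<^esub>) \<in> finite_rank A W"
| step: "\<lbrakk>f \<in> finite_rank A W; \<phi> \<in> left_dual A W; v \<in> carrier W\<rbrakk>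
    \<Longrightarrow> (\<lambda>y. f y \<oplus>\<^bsub>W\<^esub> lact W (\<phi> y) v) \<in> finite_rank A W"

text \<open>\<open>\<Phi>\<close> is \<open>id \<otimes> f\<close>. For
  \<open>f = \<Sum> \<phi>\<^sub>i(-) v\<^sub>i\<close> it sends \<open>t\<close> to the sum of the
  tensors \<open>tensor_eval M \<phi>\<^sub>i t \<otimes> v\<^sub>i\<close>. Hence it depends only
  on the evaluations of \<open>t\<close>, and if these lie in the image of \<open>g\<close>, then
  each summand comes from \<open>K \<otimes> W\<close>. Both facts concern the same
  \<open>\<Phi>\<close> and are proved in one induction.\<close>

lemma finite_rank_tensor:
  fixes K :: "('a, 'k, 'y) rmodule_scheme"
  assumes T: "tensor_factors A M W" and M: "right_module A M"
    and K: "tensor_factors A K W" and g: "g \<in> right_hom A K M"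
    and f: "f \<in> finite_rank A W"
  shows "\<exists>\<Phi>. additive_map (tensor A M W) (tensor A M W) \<Phi> \<and>
    (\<forall>y\<in>carrier W. f y \<in> carrier W) \<and>
    (\<forall>x\<in>carrier M. \<forall>y\<in>carrier W. \<Phi> (pure_tensor A M W x y) = pure_tensor A M W x (f y)) \<and>
    (\<forall>s\<in>carrier (tensor A M W). \<forall>t\<in>carrier (tensor A M W).
      (\<forall>\<phi>\<in>left_dual A W. tensor_eval M \<phi> s = tensor_eval M \<phi> t) \<longrightarrow> \<Phi> s = \<Phi> t) \<and>
    (\<forall>t\<in>carrier (tensor A M W). (\<forall>\<phi>\<in>left_dual A W. tensor_eval M \<phi> t \<in> g ` carrier K) \<longrightarrow>
      \<Phi> t \<in> tensor_map A M W g (\<lambda>y. y) ` carrier (tensor A K W))"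
    (is "\<exists>\<Phi>. ?P f \<Phi>")
  using f
proof (induction f rule: finite_rank.induct)
  case zero
  interpret T: tensor_factors A M W by fact
  interpret K: tensor_factors A K W by fact
  have "pure_tensor A M W x \<zero>\<^bsub>W\<^esub> = \<zero>\<^bsub>tensor A M W\<^esub>" if "x \<in> carrier M" for x
    by (rule additive_map_zero[OF T.pure_additive_right[OF that] T.N.abelian_group_axioms T.tensor_abelian])
  moreover have "\<zero>\<^bsub>tensor A M W\<^esub> \<in> tensor_map A M W g (\<lambda>y. y) ` carrier (tensor A K W)"
    using additive_map_zero[OF tensor_map(1)[OF K T g left_hom_id] K.tensor_abelian T.tensor_abelian]
      K.TT.zero_closed by (metis imageI)
  ultimately show ?case
    by (intro exI[of _ "\<lambda>_. \<zero>\<^bsub>tensor A M W\<^esub>"])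
      (simp add: additive_map_const_zero[OF T.tensor_abelian])
next
  case (step f \<phi> v)
  interpret T: tensor_factors A M W by fact
  interpret K: tensor_factors A K W by fact
  let ?T = "tensor A M W" and ?j = "tensor_map A M W g (\<lambda>y. y)"
  obtain \<Phi> where P: "?P f \<Phi>" using step.IH by (rule exE)
  note \<Phi> = P[THEN conjunct1] P[THEN conjunct2, THEN conjunct1, THEN bspec]
    P[THEN conjunct2, THEN conjunct2, THEN conjunct1, THEN bspec, THEN bspec]
    P[THEN conjunct2, THEN conjunct2, THEN conjunct2, THEN conjunct1, THEN bspec, THEN bspec, THEN mp]
    P[THEN conjunct2, THEN conjunct2, THEN conjunct2, THEN conjunct2, THEN bspec, THEN mp]
  note ev = tensor_eval[OF T M step.hyps(2)] and \<phi>D = left_dualD[OF step.hyps(2)]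
  note j = tensor_map[OF K T g left_hom_id]
  \<comment> \<open>On a pure tensor the new term is \<open>x \<phi>(y) \<otimes> v\<close>, which
    balancedness turns into \<open>x \<otimes> \<phi>(y) v\<close>.\<close>
  let ?\<Psi> = "\<lambda>t. \<Phi> t \<oplus>\<^bsub>?T\<^esub> pure_tensor A M W (tensor_eval M \<phi> t) v"
  have "additive_map ?T ?T ?\<Psi>"
    by (rule additive_map_add[OF \<Phi>(1) additive_map_comp[OF T.pure_additive_left[OF step.hyps(3)] ev(1)]
        T.tensor_abelian])
  moreover have "\<forall>y\<in>carrier W. f y \<oplus>\<^bsub>W\<^esub> lact W (\<phi> y) v \<in> carrier W"
    using \<Phi>(2) \<phi>D(2) T.lact_N step.hyps(3) by simp
  moreover have "\<forall>x\<in>carrier M. \<forall>y\<in>carrier W.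
      ?\<Psi> (pure_tensor A M W x y) = pure_tensor A M W x (f y \<oplus>\<^bsub>W\<^esub> lact W (\<phi> y) v)"
    using \<Phi>(2,3) ev(2) T.pure_balanced T.pure_add_right \<phi>D(2) step.hyps(3) T.lact_N by simp
  moreover have "\<forall>s\<in>carrier ?T. \<forall>t\<in>carrier ?T.
      (\<forall>\<phi>\<in>left_dual A W. tensor_eval M \<phi> s = tensor_eval M \<phi> t) \<longrightarrow> ?\<Psi> s = ?\<Psi> t"
  proof (intro ballI impI)
    fix s t assume "s \<in> carrier ?T" "t \<in> carrier ?T"
      "\<forall>\<phi>\<in>left_dual A W. tensor_eval M \<phi> s = tensor_eval M \<phi> t"
    from \<Phi>(4)[OF this] bspec[OF this(3) step.hyps(2)] show "?\<Psi> s = ?\<Psi> t" by simp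
  qed
  moreover have "\<forall>t\<in>carrier ?T. (\<forall>\<phi>\<in>left_dual A W. tensor_eval M \<phi> t \<in> g ` carrier K) \<longrightarrow>
      ?\<Psi> t \<in> ?j ` carrier (tensor A K W)"
  proof (intro ballI impI)
    fix t assume t: "t \<in> carrier ?T" "\<forall>\<phi>\<in>left_dual A W. tensor_eval M \<phi> t \<in> g ` carrier K"
    obtain s where s: "s \<in> carrier (tensor A K W)" "\<Phi> t = ?j s" using \<Phi>(5)[OF t] by (rule imageE)
    obtain k where k: "k \<in> carrier K" "tensor_eval M \<phi> t = g k" using t(2) step.hyps(2) by blast
    let ?p = "pure_tensor A K W k v"
    have p: "?p \<in> carrier (tensor A K W)" using K.pure_closed k(1) step.hyps(3) by blast
    have "?\<Psi> t = ?j (s \<oplus>\<^bsub>tensor A K W\<^esub> ?p)"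
      using additive_mapD(2)[OF j(1) s(1) p] j(2)[OF k(1) step.hyps(3)] s(2) k(2) by simp
    then show "?\<Psi> t \<in> ?j ` carrier (tensor A K W)" using K.TT.a_closed[OF s(1) p] by blast
  qed
  ultimately have "?P (\<lambda>y. f y \<oplus>\<^bsub>W\<^esub> lact W (\<phi> y) v) ?\<Psi>" by (intro conjI)
  then show ?case by (rule exI[of "?P (\<lambda>y. f y \<oplus>\<^bsub>W\<^esub> lact W (\<phi> y) v)" ?\<Psi>])
qed

text \<open>An elementwise consequence of local projectivity. All later arguments use it in this
  form, which also passes to \<open>C \<otimes> C\<close>.\<close>

definition local_dual_basis :: "('a, 'q) ring_scheme \<Rightarrow> ('a, 'w, 'z) bimodule_scheme \<Rightarrow> bool"
  where "local_dual_basis A W \<longleftrightarrow> (\<forall>F. finite F \<and> F \<subseteq> carrier W \<longrightarrow> (\<exists>f\<in>finite_rank A W. \<forall>x\<in>F. f x = x))"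

lemma local_dual_basisD:
  assumes "local_dual_basis A W" "finite F" "F \<subseteq> carrier W"
  shows "\<exists>f\<in>finite_rank A W. \<forall>x\<in>F. f x = x"
  using assms by (simp add: local_dual_basis_def)

text \<open>Choose \<open>f\<close> of finite rank fixing the second components of the pure tensors
  that make up \<open>s\<close> and \<open>t\<close>. Then \<open>id \<otimes> f\<close> fixes both,
  while its values depend only on evaluations.\<close>

lemma tensor_separation:
  assumes T: "tensor_factors A M W" and M: "right_module A M" and W: "local_dual_basis A W"
    and s: "s \<in> carrier (tensor A M W)" and t: "t \<in> carrier (tensor A M W)"
    and ev: "\<And>\<phi>. \<phi> \<in> left_dual A W \<Longrightarrow> tensor_eval M \<phi> s = tensor_eval M \<phi> t"
  shows "s = t"
proof -
  obtain P where P: "finite P" "P \<subseteq> carrier M \<times> carrier W"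
    "\<forall>\<Phi>. additive_map (tensor A M W) (tensor A M W) \<Phi> \<longrightarrow>
      (\<forall>x y. (x, y) \<in> P \<longrightarrow> \<Phi> (pure_tensor A M W x y) = pure_tensor A M W x y) \<longrightarrow> \<Phi> s = s"
    using tensor_factors.tensor_finite_support[OF T s] by (elim exE conjE)
  obtain Q where Q: "finite Q" "Q \<subseteq> carrier M \<times> carrier W"
    "\<forall>\<Phi>. additive_map (tensor A M W) (tensor A M W) \<Phi> \<longrightarrow>
      (\<forall>x y. (x, y) \<in> Q \<longrightarrow> \<Phi> (pure_tensor A M W x y) = pure_tensor A M W x y) \<longrightarrow> \<Phi> t = t"
    using tensor_factors.tensor_finite_support[OF T t] by (elim exE conjE)
  have "finite (snd ` (P \<union> Q))" "snd ` (P \<union> Q) \<subseteq> carrier W" using P(1,2) Q(1,2) by auto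
  from local_dual_basisD[OF W this] obtain f
    where f: "f \<in> finite_rank A W" "\<forall>y\<in>snd ` (P \<union> Q). f y = y" by (rule bexE)
  obtain \<Phi> where \<Phi>: "additive_map (tensor A M W) (tensor A M W) \<Phi>"
    "\<forall>x\<in>carrier M. \<forall>y\<in>carrier W. \<Phi> (pure_tensor A M W x y) = pure_tensor A M W x (f y)"
    "\<forall>s\<in>carrier (tensor A M W). \<forall>t\<in>carrier (tensor A M W).
      (\<forall>\<phi>\<in>left_dual A W. tensor_eval M \<phi> s = tensor_eval M \<phi> t) \<longrightarrow> \<Phi> s = \<Phi> t"
    using finite_rank_tensor[OF T M T right_hom_id f(1)] by (elim exE conjE) (rule that)
  have fixed: "\<Phi> (pure_tensor A M W x y) = pure_tensor A M W x y" if "(x, y) \<in> P \<union> Q" for x y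
  proof -
    have "x \<in> carrier M" "y \<in> carrier W" "f y = y" using that P(2) Q(2) f(2) by force+
    then show ?thesis using \<Phi>(2) by simp
  qed
  have "s = \<Phi> s" using P(3)[THEN spec, THEN mp, OF \<Phi>(1)] fixed by simp
  also have "\<dots> = \<Phi> t"
    by (rule \<Phi>(3)[THEN bspec, THEN bspec, THEN mp, OF s t]) (rule ballI, rule ev)
  also have "\<dots> = t" using Q(3)[THEN spec, THEN mp, OF \<Phi>(1)] fixed by simp
  finally show ?thesis .
qed

text \<open>As in \<open>tensor_separation\<close>, a suitable \<open>id \<otimes> f\<close> fixes
  \<open>t\<close>; its value there is a sum of tensors \<open>g k \<otimes> v\<close>, each the
  image of \<open>k \<otimes> v\<close>.\<close>

lemma tensor_in_image:
  assumes T: "tensor_factors A M W" and M: "right_module A M" and W: "local_dual_basis A W"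
    and K: "tensor_factors A K W" and g: "g \<in> right_hom A K M"
    and t: "t \<in> carrier (tensor A M W)"
    and ev: "\<And>\<phi>. \<phi> \<in> left_dual A W \<Longrightarrow> tensor_eval M \<phi> t \<in> g ` carrier K"
  shows "t \<in> tensor_map A M W g (\<lambda>y. y) ` carrier (tensor A K W)"
proof -
  obtain P where P: "finite P" "P \<subseteq> carrier M \<times> carrier W"
    "\<forall>\<Phi>. additive_map (tensor A M W) (tensor A M W) \<Phi> \<longrightarrow>
      (\<forall>x y. (x, y) \<in> P \<longrightarrow> \<Phi> (pure_tensor A M W x y) = pure_tensor A M W x y) \<longrightarrow> \<Phi> t = t"
    using tensor_factors.tensor_finite_support[OF T t] by (elim exE conjE)
  have "finite (snd ` P)" "snd ` P \<subseteq> carrier W" using P(1,2) by auto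
  from local_dual_basisD[OF W this] obtain f
    where f: "f \<in> finite_rank A W" "\<forall>y\<in>snd ` P. f y = y" by (rule bexE)
  obtain \<Phi> where \<Phi>: "additive_map (tensor A M W) (tensor A M W) \<Phi>"
    "\<forall>x\<in>carrier M. \<forall>y\<in>carrier W. \<Phi> (pure_tensor A M W x y) = pure_tensor A M W x (f y)"
    "\<forall>t\<in>carrier (tensor A M W). (\<forall>\<phi>\<in>left_dual A W. tensor_eval M \<phi> t \<in> g ` carrier K) \<longrightarrow>
      \<Phi> t \<in> tensor_map A M W g (\<lambda>y. y) ` carrier (tensor A K W)"
    using finite_rank_tensor[OF T M K g f(1)] by (elim exE conjE) (rule that)
  have "\<Phi> t = t"
  proof (rule P(3)[THEN spec, THEN mp, THEN mp, OF \<Phi>(1)], intro allI impI)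
    fix x y assume "(x, y) \<in> P"
    then have "x \<in> carrier M" "y \<in> carrier W" "f y = y" using P(2) f(2) by force+
    then show "\<Phi> (pure_tensor A M W x y) = pure_tensor A M W x y" using \<Phi>(2) by simp
  qed
  moreover have "\<Phi> t \<in> tensor_map A M W g (\<lambda>y. y) ` carrier (tensor A K W)"
    by (rule \<Phi>(3)[THEN bspec, THEN mp, OF t]) (rule ballI, rule ev)
  ultimately show ?thesis by simp
qed

lemma finite_rank_additive:
  assumes W: "abelian_group W" and l: "\<And>v. v \<in> carrier W \<Longrightarrow> additive_map A W (\<lambda>a. lact W a v)"
    and f: "f \<in> finite_rank A W"
  shows "additive_map W W f"
  using f
proof induction
  case zero
  show ?case by (rule additive_map_const_zero[OF W])
next
  case (step f \<phi> v)
  show ?case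
    by (rule additive_map_add[OF step.IH additive_map_comp[OF l[OF step.hyps(3)] left_dualD(1)[OF step.hyps(2)]] W])
qed

text \<open>The identity of \<open>W\<close> is lifted, on the submodule generated by
  \<open>S\<close>, through the evaluation map from the free module on \<open>W\<close>. The
  coordinates of the lift are left linear functionals, and expanding \<open>x\<close> in them is the
  dual basis formula.\<close>

lemma locally_projective_dual_basis:
  fixes A :: "('a, 'q) ring_scheme" and W :: "('a, 'w, 'z) bimodule_scheme"
  assumes W: "bimodule A W" and lp: "locally_projective A (left_part W)"
  shows "local_dual_basis A W"
  unfolding local_dual_basis_def
proof (intro allI impI, elim conjE)
  fix S assume S: "finite S" "S \<subseteq> carrier W"
  interpret W: bimodule A W by fact
  let ?W = "left_part W" and ?P = "free_left_module A (carrier W)"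
  let ?\<pi> = "free_eval A ?W (\<lambda>w. w)" and ?F = "(\<lambda>H. submodule H A ?W) hull S"
  have \<pi>: "?\<pi> \<in> left_hom A ?P ?W" by (rule free_eval_hom[OF W.left.left_module_axioms]) simp
  have P: "left_module A ?P" by (rule left_module_free[OF W.ring_axioms])
  have "w \<in> ?\<pi> ` carrier ?P" if w: "w \<in> carrier W" for w
  proof
    let ?d = "\<lambda>v. if v = w then \<one>\<^bsub>A\<^esub> else \<zero>\<^bsub>A\<^esub>"
    show "?d \<in> carrier ?P" using w by (auto simp: free_left_module_def)
    have "?\<pi> ?d = finsum ?W (\<lambda>v. ?d v \<odot>\<^bsub>?W\<^esub> v) {w}"
      by (rule W.left.free_eval_superset) (use w in auto)
    also have "\<dots> = w" using w W.left.M.finsum_insert[of "{}" w "\<lambda>v. ?d v \<odot>\<^bsub>?W\<^esub> v"]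
        W.left.lsm_one[of w] W.left.M.r_zero[of w] by (simp add: Pi_iff)
    finally show "w = ?\<pi> ?d" by simp
  qed
  moreover have "?\<pi> \<in> carrier ?P \<rightarrow> carrier W" using \<pi> by (simp add: left_hom_def)
  ultimately have surj: "?\<pi> ` carrier ?P = carrier ?W" by auto
  have id: "(\<lambda>w. w) \<in> left_hom A ?W ?W" by (simp add: left_hom_def)
  have "local_lifting A ?W ?P ?W"
    using lp P W.left.left_module_axioms unfolding locally_projective_def by blast
  moreover have "finitely_generated_submodule A ?W ?F"
    using S unfolding finitely_generated_submodule_def by auto
  ultimately obtain g where g: "g \<in> left_hom A ?W ?P" and lift: "\<forall>x\<in>?F. ?\<pi> (g x) = x"
    unfolding local_lifting_def using \<pi> surj id by blast
  have gP: "g x \<in> carrier ?P" if "x \<in> carrier W" for x using g that by (auto simp: left_hom_def)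
  have gA: "g x w \<in> carrier A" if "x \<in> carrier W" for x w
    using gP[OF that] by (simp add: free_left_module_def)
  have dual: "(\<lambda>x. g x w) \<in> left_dual A W" for w
    using g gA unfolding left_dual_def additive_map_def left_hom_def
    by (auto simp: free_left_module_def)
  have sum: "\<exists>f\<in>finite_rank A W. \<forall>x\<in>carrier W. f x = finsum ?W (\<lambda>w. g x w \<odot>\<^bsub>?W\<^esub> w) J"
    if "finite J" "J \<subseteq> carrier W" for J
    using that
  proof (induction J rule: finite_induct)
    case empty
    show ?case by (rule bexI[OF _ finite_rank.zero]) simp
  next
    case (insert w J)
    then obtain f where f: "f \<in> finite_rank A W"
      "\<forall>x\<in>carrier W. f x = finsum ?W (\<lambda>w. g x w \<odot>\<^bsub>?W\<^esub> w) J" by auto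
    have "f x \<oplus>\<^bsub>W\<^esub> lact W (g x w) w = finsum ?W (\<lambda>w. g x w \<odot>\<^bsub>?W\<^esub> w) (insert w J)"
      if x: "x \<in> carrier W" for x
    proof -
      have c: "(\<lambda>w. g x w \<odot>\<^bsub>?W\<^esub> w) \<in> J \<rightarrow> carrier ?W" "g x w \<odot>\<^bsub>?W\<^esub> w \<in> carrier ?W"
        using W.left.lsm_closed gA[OF x] insert.prems by auto
      show ?thesis
        using f(2) x W.left.M.finsum_insert[OF insert.hyps c] W.left.M.finsum_closed[OF c(1)] c(2)
          W.left.M.a_comm by simp
    qed
    then show ?case using insert.prems
      by (intro bexI[OF _ finite_rank.step[OF f(1) dual[of w]]] ballI) auto
  qed
  \<comment> \<open>The lift may have infinitely many non-zero coordinates, but each value has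
    finite support and \<open>S\<close> is finite, so finitely many coordinates matter on
    \<open>S\<close>.\<close>
  let ?J = "\<Union>x\<in>S. {w. g x w \<noteq> \<zero>\<^bsub>A\<^esub>}"
  have J: "finite ?J" "?J \<subseteq> carrier W" using S gP by (auto simp: free_left_module_def)
  obtain f where f: "f \<in> finite_rank A W"
    "\<forall>x\<in>carrier W. f x = finsum ?W (\<lambda>w. g x w \<odot>\<^bsub>?W\<^esub> w) ?J" using sum[OF J] by (rule bexE)
  have "f x = x" if x: "x \<in> S" for x
  proof -
    have "x \<in> ?F" using x hull_subset[of S] by blast
    then have "x = ?\<pi> (g x)" using lift by simp
    also have "\<dots> = finsum ?W (\<lambda>w. g x w \<odot>\<^bsub>?W\<^esub> w) ?J"
      by (rule W.left.free_eval_superset[OF J(1)]) (use x J S(2) gA in auto)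
    finally show ?thesis using f(2) S(2) x by auto
  qed
  then show "\<exists>f\<in>finite_rank A W. \<forall>x\<in>S. f x = x" using f(1) by (intro bexI[OF _ f(1)] ballI)
qed

section \<open>Local dual bases of tensor products\<close>

context
  fixes A :: "('a, 'q) ring_scheme" and C :: "('a, 'c, 'z) bimodule_scheme"
  assumes C: "bimodule A C" and ldb: "local_dual_basis A C"
begin

interpretation T: tensor_factors A C C by (rule tensor_factorsI[OF bimoduleD(2)[OF C] C])

abbreviation (input) "CC \<equiv> bitensor A C C"

text \<open>On pure tensors this is \<open>\<phi> (c \<psi>(d))\<close>. It is left linear because
  \<open>\<psi>\<close> consumes the second factor and the left action on the first one commutes
  with right multiplication by \<open>\<psi>(d)\<close>.\<close>

lemma left_dual_eval_comp:
  assumes \<phi>: "\<phi> \<in> left_dual A C" and \<psi>: "\<psi> \<in> left_dual A C"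
  shows "(\<lambda>z. \<phi> (tensor_eval C \<psi> z)) \<in> left_dual A CC"
proof -
  note ev = tensor_eval[OF T.tensor_factors_axioms bimoduleD(2)[OF C] \<psi>]
  note \<phi>CC = left_dualD[OF \<phi>] and CD = bimoduleD[OF C]
  note la = lact_bitensor[OF T.tensor_factors_axioms C]
  have lin: "tensor_eval C \<psi> (lact CC a z) = lact C a (tensor_eval C \<psi> z)"
    if a: "a \<in> carrier A" and z: "z \<in> carrier T.TT" for a z
    by (rule T.tensor_eqI[OF z additive_map_comp[OF ev(1) la(1)[OF a]] additive_map_comp[OF CD(6)[OF a] ev(1)]])
      (use la(2)[OF a] ev(2) CD(4,8) a left_dualD(2)[OF \<psi>] in simp)
  show ?thesis
    unfolding left_dual_def
    using additive_map_comp[OF \<phi>CC(1) ev(1)] lin \<phi>CC(3) additive_mapD(1)[OF ev(1)]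
    by (simp add: additive_map_def)
qed

lemma bitensor_additive:
  shows "abelian_group CC" and "v \<in> carrier CC \<Longrightarrow> additive_map A CC (\<lambda>a. lact CC a v)"
proof -
  show "abelian_group CC" by (rule abelian_group_cong[OF T.tensor_abelian]) simp_all
  note la = lact_bitensor[OF T.tensor_factors_axioms C]
  interpret A: ring A using C by (simp add: bimodule_def right_module_def)
  assume v: "v \<in> carrier CC"
  have "lact CC (a \<oplus>\<^bsub>A\<^esub> b) v = lact CC a v \<oplus>\<^bsub>T.TT\<^esub> lact CC b v" if ab: "a \<in> carrier A" "b \<in> carrier A" for a b
    by (rule T.tensor_eqI[OF v[simplified] la(1)[OF A.a_closed[OF ab]]
        additive_map_add[OF la(1)[OF ab(1)] la(1)[OF ab(2)] T.tensor_abelian]])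
      (use la(2) ab bimoduleD(4,9)[OF C] T.pure_add_left in simp)
  then show "additive_map A CC (\<lambda>a. lact CC a v)"
    using additive_mapD(1)[OF la(1)] v by (simp add: additive_map_def)
qed

lemma finite_rank_additive_tensor: "h \<in> finite_rank A CC \<Longrightarrow> additive_map CC CC h"
  using finite_rank_additive[OF bitensor_additive] .

lemma finite_rank_additive_C: "f \<in> finite_rank A C \<Longrightarrow> additive_map C C f"
proof (rule finite_rank_additive[OF bimoduleD(1)[OF C]])
  show "additive_map A C (\<lambda>a. lact C a v)" if "v \<in> carrier C" for v
    using bimoduleD(4,9)[OF C] that by (simp add: additive_map_def)
qed

text \<open>The added term has finite rank: for
  \<open>f = \<Sum> \<phi>\<^sub>i(-) v\<^sub>i\<close> it is the sum of the terms
  \<open>\<phi>\<^sub>i (c \<psi>(d)) (v\<^sub>i \<otimes> w)\<close>, with the functionals of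
  \<open>left_dual_eval_comp\<close>.\<close>

lemma finite_rank_add_summand:
  assumes f: "f \<in> finite_rank A C" and \<psi>: "\<psi> \<in> left_dual A C" and w: "w \<in> carrier C"
    and h: "h \<in> finite_rank A CC"
  shows "\<exists>h'\<in>finite_rank A CC. \<forall>c\<in>carrier C. \<forall>d\<in>carrier C.
    h' (T.pt c d) = h (T.pt c d) \<oplus>\<^bsub>T.TT\<^esub> T.pt (f (ract C c (\<psi> d))) w"
  using f
proof induction
  case zero
  have "T.pt \<zero>\<^bsub>C\<^esub> w = \<zero>\<^bsub>T.TT\<^esub>"
    by (rule additive_map_zero[OF T.pure_additive_left[OF w] bimoduleD(1)[OF C] T.tensor_abelian])
  then have "\<forall>c\<in>carrier C. \<forall>d\<in>carrier C. h (T.pt c d) = h (T.pt c d) \<oplus>\<^bsub>T.TT\<^esub> T.pt \<zero>\<^bsub>C\<^esub> w"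
    using additive_mapD(1)[OF finite_rank_additive_tensor[OF h]] T.pure_closed by simp
  then show ?case using h by (rule bexI)
next
  case (step f \<phi> v)
  then obtain h' where h': "h' \<in> finite_rank A CC" "\<forall>c\<in>carrier C. \<forall>d\<in>carrier C.
    h' (T.pt c d) = h (T.pt c d) \<oplus>\<^bsub>T.TT\<^esub> T.pt (f (ract C c (\<psi> d))) w" by (elim bexE)
  let ?\<chi> = "\<lambda>z. \<phi> (tensor_eval C \<psi> z)" and ?p = "T.pt v w"
  have p: "?p \<in> carrier CC" using T.pure_closed step.hyps(3) w by simp
  note ev = tensor_eval(2)[OF T.tensor_factors_axioms bimoduleD(2)[OF C] \<psi>]
  note la = lact_bitensor(2)[OF T.tensor_factors_axioms C]
  note CD = bimoduleD[OF C]
  have "h' (T.pt c d) \<oplus>\<^bsub>CC\<^esub> lact CC (?\<chi> (T.pt c d)) ?p =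
      h (T.pt c d) \<oplus>\<^bsub>T.TT\<^esub> T.pt (f (ract C c (\<psi> d)) \<oplus>\<^bsub>C\<^esub> lact C (\<phi> (ract C c (\<psi> d))) v) w"
    if cd: "c \<in> carrier C" "d \<in> carrier C" for c d
  proof -
    let ?x = "ract C c (\<psi> d)"
    have x: "?x \<in> carrier C" using CD(5) cd left_dualD(2)[OF \<psi>] by blast
    have \<phi>x: "\<phi> ?x \<in> carrier A" using left_dualD(2)[OF step.hyps(2) x] .
    have fx: "f ?x \<in> carrier C" using additive_mapD(1)[OF finite_rank_additive_C[OF step.hyps(1)] x] .
    have vx: "lact C (\<phi> ?x) v \<in> carrier C" using CD(4) \<phi>x step.hyps(3) by blast
    have "h (T.pt c d) \<in> carrier T.TT"
      using additive_mapD(1)[OF finite_rank_additive_tensor[OF h]] T.pure_closed[OF cd] by simp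
    then show ?thesis
      using h'(2) cd ev[OF cd] la[OF \<phi>x step.hyps(3) w] T.pure_add_left[OF fx vx w]
        T.pure_closed[OF fx w] T.pure_closed[OF vx w] by (simp add: T.TT.a_assoc)
  qed
  then show ?case
    by (intro bexI[OF _ finite_rank.step[OF h'(1) left_dual_eval_comp[OF step.hyps(2) \<psi>] p]] ballI)
qed

text \<open>For a summand \<open>\<psi>(-) w\<close> of \<open>g\<close>, balancedness rewrites
  \<open>c \<otimes> \<psi>(d) w\<close> as \<open>c \<psi>(d) \<otimes> w\<close>, which is not yet
  a functional times a vector. Replacing \<open>c \<psi>(d)\<close> by
  \<open>f (c \<psi>(d))\<close>, with \<open>f\<close> of finite rank, makes it a sum of such; this
  changes nothing if \<open>f\<close> fixes the elements \<open>c \<psi>(d)\<close>, which can be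
  arranged because \<open>P\<close> is finite.\<close>

lemma finite_rank_second_factor:
  assumes g: "g \<in> finite_rank A C" and P: "finite P" "P \<subseteq> carrier C \<times> carrier C"
  shows "\<exists>h\<in>finite_rank A CC. \<forall>(c, d)\<in>P. h (T.pt c d) = T.pt c (g d)"
  using g
proof induction
  case zero
  have "T.pt c \<zero>\<^bsub>C\<^esub> = \<zero>\<^bsub>T.TT\<^esub>" if "c \<in> carrier C" for c
    by (rule additive_map_zero[OF T.pure_additive_right[OF that] bimoduleD(1)[OF C] T.tensor_abelian])
  then show ?case using P(2) by (intro bexI[OF _ finite_rank.zero]) auto
next
  case (step g \<psi> w)
  then obtain h where h: "h \<in> finite_rank A CC" "\<forall>(c, d)\<in>P. h (T.pt c d) = T.pt c (g d)" by (elim bexE)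
  note CD = bimoduleD[OF C]
  let ?F = "(\<lambda>(c, d). ract C c (\<psi> d)) ` P"
  have "finite ?F" "?F \<subseteq> carrier C" using P CD(5) left_dualD(2)[OF step.hyps(2)] by auto
  from local_dual_basisD[OF ldb this] obtain f where f: "f \<in> finite_rank A C" "\<forall>x\<in>?F. f x = x" by (elim bexE)
  obtain h' where h': "h' \<in> finite_rank A CC" "\<forall>c\<in>carrier C. \<forall>d\<in>carrier C.
    h' (T.pt c d) = h (T.pt c d) \<oplus>\<^bsub>T.TT\<^esub> T.pt (f (ract C c (\<psi> d))) w"
    using finite_rank_add_summand[OF f(1) step.hyps(2,3) h(1)] by (elim bexE)
  have "h' (T.pt c d) = T.pt c (g d \<oplus>\<^bsub>C\<^esub> lact C (\<psi> d) w)" if "(c, d) \<in> P" for c d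
  proof -
    have cd: "c \<in> carrier C" "d \<in> carrier C" using that P(2) by auto
    have \<psi>d: "\<psi> d \<in> carrier A" using left_dualD(2)[OF step.hyps(2) cd(2)] .
    have gd: "g d \<in> carrier C" using additive_mapD(1)[OF finite_rank_additive_C[OF step.hyps(1)] cd(2)] .
    have "f (ract C c (\<psi> d)) = ract C c (\<psi> d)" using f(2) that by force
    moreover have "h (T.pt c d) = T.pt c (g d)" using h(2) that by auto
    moreover have "lact C (\<psi> d) w \<in> carrier C" using CD(4) \<psi>d step.hyps(3) by blast
    ultimately show ?thesis
      using h'(2) cd gd T.pure_add_right[OF cd(1) gd] T.pure_balanced[OF cd(1) \<psi>d step.hyps(3)] by simp
  qed
  then show ?case by (intro bexI[OF _ h'(1)]) auto
qed

text \<open>Collect the pure tensors that make up the given elements, and let \<open>g\<close> of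
  finite rank fix their second components. On these tensors \<open>id \<otimes> g\<close> is the
  identity and agrees with a finite rank map of \<open>C \<otimes> C\<close>.\<close>

lemma local_dual_basis_bitensor: "local_dual_basis A CC"
  unfolding local_dual_basis_def
proof (intro allI impI, elim conjE)
  fix F assume F: "finite F" "F \<subseteq> carrier CC"
  have "\<forall>z\<in>F. \<exists>P. finite P \<and> P \<subseteq> carrier C \<times> carrier C \<and> (\<forall>\<Phi>. additive_map T.TT T.TT \<Phi> \<longrightarrow>
      (\<forall>x y. (x, y) \<in> P \<longrightarrow> \<Phi> (T.pt x y) = T.pt x y) \<longrightarrow> \<Phi> z = z)"
  proof
    fix z assume "z \<in> F"
    then have "z \<in> carrier T.TT" using F(2) by auto
    then show "\<exists>P. finite P \<and> P \<subseteq> carrier C \<times> carrier C \<and> (\<forall>\<Phi>. additive_map T.TT T.TT \<Phi> \<longrightarrow>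
      (\<forall>x y. (x, y) \<in> P \<longrightarrow> \<Phi> (T.pt x y) = T.pt x y) \<longrightarrow> \<Phi> z = z)"
      by (rule T.tensor_finite_support)
  qed
  from bchoice[OF this] obtain P where P: "\<forall>z\<in>F. finite (P z) \<and> P z \<subseteq> carrier C \<times> carrier C \<and>
      (\<forall>\<Phi>. additive_map T.TT T.TT \<Phi> \<longrightarrow>
      (\<forall>x y. (x, y) \<in> P z \<longrightarrow> \<Phi> (T.pt x y) = T.pt x y) \<longrightarrow> \<Phi> z = z)" ..
  let ?P = "\<Union>z\<in>F. P z"
  note PD = P[THEN bspec, THEN conjunct1] P[THEN bspec, THEN conjunct2, THEN conjunct1]
    P[THEN bspec, THEN conjunct2, THEN conjunct2, THEN spec, THEN mp, THEN mp]
  have fin: "finite ?P" "?P \<subseteq> carrier C \<times> carrier C"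
    using F(1) PD(1) by (blast intro: finite_UN_I) (use PD(2) in blast)
  then have "finite (snd ` ?P)" "snd ` ?P \<subseteq> carrier C" by auto
  from local_dual_basisD[OF ldb this] obtain g
    where g: "g \<in> finite_rank A C" "\<forall>d\<in>snd ` ?P. g d = d" by (rule bexE)
  obtain h where h: "h \<in> finite_rank A CC" "\<forall>(c, d)\<in>?P. h (T.pt c d) = T.pt c (g d)"
    using finite_rank_second_factor[OF g(1) fin] by (rule bexE)
  have ha: "additive_map T.TT T.TT h" using finite_rank_additive_tensor[OF h(1)] by (simp add: additive_map_def)
  have "h z = z" if z: "z \<in> F" for z
  proof -
    have "h (T.pt x y) = T.pt x y" if "(x, y) \<in> P z" for x y
    proof -
      have xy: "(x, y) \<in> ?P" using that z by blast
      have "g y = y" using bspec[OF g(2) imageI[OF xy, of snd]] by simp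
      then show ?thesis using bspec[OF h(2) xy] by simp
    qed
    then show ?thesis using PD(3)[OF z ha] by simp
  qed
  then show "\<exists>h\<in>finite_rank A CC. \<forall>z\<in>F. h z = z" by (intro bexI[OF _ h(1)] ballI)
qed

end

section \<open>Comodules as modules over the left dual\<close>

definition comod_act :: "('a, 'c, 'm, 'z) comodule_scheme \<Rightarrow> ('c \<Rightarrow> 'a) \<Rightarrow> 'm \<Rightarrow> 'm"
  where "comod_act M \<phi> x = tensor_eval M \<phi> (coact M x)"

section \<open>Colinearity and stability in terms of functionals\<close>

lemma right_comoduleD:
  assumes "right_comodule A C M"
  shows "coring A C" "bimodule A C" "right_module A M" "tensor_factors A M C"
    "coact M \<in> right_hom A M (tensor A M C)" "x \<in> carrier M \<Longrightarrow> coact M x \<in> carrier (tensor A M C)"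
proof -
  interpret M: right_comodule A C M by fact
  show "coring A C" "bimodule A C" "right_module A M" by unfold_locales
  then show "tensor_factors A M C" using tensor_factorsI by blast
  show h: "coact M \<in> right_hom A M (tensor A M C)" by (rule M.coact_hom)
  show "x \<in> carrier M \<Longrightarrow> coact M x \<in> carrier (tensor A M C)"
    using h by (auto simp: right_hom_def)
qed

text \<open>Evaluations commute with the injective \<open>f\<close>, so tensors with equal images
  have equal evaluations and are equal by separation. This plays the part of flatness of
  \<open>W\<close>.\<close>

lemma tensor_map_inj:
  assumes T: "tensor_factors A K W" and T': "tensor_factors A M W"
    and K: "right_module A K" and M: "right_module A M" and W: "local_dual_basis A W"
    and f: "f \<in> right_hom A K M" "inj_on f (carrier K)"
  shows "inj_on (tensor_map A M W f (\<lambda>y. y)) (carrier (tensor A K W))"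
proof (rule inj_onI)
  fix s t assume st: "s \<in> carrier (tensor A K W)" "t \<in> carrier (tensor A K W)"
    and eq: "tensor_map A M W f (\<lambda>y. y) s = tensor_map A M W f (\<lambda>y. y) t"
  show "s = t"
  proof (rule tensor_separation[OF T K W st])
    fix \<phi> assume \<phi>: "\<phi> \<in> left_dual A W"
    note ev = tensor_eval_map[OF T T' K M f(1) \<phi>] and ac = additive_mapD(1)[OF tensor_eval(1)[OF T K \<phi>]]
    have "f (tensor_eval K \<phi> s) = f (tensor_eval K \<phi> t)"
      using ev[OF st(1)] ev[OF st(2)] eq by simp
    then show "tensor_eval K \<phi> s = tensor_eval K \<phi> t"
      by (rule inj_onD[OF f(2) _ ac[OF st(1)] ac[OF st(2)]])
  qed
qed

lemma comod_act_additive: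
  assumes M: "right_comodule A C M" and \<phi>: "\<phi> \<in> left_dual A C"
  shows "additive_map M M (comod_act M \<phi>)"
proof -
  note MD = right_comoduleD[OF M]
  have "additive_map M (tensor A M C) (coact M)" using MD(5) by (simp add: right_hom_iff)
  from additive_map_comp[OF tensor_eval(1)[OF MD(4,3) \<phi>] this]
  show ?thesis by (simp add: comod_act_def[abs_def])
qed

lemma counit_in_left_dual:
  assumes "coring A C" shows "counit C \<in> left_dual A C"
proof -
  interpret C: coring A C by fact
  show ?thesis using C.counit_closed C.counit_add C.counit_left
    by (auto simp: left_dual_def additive_map_def)
qed

lemma counit_times_in_left_dual:
  assumes "coring A C" "a \<in> carrier A" shows "(\<lambda>c. counit C c \<otimes>\<^bsub>A\<^esub> a) \<in> left_dual A C"
proof -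
  interpret C: coring A C by fact
  have "counit C x \<in> carrier A" if "x \<in> carrier C" for x using C.counit_closed that by auto
  then show ?thesis using C.counit_add C.counit_left assms(2)
    by (simp add: left_dual_def additive_map_def C.l_distr C.m_assoc)
qed

text \<open>By the counit law, \<open>\<Sum> m\<^sub>0 \<epsilon>(m\<^sub>1) a = m a\<close>. Thus
  the scalars of \<open>A\<close> act through operators.\<close>

lemma comod_act_counit:
  assumes M: "right_comodule A C M" and a: "a \<in> carrier A" and x: "x \<in> carrier M"
  shows "comod_act M (\<lambda>c. counit C c \<otimes>\<^bsub>A\<^esub> a) x = ract M x a"
proof -
  note MD = right_comoduleD[OF M]
  note \<epsilon> = counit_in_left_dual[OF MD(1)] and \<epsilon>a = counit_times_in_left_dual[OF MD(1) a]
  note ev = tensor_eval[OF MD(4,3) \<epsilon>] and eva = tensor_eval[OF MD(4,3) \<epsilon>a]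
  note RD = right_moduleD[OF MD(3)]
  have "tensor_eval M (\<lambda>c. counit C c \<otimes>\<^bsub>A\<^esub> a) (coact M x) = ract M (tensor_eval M (counit C) (coact M x)) a"
    by (rule tensor_factors.tensor_eqI[OF MD(4) MD(6)[OF x] eva(1) additive_map_comp[OF RD(3)[OF a] ev(1)]])
      (use ev(2) eva(2) RD(5) a left_dualD(2)[OF \<epsilon>] in simp)
  moreover have "tensor_eval M (counit C) (coact M x) = x"
    using right_comodule.coact_counit[OF M x] by (simp add: tensor_eval_def)
  ultimately show ?thesis by (simp add: comod_act_def)
qed

text \<open>For the converse, right linearity is commutation with the operators of the functionals
  \<open>\<epsilon>(c) a\<close>; colinearity follows by separation, since the two tensors to be
  compared have equal evaluations.\<close>

lemma comod_hom_iff: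
  assumes M: "right_comodule A C M" and N: "right_comodule A C N" and ldb: "local_dual_basis A C"
  shows "f \<in> comod_hom A C M N \<longleftrightarrow> additive_map M N f \<and>
    (\<forall>\<phi>\<in>left_dual A C. \<forall>x\<in>carrier M. f (comod_act M \<phi> x) = comod_act N \<phi> (f x))"
proof
  note MD = right_comoduleD[OF M] and ND = right_comoduleD[OF N]
  assume "f \<in> comod_hom A C M N"
  then have f: "f \<in> right_hom A M N"
    and co: "\<And>x. x \<in> carrier M \<Longrightarrow> coact N (f x) = tensor_map A N C f (\<lambda>y. y) (coact M x)"
    by (auto simp: comod_hom_def)
  have "f (comod_act M \<phi> x) = comod_act N \<phi> (f x)" if "\<phi> \<in> left_dual A C" "x \<in> carrier M" for \<phi> x
    using tensor_eval_map[OF MD(4) ND(4) MD(3) ND(3) f that(1) MD(6)[OF that(2)]] co[OF that(2)]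
    by (simp add: comod_act_def)
  then show "additive_map M N f \<and>
    (\<forall>\<phi>\<in>left_dual A C. \<forall>x\<in>carrier M. f (comod_act M \<phi> x) = comod_act N \<phi> (f x))"
    using f by (simp add: right_hom_iff)
next
  note MD = right_comoduleD[OF M] and ND = right_comoduleD[OF N]
  assume "additive_map M N f \<and>
    (\<forall>\<phi>\<in>left_dual A C. \<forall>x\<in>carrier M. f (comod_act M \<phi> x) = comod_act N \<phi> (f x))"
  then have f: "additive_map M N f"
    and act: "\<And>\<phi> x. \<lbrakk>\<phi> \<in> left_dual A C; x \<in> carrier M\<rbrakk> \<Longrightarrow> f (comod_act M \<phi> x) = comod_act N \<phi> (f x)"
    by auto
  have fr: "f \<in> right_hom A M N"
    unfolding right_hom_iff
  proof (intro conjI ballI f)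
    fix a x assume a: "a \<in> carrier A" and x: "x \<in> carrier M"
    show "f (ract M x a) = ract N (f x) a"
      using act[OF counit_times_in_left_dual[OF MD(1) a] x] comod_act_counit[OF M a x]
        comod_act_counit[OF N a additive_mapD(1)[OF f x]] by simp
  qed
  have "coact N (f x) = tensor_map A N C f (\<lambda>y. y) (coact M x)" if x: "x \<in> carrier M" for x
  proof (rule tensor_separation[OF ND(4,3) ldb ND(6)[OF additive_mapD(1)[OF f x]]
        additive_mapD(1)[OF tensor_map(1)[OF MD(4) ND(4) fr left_hom_id] MD(6)[OF x]]])
    fix \<phi> assume \<phi>: "\<phi> \<in> left_dual A C"
    show "tensor_eval N \<phi> (coact N (f x)) = tensor_eval N \<phi> (tensor_map A N C f (\<lambda>y. y) (coact M x))"
      using tensor_eval_map[OF MD(4) ND(4) MD(3) ND(3) fr \<phi> MD(6)[OF x]] act[OF \<phi> x]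
      by (simp add: comod_act_def)
  qed
  then show "f \<in> comod_hom A C M N" using fr by (simp add: comod_hom_def)
qed

text \<open>Colinearity of the inclusion forces the action computed from \<open>\<rho>\<close> to be
  the action of \<open>M\<close>, whichever coaction \<open>\<rho>\<close> is given.\<close>

lemma subcomodule_viaD:
  assumes M: "right_comodule A C M" and ldb: "local_dual_basis A C" and K: "subcomodule_via A C M K \<rho>"
  shows "K \<subseteq> carrier M" "right_comodule A C (M\<lparr>carrier := K, coact := \<rho>\<rparr>)"
    "\<And>\<phi> x. \<lbrakk>\<phi> \<in> left_dual A C; x \<in> K\<rbrakk> \<Longrightarrow> comod_act (M\<lparr>carrier := K, coact := \<rho>\<rparr>) \<phi> x = comod_act M \<phi> x"
    "\<And>\<phi> x. \<lbrakk>\<phi> \<in> left_dual A C; x \<in> K\<rbrakk> \<Longrightarrow> comod_act M \<phi> x \<in> K"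
    "\<zero>\<^bsub>M\<^esub> \<in> K" "\<And>x y. \<lbrakk>x \<in> K; y \<in> K\<rbrakk> \<Longrightarrow> x \<oplus>\<^bsub>M\<^esub> y \<in> K" "\<And>x. x \<in> K \<Longrightarrow> \<ominus>\<^bsub>M\<^esub> x \<in> K"
    "\<And>x a. \<lbrakk>x \<in> K; a \<in> carrier A\<rbrakk> \<Longrightarrow> ract M x a \<in> K"
proof -
  let ?K = "M\<lparr>carrier := K, coact := \<rho>\<rparr>"
  have id: "(\<lambda>x. x) \<in> comod_hom A C ?K M" and KC: "right_comodule A C ?K"
    using K by (auto simp: subcomodule_via_def)
  then have id': "additive_map ?K M (\<lambda>x. x)"
    "\<And>\<phi> x. \<lbrakk>\<phi> \<in> left_dual A C; x \<in> K\<rbrakk> \<Longrightarrow> comod_act ?K \<phi> x = comod_act M \<phi> x"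
    using comod_hom_iff[OF KC M ldb] by auto
  show KM: "K \<subseteq> carrier M" using id'(1) by (auto simp: additive_map_def)
  show "right_comodule A C ?K" by (rule KC)
  show eq: "\<And>\<phi> x. \<lbrakk>\<phi> \<in> left_dual A C; x \<in> K\<rbrakk> \<Longrightarrow> comod_act ?K \<phi> x = comod_act M \<phi> x" by (rule id'(2))
  show "comod_act M \<phi> x \<in> K" if "\<phi> \<in> left_dual A C" "x \<in> K" for \<phi> x
    using additive_mapD(1)[OF comod_act_additive[OF KC that(1)], of x] eq that by simp
  note RK = right_moduleD[OF right_comoduleD(3)[OF KC]] and RM = right_moduleD[OF right_comoduleD(3)[OF M]]
  interpret K: abelian_group ?K by (rule RK(1))
  show "\<zero>\<^bsub>M\<^esub> \<in> K" using K.zero_closed by simp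
  show "x \<oplus>\<^bsub>M\<^esub> y \<in> K" if "x \<in> K" "y \<in> K" for x y using K.a_closed[of x y] that by simp
  \<comment> \<open>Negation in the restricted record is a description relative to its own carrier,
    a different term from negation in \<open>M\<close>; additivity of the inclusion identifies the
    two.\<close>
  show "\<ominus>\<^bsub>M\<^esub> x \<in> K" if "x \<in> K" for x
    using K.a_inv_closed[of x] additive_map_minus[OF id'(1) RK(1) RM(1), of x] that by simp
  show "ract M x a \<in> K" if "x \<in> K" "a \<in> carrier A" for x a
    using RK(2)[OF that(2), of x] that by simp
qed

text \<open>A coaction \<open>\<rho>\<close> takes values in \<open>K \<otimes> C\<close>, which has
  to be formed before \<open>\<rho>\<close> exists. This and the next rules say that storing
  \<open>\<rho>\<close> in the record leaves the tensor constructions unchanged.\<close>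

lemma pure_tensor_update [simp]:
  "pure_tensor A (M\<lparr>carrier := K, coact := \<rho>\<rparr>) N = pure_tensor A (M\<lparr>carrier := K\<rparr>) N"
  by (intro ext) (simp add: pure_tensor_def tensor_rel_def)

lemma tensor_update [simp]:
  "tensor A (M\<lparr>carrier := K, coact := \<rho>\<rparr>) N = tensor A (M\<lparr>carrier := K\<rparr>) N"
  unfolding tensor_def pure_tensor_update tensor_ring_def tensor_group_def by (simp add: tensor_rel_def)

lemma tensor_assoc_update [simp]:
  "tensor_assoc A (M\<lparr>carrier := K, coact := \<rho>\<rparr>) N P = tensor_assoc A (M\<lparr>carrier := K\<rparr>) N P"
  unfolding tensor_assoc_def tensor_update pure_tensor_update ..

lemma tensor_map_update [simp]:
  "tensor_map A (M\<lparr>carrier := K, coact := \<rho>\<rparr>) N = tensor_map A (M\<lparr>carrier := K\<rparr>) N"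
  by (intro ext) (simp add: tensor_map_def)

text \<open>Right linearity of \<open>f \<otimes> id\<close> is what allows it to be tensored once
  more, as naturality of the associativity map demands.\<close>

lemma tensor_map_right_hom:
  assumes K: "right_module A K" and M: "right_module A M" and N: "bimodule A N"
    and f: "f \<in> right_hom A K M"
  shows "tensor_map A M N f (\<lambda>y. y) \<in> right_hom A (tensor A K N) (tensor A M N)"
    (is "?j \<in> _")
  unfolding right_hom_iff
proof (intro conjI ballI)
  note TK = tensor_factorsI[OF K N] and TM = tensor_factorsI[OF M N]
  note j = tensor_map[OF TK TM f left_hom_id]
  note rK = ract_tensor[OF TK N] and rM = ract_tensor[OF TM N]
  have fc: "f x \<in> carrier M" if "x \<in> carrier K" for x using f that by (auto simp: right_hom_def)
  show "additive_map (tensor A K N) (tensor A M N) ?j" by (rule j(1))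
  fix a t assume a: "a \<in> carrier A" and t: "t \<in> carrier (tensor A K N)"
  show "?j (ract (tensor A K N) t a) = ract (tensor A M N) (?j t) a"
    by (rule tensor_factors.tensor_eqI[OF TK t additive_map_comp[OF j(1) rK(1)[OF a]]
        additive_map_comp[OF rM(1)[OF a] j(1)]])
      (use rK(2)[OF a] rM(2)[OF a] j(2) fc bimoduleD(5)[OF N a] in simp)
qed

lemma tensor_assoc_natural:
  assumes K: "right_module A K" and M: "right_module A M" and N: "bimodule A N" and P: "bimodule A P"
    and f: "f \<in> right_hom A K M" and u: "u \<in> carrier (tensor A (tensor A K N) P)"
  shows "tensor_map A M (bitensor A N P) f (\<lambda>y. y) (tensor_assoc A K N P u) =
    tensor_assoc A M N P (tensor_map A (tensor A M N) P (tensor_map A M N f (\<lambda>y. y)) (\<lambda>z. z) u)"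
proof -
  note TK = tensor_factorsI[OF K N] and TM = tensor_factorsI[OF M N]
  note LK = tensor_factors_tensor_left[OF TK N P] and LM = tensor_factors_tensor_left[OF TM N P]
  note RK = tensor_factors_bitensor[OF K N P] and RM = tensor_factors_bitensor[OF M N P]
  note aK = tensor_assoc[OF K N P] and aM = tensor_assoc[OF M N P]
  let ?j = "tensor_map A M N f (\<lambda>y. y)" and ?J = "tensor_map A M (bitensor A N P) f (\<lambda>y. y)"
  note j = tensor_map[OF TK TM f left_hom_id] and J = tensor_map[OF RK RM f left_hom_id]
  have fc: "f x \<in> carrier M" if "x \<in> carrier K" for x using f that by (auto simp: right_hom_def)
  have TNP: "tensor_factors A N P" by (rule tensor_factorsI[OF bimoduleD(2)[OF N] P])
  note jr = tensor_map_right_hom[OF K M N f]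
  note jL = tensor_map[OF LK LM jr left_hom_id]
  have jc: "?j s \<in> carrier (tensor A M N)" if "s \<in> carrier (tensor A K N)" for s
    by (rule additive_mapD(1)[OF j(1) that])
  show "?J (tensor_assoc A K N P u) = tensor_assoc A M N P (tensor_map A (tensor A M N) P ?j (\<lambda>z. z) u)"
  proof (rule tensor_factors.tensor_eqI[OF LK u additive_map_comp[OF J(1) aK(1)]
        additive_map_comp[OF aM(1) jL(1)]])
    fix s z assume s: "s \<in> carrier (tensor A K N)" and z: "z \<in> carrier P"
    note pK = tensor_factors.pure_additive_left[OF LK z] and pM = tensor_factors.pure_additive_left[OF LM z]
    \<comment> \<open>Elements of the left factor \<open>K \<otimes> N\<close> are themselves
      tensors, so a second reduction to pure tensors, with \<open>z\<close> fixed, takes place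
      here.\<close>
    have "?J (tensor_assoc A K N P (pure_tensor A (tensor A K N) P s z)) =
        tensor_assoc A M N P (pure_tensor A (tensor A M N) P (?j s) z)"
    proof (rule tensor_factors.tensor_eqI[OF TK s
          additive_map_comp[OF additive_map_comp[OF J(1) aK(1)] pK]
          additive_map_comp[OF aM(1) additive_map_comp[OF pM j(1)]]])
      fix x y assume x: "x \<in> carrier K" and y: "y \<in> carrier N"
      have yz: "pure_tensor A N P y z \<in> carrier (bitensor A N P)"
        using tensor_factors.pure_closed[OF TNP y z] by simp
      show "?J (tensor_assoc A K N P (pure_tensor A (tensor A K N) P (pure_tensor A K N x y) z)) =
          tensor_assoc A M N P (pure_tensor A (tensor A M N) P (?j (pure_tensor A K N x y)) z)"
        using aK(2)[OF x y z] aM(2)[OF fc[OF x] y z] j(2)[OF x y] J(2)[OF x yz] by simp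
    qed
    then show "?J (tensor_assoc A K N P (pure_tensor A (tensor A K N) P s z)) =
        tensor_assoc A M N P (tensor_map A (tensor A M N) P ?j (\<lambda>z. z) (pure_tensor A (tensor A K N) P s z))"
      using jL(2)[OF s z] by simp
  qed
qed

section \<open>Subcomodules from stable subgroups\<close>

lemma right_module_cong:
  assumes M: "right_module A M"
    and "carrier N = carrier M" "add N = add M" "zero N = zero M" "ract N = ract M"
  shows "right_module A N"
proof -
  interpret M: right_module A M by fact
  have "abelian_group N" by (rule abelian_group_cong[OF M.M.abelian_group_axioms assms(2-4)])
  then show ?thesis
    by (intro right_module.intro right_module_axioms.intro M.ring_axioms)
      (simp_all add: assms(2-5) M.ract_closed M.ract_r_distr M.ract_l_distr M.ract_assoc M.ract_one)
qed

lemma right_module_restrict: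
  assumes M: "right_module A M" and K: "K \<subseteq> carrier M" "\<zero>\<^bsub>M\<^esub> \<in> K"
    "\<And>x y. \<lbrakk>x \<in> K; y \<in> K\<rbrakk> \<Longrightarrow> x \<oplus>\<^bsub>M\<^esub> y \<in> K" "\<And>x. x \<in> K \<Longrightarrow> \<ominus>\<^bsub>M\<^esub> x \<in> K"
    "\<And>x a. \<lbrakk>x \<in> K; a \<in> carrier A\<rbrakk> \<Longrightarrow> ract M x a \<in> K"
  shows "right_module A (M\<lparr>carrier := K\<rparr>)"
proof -
  interpret M: right_module A M by fact
  have c: "x \<in> carrier M" if "x \<in> K" for x using K(1) that by blast
  have "abelian_group (M\<lparr>carrier := K\<rparr>)"
  proof (rule abelian_groupI)
    fix x assume x: "x \<in> carrier (M\<lparr>carrier := K\<rparr>)"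
    show "\<exists>y\<in>carrier (M\<lparr>carrier := K\<rparr>). y \<oplus>\<^bsub>M\<lparr>carrier := K\<rparr>\<^esub> x = \<zero>\<^bsub>M\<lparr>carrier := K\<rparr>\<^esub>"
      using x K(4) c M.M.l_neg by (intro bexI[of _ "\<ominus>\<^bsub>M\<^esub> x"]) simp_all
  qed (use K(2,3) c in \<open>simp_all add: M.M.a_ac\<close>)
  then show ?thesis
    by (intro right_module.intro right_module_axioms.intro M.ring_axioms)
      (use K(5) c in \<open>auto simp: M.ract_r_distr M.ract_l_distr M.ract_assoc M.ract_one\<close>)
qed

text \<open>All evaluations of \<open>coact M x\<close> lie in \<open>K\<close>, so it is the image
  of an element of \<open>K \<otimes> C\<close>; choosing one gives \<open>\<rho> x\<close>. The
  maps \<open>?j\<close> on \<open>K \<otimes> C\<close> and \<open>?J\<close> on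
  \<open>K \<otimes> (C \<otimes> C)\<close> are injective, so additivity, linearity and
  coassociativity of \<open>\<rho>\<close> are inherited from \<open>M\<close>.\<close>

lemma subcomoduleI:
  assumes M: "right_comodule A C M" and ldb: "local_dual_basis A C"
    and K: "K \<subseteq> carrier M" "\<zero>\<^bsub>M\<^esub> \<in> K"
    "\<And>x y. \<lbrakk>x \<in> K; y \<in> K\<rbrakk> \<Longrightarrow> x \<oplus>\<^bsub>M\<^esub> y \<in> K" "\<And>x. x \<in> K \<Longrightarrow> \<ominus>\<^bsub>M\<^esub> x \<in> K"
    and act: "\<And>\<phi> x. \<lbrakk>\<phi> \<in> left_dual A C; x \<in> K\<rbrakk> \<Longrightarrow> comod_act M \<phi> x \<in> K"
  shows "subcomodule A C M K"
proof -
  note MD = right_comoduleD[OF M]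
  interpret M: right_comodule A C M by fact
  have c: "x \<in> carrier M" if "x \<in> K" for x using K(1) that by blast
  have rc: "ract M x a \<in> K" if "x \<in> K" "a \<in> carrier A" for x a
    using act[OF counit_times_in_left_dual[OF MD(1) that(2)] that(1)] comod_act_counit[OF M that(2) c[OF that(1)]]
    by simp
  let ?K = "M\<lparr>carrier := K\<rparr>" and ?D = "bitensor A C C"
  have RK: "right_module A ?K" by (rule right_module_restrict[OF MD(3) K rc])
  note TK = tensor_factorsI[OF RK MD(2)]
  have id: "(\<lambda>x. x) \<in> right_hom A ?K M" using K(1) by (auto simp: right_hom_iff additive_map_def)
  let ?j = "tensor_map A M C (\<lambda>x. x) (\<lambda>y. y)" and ?J = "tensor_map A M ?D (\<lambda>x. x) (\<lambda>y. y)"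
  note j = tensor_map[OF TK MD(4) id left_hom_id]
  have j_inj: "inj_on ?j (carrier (tensor A ?K C))"
    by (rule tensor_map_inj[OF TK MD(4) RK MD(3) ldb id]) (simp add: inj_on_def)
  note RD = tensor_factors_bitensor[OF RK MD(2,2)] and RM = tensor_factors_bitensor[OF MD(3,2,2)]
  \<comment> \<open>Coassociativity is an equation in a tensor product with
    \<open>C \<otimes> C\<close>; here the local dual basis of \<open>C \<otimes> C\<close>
    enters.\<close>
  have J_inj: "inj_on ?J (carrier (tensor A ?K ?D))"
    by (rule tensor_map_inj[OF RD RM RK MD(3) local_dual_basis_bitensor[OF MD(2) ldb] id])
      (simp add: inj_on_def)
  note nat = tensor_assoc_natural[OF RK MD(3) MD(2,2) id] and jr = tensor_map_right_hom[OF RK MD(3,2) id]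
  have "\<forall>x\<in>K. \<exists>t. t \<in> carrier (tensor A ?K C) \<and> ?j t = coact M x"
  proof
    fix x assume x: "x \<in> K"
    have "coact M x \<in> ?j ` carrier (tensor A ?K C)"
    proof (rule tensor_in_image[OF MD(4,3) ldb TK id MD(6)[OF c[OF x]]])
      show "tensor_eval M \<phi> (coact M x) \<in> (\<lambda>x. x) ` carrier ?K" if "\<phi> \<in> left_dual A C" for \<phi>
        using act[OF that x] by (simp add: comod_act_def)
    qed
    then show "\<exists>t. t \<in> carrier (tensor A ?K C) \<and> ?j t = coact M x" by auto
  qed
  from bchoice[OF this] obtain \<rho>
    where "\<forall>x\<in>K. \<rho> x \<in> carrier (tensor A ?K C) \<and> ?j (\<rho> x) = coact M x" ..
  then have \<rho>: "\<rho> x \<in> carrier (tensor A ?K C)" "?j (\<rho> x) = coact M x" if "x \<in> K" for x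
    using that by simp_all
  let ?L = "M\<lparr>carrier := K, coact := \<rho>\<rparr>"
  interpret TK: tensor_factors A ?K C by (rule TK)
  have coM: "additive_map M (tensor A M C) (coact M)"
    "\<And>a x. \<lbrakk>a \<in> carrier A; x \<in> carrier M\<rbrakk> \<Longrightarrow> coact M (ract M x a) = ract (tensor A M C) (coact M x) a"
    using MD(5) by (auto simp: right_hom_iff)
  have \<rho>_hom: "\<rho> \<in> right_hom A ?K (tensor A ?K C)"
    unfolding right_hom_iff additive_map_def
  proof (intro conjI ballI)
    fix x assume "x \<in> carrier ?K"
    then have x: "x \<in> K" by simp
    show "\<rho> x \<in> carrier (tensor A ?K C)" by (rule \<rho>(1)[OF x])
    fix y assume "y \<in> carrier ?K"
    then have y: "y \<in> K" by simp
    have "\<rho> (x \<oplus>\<^bsub>M\<^esub> y) = \<rho> x \<oplus>\<^bsub>tensor A ?K C\<^esub> \<rho> y"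
    proof (rule inj_onD[OF j_inj _ \<rho>(1)[OF K(3)[OF x y]] TK.TT.a_closed[OF \<rho>(1)[OF x] \<rho>(1)[OF y]]])
      show "?j (\<rho> (x \<oplus>\<^bsub>M\<^esub> y)) = ?j (\<rho> x \<oplus>\<^bsub>tensor A ?K C\<^esub> \<rho> y)"
        using additive_mapD(2)[OF j(1) \<rho>(1)[OF x] \<rho>(1)[OF y]] additive_mapD(2)[OF coM(1) c[OF x] c[OF y]]
          \<rho>(2)[OF x] \<rho>(2)[OF y] \<rho>(2)[OF K(3)[OF x y]] by simp
    qed
    then show "\<rho> (x \<oplus>\<^bsub>?K\<^esub> y) = \<rho> x \<oplus>\<^bsub>tensor A ?K C\<^esub> \<rho> y" by simp
  next
    fix a x assume a: "a \<in> carrier A" and "x \<in> carrier ?K"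
    then have x: "x \<in> K" by simp
    have "\<rho> (ract M x a) = ract (tensor A ?K C) (\<rho> x) a"
    proof (rule inj_onD[OF j_inj _ \<rho>(1)[OF rc[OF x a]]
          additive_mapD(1)[OF ract_tensor(1)[OF TK MD(2) a] \<rho>(1)[OF x]]])
      have "?j (ract (tensor A ?K C) (\<rho> x) a) = ract (tensor A M C) (?j (\<rho> x)) a"
        using jr a \<rho>(1)[OF x] by (simp add: right_hom_iff)
      then show "?j (\<rho> (ract M x a)) = ?j (ract (tensor A ?K C) (\<rho> x) a)"
        using \<rho>(2)[OF x] \<rho>(2)[OF rc[OF x a]] coM(2)[OF a c[OF x]] by simp
    qed
    then show "\<rho> (ract ?K x a) = ract (tensor A ?K C) (\<rho> x) a" by simp
  qed
  note LK = tensor_factors_tensor_left[OF TK MD(2,2)] and LM = tensor_factors_tensor_left[OF MD(4,2,2)]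
  have coK: "coact M \<in> right_hom A ?K (tensor A M C)"
    using coM c by (simp add: right_hom_iff additive_map_def)
  have coassoc: "tensor_assoc A ?K C C (tensor_map A (tensor A ?K C) C \<rho> (\<lambda>y. y) (\<rho> x)) =
      tensor_map A ?K ?D (\<lambda>y. y) (comult C) (\<rho> x)" if x: "x \<in> K" for x
  proof (rule inj_onD[OF J_inj])
    note \<rho>x = \<rho>(1)[OF x]
    have u: "tensor_map A (tensor A ?K C) C \<rho> (\<lambda>y. y) (\<rho> x) \<in> carrier (tensor A (tensor A ?K C) C)"
      by (rule additive_mapD(1)[OF tensor_map(1)[OF TK LK \<rho>_hom left_hom_id] \<rho>x])
    show "tensor_assoc A ?K C C (tensor_map A (tensor A ?K C) C \<rho> (\<lambda>y. y) (\<rho> x)) \<in> carrier (tensor A ?K ?D)"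
      by (rule additive_mapD(1)[OF tensor_assoc(1)[OF RK MD(2,2)] u])
    show "tensor_map A ?K ?D (\<lambda>y. y) (comult C) (\<rho> x) \<in> carrier (tensor A ?K ?D)"
      by (rule additive_mapD(1)[OF tensor_map(1)[OF TK RD right_hom_id M.comult_left] \<rho>x])
    \<comment> \<open>By way of \<open>?j (\<rho> x) = coact M x\<close>, these four composites
      carry the two sides under \<open>?J\<close> to the two sides of coassociativity of
      \<open>M\<close> at \<open>x\<close>.\<close>
    have 1: "tensor_map A (tensor A M C) C ?j (\<lambda>z. z) (tensor_map A (tensor A ?K C) C \<rho> (\<lambda>y. y) (\<rho> x)) =
        tensor_map A (tensor A M C) C (coact M) (\<lambda>y. y) (\<rho> x)"
      by (rule tensor_map_comp[OF TK LK LM \<rho>_hom left_hom_id jr left_hom_id coK left_hom_id _ _ \<rho>x])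
        (use \<rho>(2) in simp_all)
    have 2: "tensor_map A (tensor A M C) C (coact M) (\<lambda>z. z) (?j (\<rho> x)) =
        tensor_map A (tensor A M C) C (coact M) (\<lambda>y. y) (\<rho> x)"
      by (rule tensor_map_comp[OF TK MD(4) LM id left_hom_id MD(5) left_hom_id coK left_hom_id _ _ \<rho>x]) simp_all
    have 3: "?J (tensor_map A ?K ?D (\<lambda>y. y) (comult C) (\<rho> x)) =
        tensor_map A M ?D (\<lambda>y. y) (comult C) (\<rho> x)"
      by (rule tensor_map_comp[OF TK RD RM right_hom_id M.comult_left id left_hom_id id M.comult_left _ _ \<rho>x])
        simp_all
    have 4: "tensor_map A M ?D (\<lambda>y. y) (comult C) (?j (\<rho> x)) =
        tensor_map A M ?D (\<lambda>y. y) (comult C) (\<rho> x)"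
      by (rule tensor_map_comp[OF TK MD(4) RM id left_hom_id right_hom_id M.comult_left id M.comult_left _ _ \<rho>x])
        simp_all
    show "?J (tensor_assoc A ?K C C (tensor_map A (tensor A ?K C) C \<rho> (\<lambda>y. y) (\<rho> x))) =
        ?J (tensor_map A ?K ?D (\<lambda>y. y) (comult C) (\<rho> x))"
      using nat[OF u] 1 2 3 4 M.coact_coassoc[OF c[OF x]] \<rho>(2)[OF x] by simp
  qed
  have RL: "right_module A ?L" by (rule right_module_cong[OF RK]) simp_all
  have idL: "(\<lambda>x. x) \<in> right_hom A ?L M" using id by (simp add: right_hom_def)
  \<comment> \<open>Evaluation at the counit commutes with the inclusion, so the value is the one
    given by the counit law of \<open>M\<close>.\<close>
  have counit: "tensor_eval ?L (counit C) (\<rho> x) = x" if x: "x \<in> K" for x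
    using tensor_eval_map[OF tensor_factorsI[OF RL MD(2)] MD(4) RL MD(3) idL counit_in_left_dual[OF MD(1)],
        of "\<rho> x"] \<rho>[OF x] M.coact_counit[OF c[OF x]] by (simp add: tensor_eval_def)
  from RL have "right_comodule A C ?L"
    using \<rho>_hom coassoc counit
    by (intro right_comodule.intro right_comodule_axioms.intro MD(1))
      (simp_all add: right_hom_def tensor_eval_def)
  moreover have "(\<lambda>x. x) \<in> comod_hom A C ?L M"
    using id \<rho>(2) by (simp add: comod_hom_def right_hom_def)
  ultimately show ?thesis unfolding subcomodule_def subcomodule_via_def by blast
qed

section \<open>Factor comodules and the self-cogenerator condition\<close>

lemma factor_module:
  assumes M: "right_module A M" and K: "K \<subseteq> carrier M" "\<zero>\<^bsub>M\<^esub> \<in> K"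
    "\<And>x y. \<lbrakk>x \<in> K; y \<in> K\<rbrakk> \<Longrightarrow> x \<oplus>\<^bsub>M\<^esub> y \<in> K" "\<And>x. x \<in> K \<Longrightarrow> \<ominus>\<^bsub>M\<^esub> x \<in> K"
    "\<And>x a. \<lbrakk>x \<in> K; a \<in> carrier A\<rbrakk> \<Longrightarrow> ract M x a \<in> K"
  shows "abelian_subgroup K M" "abelian_group (factor_module M K)"
    "a_r_coset M K \<in> right_hom A M (factor_module M K)"
    "carrier (factor_module M K) = a_r_coset M K ` carrier M"
    "\<And>a X. \<lbrakk>a \<in> carrier A; X \<in> carrier (factor_module M K)\<rbrakk> \<Longrightarrow> ract (factor_module M K) X a \<in> carrier (factor_module M K)"
proof -
  interpret M: right_module A M by fact
  let ?Q = "factor_module M K" and ?p = "a_r_coset M K"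
  have "subgroup K (add_monoid M)"
    using K(1-4) by (intro subgroup.intro) (auto simp: a_inv_def)
  then show sg: "abelian_subgroup K M"
    by (intro abelian_subgroupI3 additive_subgroup.intro M.M.abelian_group_axioms)
  then interpret K: abelian_subgroup K M .
  show Q: "abelian_group ?Q"
    by (rule abelian_group_if_comm_group[OF K.a_factorgroup_is_comm_group])
      (simp_all add: factor_module_def A_FactGroup_def FactGroup_def A_RCOSETS_def set_add_def)
  show carr: "carrier ?Q = ?p ` carrier M"
    by (auto simp: factor_module_def A_RCOSETS_def RCOSETS_def a_r_coset_def)
  have add: "additive_map M ?Q ?p"
    using carr K.a_rcos_sum by (auto simp: additive_map_def factor_module_def)
  have pK: "?p k = K" if "k \<in> K" for k by (rule K.a_rcos_const[OF that])
  have ract: "ract ?Q (?p x) a = ?p (ract M x a)" if x: "x \<in> carrier M" and a: "a \<in> carrier A" for x a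
  proof -
    \<comment> \<open>The action on a coset is a description over all its representatives; these
      differ by elements of \<open>K\<close>, and \<open>K\<close> is closed under
      \<open>A\<close>.\<close>
    have "?p (ract M y a) = ?p (ract M x a)" if y: "y \<in> ?p x" for y
    proof -
      obtain k where k: "k \<in> K" "y = k \<oplus>\<^bsub>M\<^esub> x" using y by (auto simp: a_r_coset_def')
      have kM: "k \<in> carrier M" using K(1) k(1) by blast
      have "?p (ract M y a) = ?p (ract M k a) \<oplus>\<^bsub>?Q\<^esub> ?p (ract M x a)"
        using k(2) M.ract_l_distr[OF a kM x] additive_mapD(2)[OF add] M.ract_closed a kM x by simp
      also have "?p (ract M k a) = \<zero>\<^bsub>?Q\<^esub>" using pK[OF K(5)[OF k(1) a]] by (simp add: factor_module_def)
      finally show ?thesis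
        using additive_mapD(1)[OF add M.ract_closed[OF a x]] Q by (simp add: abelian_group_def abelian_monoid.l_zero)
    qed
    moreover have "x \<in> ?p x" using K.a_rcos_self[OF x] .
    ultimately have "(\<lambda>y. ?p (ract M y a)) ` ?p x = {?p (ract M x a)}" by blast
    then show ?thesis by (simp add: factor_module_def)
  qed
  show "?p \<in> right_hom A M ?Q" using add ract by (simp add: right_hom_iff)
  show "ract ?Q X a \<in> carrier ?Q" if "a \<in> carrier A" "X \<in> carrier ?Q" for a X
    using that carr ract M.ract_closed by auto
qed

lemma factor_comodule_simps:
  "carrier (factor_comodule A C M K) = carrier (factor_module M K)"
  "add (factor_comodule A C M K) = add (factor_module M K)"
  "zero (factor_comodule A C M K) = K" "zero (factor_module M K) = K"
  "ract (factor_comodule A C M K) = ract (factor_module M K)"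
  by (simp_all add: factor_comodule_def rmodule.defs factor_module_def)

text \<open>Once the coaction of the factor is known to send the class of \<open>x\<close> to
  \<open>p \<otimes> id\<close> applied to \<open>coact M x\<close>, colinearity of \<open>h\<close>
  after \<open>p\<close> is functoriality of the tensor product.\<close>

lemma comod_hom_from_factor:
  assumes M: "right_comodule A C M" and ldb: "local_dual_basis A C" and K: "subcomodule_via A C M K \<rho>"
    and h: "h \<in> comod_hom A C (factor_comodule A C M K) M"
  shows "(\<lambda>x. h (K +>\<^bsub>M\<^esub> x)) \<in> comod_hom A C M M"
proof -
  note MD = right_comoduleD[OF M] and KD = subcomodule_viaD[OF M ldb K]
  note Q = factor_module[OF MD(3) KD(1,5,6,7,8)]
  let ?Q = "factor_module M K" and ?p = "a_r_coset M K" and ?L = "M\<lparr>carrier := K, coact := \<rho>\<rparr>"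
  interpret K: abelian_subgroup K M by (rule Q(1))
  note TL = right_comoduleD(4)[OF KD(2)]
  have TQ: "tensor_factors A ?Q C"
    using Q(2,5) bimoduleD(1,4)[OF MD(2)] by (simp add: tensor_factors_def tensor_factors_axioms_def)
  interpret TQ: tensor_factors A ?Q C by (rule TQ)
  let ?P = "tensor_map A ?Q C ?p (\<lambda>c. c)" and ?j = "tensor_map A M C (\<lambda>x. x) (\<lambda>y. y)"
  note P = tensor_map[OF MD(4) TQ Q(3) left_hom_id]
  have pM: "additive_map M ?Q ?p" using Q(3) by (simp add: right_hom_iff)
  have id: "(\<lambda>x. x) \<in> right_hom A ?L M" and coK: "\<And>k. k \<in> K \<Longrightarrow> coact M k = ?j (\<rho> k)"
    using K by (auto simp: subcomodule_via_def comod_hom_def)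
  note j = tensor_map[OF TL MD(4) id left_hom_id]
  have coM: "additive_map M (tensor A M C) (coact M)" using MD(5) by (simp add: right_hom_iff)
  \<comment> \<open>The coaction of \<open>k\<close> comes from \<open>K \<otimes> C\<close>, where
    \<open>p\<close> kills the first component of every pure tensor. Hence the value of the factor
    coaction does not depend on the representative.\<close>
  have PK: "?P (coact M k) = \<zero>\<^bsub>tensor A ?Q C\<^esub>" if k: "k \<in> K" for k
  proof -
    have \<rho>k: "\<rho> k \<in> carrier (tensor A ?L C)" using right_comoduleD(6)[OF KD(2), of k] k by simp
    have "?P (?j (\<rho> k)) = \<zero>\<^bsub>tensor A ?Q C\<^esub>"
    proof (rule tensor_factors.tensor_eqI[OF TL \<rho>k additive_map_comp[OF P(1) j(1)]
          additive_map_const_zero[OF TQ.tensor_abelian]])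
      fix x y assume x: "x \<in> carrier ?L" and y: "y \<in> carrier C"
      then have "x \<in> K" "x \<in> carrier M" using KD(1) by auto
      moreover have "pure_tensor A ?Q C \<zero>\<^bsub>?Q\<^esub> y = \<zero>\<^bsub>tensor A ?Q C\<^esub>"
        by (rule additive_map_zero[OF TQ.pure_additive_left[OF y] Q(2) TQ.tensor_abelian])
      ultimately show "?P (?j (pure_tensor A ?L C x y)) = \<zero>\<^bsub>tensor A ?Q C\<^esub>"
        using j(2)[OF x y] P(2)[of x y] y K.a_rcos_const by (simp add: factor_comodule_simps)
    qed
    then show ?thesis using coK[OF k] by simp
  qed
  have coQ: "coact (factor_comodule A C M K) (?p x) = ?P (coact M x)" if x: "x \<in> carrier M" for x
  proof -
    have "?P (coact M y) = ?P (coact M x)" if y: "y \<in> ?p x" for y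
    proof -
      obtain k where k: "k \<in> K" "y = k \<oplus>\<^bsub>M\<^esub> x" using y by (auto simp: a_r_coset_def')
      have kM: "k \<in> carrier M" using KD(1) k(1) by blast
      have "?P (coact M y) = ?P (coact M k) \<oplus>\<^bsub>tensor A ?Q C\<^esub> ?P (coact M x)"
        using k(2) additive_mapD(2)[OF additive_map_comp[OF P(1) coM] kM x] by simp
      then show ?thesis
        using PK[OF k(1)] additive_mapD(1)[OF additive_map_comp[OF P(1) coM] x] by simp
    qed
    moreover have "x \<in> ?p x" using K.a_rcos_self[OF x] .
    ultimately have "(\<lambda>y. ?P (coact M y)) ` ?p x = {?P (coact M x)}" by blast
    then show ?thesis by (simp add: factor_comodule_def rmodule.defs)
  qed
  have hQ: "h \<in> right_hom A ?Q M"
    and hco: "\<And>X. X \<in> carrier ?Q \<Longrightarrow> coact M (h X) = tensor_map A M C h (\<lambda>y. y) (coact (factor_comodule A C M K) X)"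
    using h by (simp_all add: comod_hom_def right_hom_def factor_comodule_simps)
  have f: "(\<lambda>x. h (?p x)) \<in> right_hom A M M"
    using hQ Q(3) unfolding right_hom_iff
    by (auto intro: additive_map_comp simp: additive_mapD(1))
  have "coact M (h (?p x)) = tensor_map A M C (\<lambda>x. h (?p x)) (\<lambda>y. y) (coact M x)" if x: "x \<in> carrier M" for x
  proof -
    have "coact M (h (?p x)) = tensor_map A M C h (\<lambda>y. y) (?P (coact M x))"
      using hco[OF additive_mapD(1)[OF pM x]] coQ[OF x] by simp
    also have "\<dots> = tensor_map A M C (\<lambda>x. h (?p x)) (\<lambda>y. y) (coact M x)"
      by (rule tensor_map_comp[OF MD(4) TQ MD(4) Q(3) left_hom_id hQ left_hom_id f left_hom_id _ _ MD(6)[OF x]])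
        simp_all
    finally show ?thesis .
  qed
  then show ?thesis using f by (simp add: comod_hom_def)
qed

text \<open>The class of \<open>x\<close> is non-zero, so some colinear map on the factor does not
  kill it; its composite with the projection vanishes on \<open>K\<close> but not at
  \<open>x\<close>.\<close>

lemma self_cogenerator_separates:
  assumes M: "right_comodule A C M" and ldb: "local_dual_basis A C" and sc: "self_cogenerator A C M"
    and K: "subcomodule A C M K" and x: "x \<in> carrier M" "x \<notin> K"
  shows "\<exists>f\<in>comod_hom A C M M. (\<forall>k\<in>K. f k = \<zero>\<^bsub>M\<^esub>) \<and> f x \<noteq> \<zero>\<^bsub>M\<^esub>"
proof -
  obtain \<rho> where \<rho>: "subcomodule_via A C M K \<rho>" using K unfolding subcomodule_def ..
  note MD = right_comoduleD[OF M] and KD = subcomodule_viaD[OF M ldb \<rho>]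
  note Q = factor_module[OF MD(3) KD(1,5,6,7,8)]
  interpret K: abelian_subgroup K M by (rule Q(1))
  let ?F = "factor_comodule A C M K" and ?p = "a_r_coset M K"
  have "x \<in> ?p x" using K.a_rcos_self[OF x(1)] .
  then have "?p x \<noteq> K" using x(2) by auto
  moreover have "(\<Inter>h \<in> comod_hom A C ?F M. a_kernel ?F M h) = {K}"
    using sc K by (simp add: self_cogenerator_def factor_comodule_simps)
  ultimately obtain h where h: "h \<in> comod_hom A C ?F M" "?p x \<notin> a_kernel ?F M h" by blast
  have pF: "?p x \<in> carrier ?F" using Q(4) x(1) by (simp add: factor_comodule_simps)
  have "h (?p x) \<noteq> \<zero>\<^bsub>M\<^esub>" using h(2) pF by (simp add: a_kernel_def kernel_def)
  moreover have "h (?p k) = \<zero>\<^bsub>M\<^esub>" if "k \<in> K" for k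
  proof -
    have "additive_map (factor_module M K) M h"
      using h(1) by (auto simp: comod_hom_def right_hom_def factor_comodule_simps additive_map_def)
    from additive_map_zero[OF this Q(2) K.abelian_group_axioms]
    show ?thesis using K.a_rcos_const[OF that] by (simp add: factor_comodule_simps)
  qed
  ultimately show ?thesis
    by (intro bexI[OF _ comod_hom_from_factor[OF M ldb \<rho> h(1)]] conjI ballI)
qed

theorem theorem4p21:
  fixes R :: "'r ring"
    and A :: "('r, 'a) module"
    and C :: "('a, 'c) coring"
    and M :: "('a, 'c, 'm) comodule"
  assumes "cring R" and "\<one>\<^bsub>R\<^esub> \<noteq> \<zero>\<^bsub>R\<^esub>"
    and "unital_algebra R A"
    and "coring A C" and "carrier C \<noteq> {\<zero>\<^bsub>C\<^esub>}"
    and "locally_projective A (left_part C)"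
    and "right_comodule A C M" and "carrier M \<noteq> {\<zero>\<^bsub>M\<^esub>}"
    and "self_injective A C M" and "self_cogenerator A C M"
    and "commutative_comod_end A C M"
    and "fully_coprime A C M"
  shows "irreducible_comodule A C M"
proof -
  note M = \<open>right_comodule A C M\<close>
  note MD = right_comoduleD[OF M]
  have ldb: "local_dual_basis A C"
    by (rule locally_projective_dual_basis[OF MD(2) \<open>locally_projective A (left_part C)\<close>])
  interpret M: abelian_group M by (rule right_moduleD(1)[OF MD(3)])
  note act = additive_mapD[OF comod_act_additive[OF M]]
  interpret O: operator_group M "left_dual A C" "comod_act M"
    by unfold_locales (rule act; assumption)+
  have sub_iff: "O.op_subgroup K \<longleftrightarrow> subcomodule A C M K" for K
  proof
    assume "O.op_subgroup K"
    note KD = O.op_subgroupD[OF this]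
    show "subcomodule A C M K" by (rule subcomoduleI[OF M ldb KD(1,3-6)])
  next
    assume "subcomodule A C M K"
    then obtain \<rho> where \<rho>: "subcomodule_via A C M K \<rho>" unfolding subcomodule_def ..
    note KD = subcomodule_viaD[OF M ldb \<rho>]
    show "O.op_subgroup K" by (rule O.op_subgroupI[OF KD(1,5,6,7,4)])
  qed
  have hom_iff: "f \<in> O.op_hom (carrier M) \<longleftrightarrow> f \<in> comod_hom A C M M" for f
    unfolding comod_hom_iff[OF M M ldb] O.op_hom_def additive_map_def by auto
  then have hom_eq: "O.op_hom (carrier M) = comod_hom A C M M" by blast
  interpret O: coprime_operator_group M "left_dual A C" "comod_act M"
  proof
    fix K f assume K: "O.op_subgroup K" and f: "f \<in> O.op_hom K"
    obtain \<rho> where \<rho>: "subcomodule_via A C M K \<rho>" using K sub_iff unfolding subcomodule_def by blast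
    note KD = subcomodule_viaD[OF M ldb \<rho>]
    \<comment> \<open>The action on \<open>K\<close> computed from \<open>\<rho>\<close> is that of
      \<open>M\<close>, so commuting with the operators already makes \<open>f\<close> colinear for
      this \<open>\<rho>\<close>.\<close>
    have fh: "f \<in> comod_hom A C (M\<lparr>carrier := K, coact := \<rho>\<rparr>) M"
      unfolding comod_hom_iff[OF KD(2) M ldb]
      using O.op_homD[OF f] KD(3) by (simp add: additive_map_def)
    have "\<exists>g\<in>comod_hom A C M M. \<forall>x\<in>K. g x = f x"
      by (rule \<open>self_injective A C M\<close>[unfolded self_injective_def, THEN spec, THEN spec, THEN mp,
          OF \<rho>, THEN bspec, OF fh])
    then show "\<exists>g\<in>O.op_hom (carrier M). \<forall>x\<in>K. g x = f x" by (simp add: hom_eq)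
  next
    show "\<exists>f\<in>O.op_hom (carrier M). (\<forall>k\<in>K. f k = \<zero>\<^bsub>M\<^esub>) \<and> f x \<noteq> \<zero>\<^bsub>M\<^esub>"
      if "O.op_subgroup K" "x \<in> carrier M" "x \<notin> K" for K x
      using self_cogenerator_separates[OF M ldb \<open>self_cogenerator A C M\<close>] that by (simp add: sub_iff hom_eq)
  next
    show "f (g x) = g (f x)"
      if "f \<in> O.op_hom (carrier M)" "g \<in> O.op_hom (carrier M)" "x \<in> carrier M" for f g x
      using \<open>commutative_comod_end A C M\<close> that by (simp add: hom_iff commutative_comod_end_def)
  next
    fix X Y
    assume X: "O.op_subgroup X" and Y: "O.op_subgroup Y"
      and inv: "\<And>f. f \<in> O.op_hom (carrier M) \<Longrightarrow> f ` X \<subseteq> X" "\<And>f. f \<in> O.op_hom (carrier M) \<Longrightarrow> f ` Y \<subseteq> Y"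
      and co: "\<And>f x. \<lbrakk>f \<in> O.op_hom (carrier M); \<forall>x\<in>X. f x = \<zero>\<^bsub>M\<^esub>; x \<in> carrier M\<rbrakk> \<Longrightarrow> f x \<in> Y"
    have "fully_invariant A C M X" "fully_invariant A C M Y"
      unfolding fully_invariant_def using X Y inv by (simp_all add: sub_iff hom_iff)
    moreover have "carrier M = internal_coproduct A C M X Y"
    proof
      show "carrier M \<subseteq> internal_coproduct A C M X Y"
        using co by (auto simp: internal_coproduct_def hom_iff)
      \<comment> \<open>The zero map makes the intersected family non-empty; an empty intersection
        would be the whole type rather than a subset of \<open>carrier M\<close>.\<close>
      have "(\<lambda>_. \<zero>\<^bsub>M\<^esub>) \<in> O.op_hom (carrier M)"
        by (rule O.op_homI) (simp_all add: O.op_zero)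
      then show "internal_coproduct A C M X Y \<subseteq> carrier M"
        by (auto simp: internal_coproduct_def hom_iff)
    qed
    ultimately show "X = carrier M \<or> Y = carrier M"
      using \<open>fully_coprime A C M\<close> unfolding fully_coprime_def by blast
  qed
  obtain S where S: "O.op_subgroup S" "S \<noteq> {\<zero>\<^bsub>M\<^esub>}"
    "\<And>K. \<lbrakk>O.op_subgroup K; K \<noteq> {\<zero>\<^bsub>M\<^esub>}\<rbrakk> \<Longrightarrow> S \<subseteq> K"
    by (rule O.irreducible[OF \<open>carrier M \<noteq> {\<zero>\<^bsub>M\<^esub>}\<close>]) blast
  obtain \<rho> where \<rho>: "subcomodule_via A C M S \<rho>" using S(1) sub_iff unfolding subcomodule_def by blast
  note SD = subcomodule_viaD[OF M ldb \<rho>]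
  let ?S = "M\<lparr>carrier := S, coact := \<rho>\<rparr>"
  \<comment> \<open>A subcomodule of \<open>?S\<close> is stable under the operators of
    \<open>M\<close>, since those of \<open>?S\<close> are their restrictions; if non-zero, it
    contains the least such subgroup, which is \<open>S\<close>.\<close>
  have "simple_comodule A C ?S"
    unfolding simple_comodule_def
  proof (intro conjI allI impI)
    show "carrier ?S \<noteq> {\<zero>\<^bsub>?S\<^esub>}" using S(2) by simp
    fix K assume "subcomodule A C ?S K"
    then obtain \<sigma> where \<sigma>: "subcomodule_via A C ?S K \<sigma>" unfolding subcomodule_def ..
    note KD = subcomodule_viaD[OF SD(2) ldb \<sigma>]
    have KS: "K \<subseteq> S" using KD(1) by simp
    have KM: "K \<subseteq> carrier M" using KS SD(1) by blast
    have "O.op_subgroup K"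
    proof (rule O.op_subgroupI[OF KM])
      show "\<zero>\<^bsub>M\<^esub> \<in> K" using KD(5) by simp
      show "x \<oplus>\<^bsub>M\<^esub> y \<in> K" if "x \<in> K" "y \<in> K" for x y using KD(6)[OF that] by simp
      show "comod_act M \<phi> x \<in> K" if "\<phi> \<in> left_dual A C" "x \<in> K" for \<phi> x
        using KD(4)[OF that] SD(3)[OF that(1)] KS that(2) by auto
      show "\<ominus>\<^bsub>M\<^esub> x \<in> K" if "x \<in> K" for x
      proof -
        have "additive_map ?S M (\<lambda>x. x)" using SD(1) by (auto simp: additive_map_def)
        from additive_map_minus[OF this right_moduleD(1)[OF right_comoduleD(3)[OF SD(2)]] M.abelian_group_axioms, of x]
        show ?thesis using KD(7)[OF that] KS that by auto
      qed
    qed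
    then show "K = {\<zero>\<^bsub>?S\<^esub>} \<or> K = carrier ?S" using S(3) KS by auto
  qed
  then have simple: "simple_subcomodule A C M S" unfolding simple_subcomodule_def using \<rho> by blast
  have least: "S \<subseteq> K" if "subcomodule A C M K" "K \<noteq> {\<zero>\<^bsub>M\<^esub>}" for K using S(3) that sub_iff by blast
  show ?thesis
    unfolding irreducible_comodule_def
  proof (rule ex1I[of _ S])
    show "simple_subcomodule A C M S \<and> (\<forall>K. subcomodule A C M K \<and> K \<noteq> {\<zero>\<^bsub>M\<^esub>} \<longrightarrow> S \<subseteq> K)"
      using simple least by blast
    fix S' assume S': "simple_subcomodule A C M S' \<and> (\<forall>K. subcomodule A C M K \<and> K \<noteq> {\<zero>\<^bsub>M\<^esub>} \<longrightarrow> S' \<subseteq> K)"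
    then have "subcomodule A C M S'" "S' \<noteq> {\<zero>\<^bsub>M\<^esub>}"
      by (auto simp: simple_subcomodule_def subcomodule_def simple_comodule_def)
    \<comment> \<open>Both are least among the non-zero subcomodules, so each contains the
      other.\<close>
    then show "S' = S" using least S' S(1,2) sub_iff by blast
  qed
qed

end
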